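(* Let $\alpha=\{\alpha_k\}_{k\in\mathbb{Z}}\subset\mathbb{D}$ be a reflectionless sequence of Verblunsky coefficients, and let $U$ be the associated unitary CMV operator on $\ell^2(\mathbb{Z})$. Suppose that the spectrum of $U$ consists of a connected arc of $\partial\mathbb{D}$, $$\sigma(U)=\operatorname{Arc}\big(\big[e^{i\theta_0},e^{i\theta_1}\big]\big)$$ with $\theta_0\in[0,2\pi]$, $\theta_0<\theta_1\le\theta_0+2\pi$ (and hence $e^{i(\theta_0+\theta_1)/2}\in\operatorname{Arc}\big(\big(e^{i\theta_0},e^{i\theta_1}\big)\big)$). Then $\alpha$ is of the form $$\alpha_k=\alpha_0\, g^k,\quad k\in\mathbb{Z},$$ where $$g=-\exp(i(\theta_0+\theta_1)/2)\quad\text{and}\quad |\alpha_0|=\cos((\theta_1-\theta_0)/4).$$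
   Context: Notation. $\mathbb{D}=\{z\in\mathbb{C}: |z|<1\}$, $\partial\mathbb{D}$ is the unit circle, $\mu_0$ is normalized Lebesgue measure on $\partial\mathbb{D}$ ($d\mu_0=d\theta/(2\pi)$). $\operatorname{Arc}([e^{i\theta_0},e^{i\theta_1}])=\{e^{i\theta}:\theta_0\le\theta\le\theta_1\}$ and $\operatorname{Arc}((e^{i\theta_0},e^{i\theta_1}))=\{e^{i\theta}:\theta_0<\theta<\theta_1\}$. The scalar product on $\ell^2$ is linear in the second argument and $\{\delta_k\}$ is the standard basis. $\sigma(\cdot)$ and $\sigma_{\rm ess}(\cdot)$ denote spectrum and essential spectrum. CMV operator. For $\alpha=\{\alpha_k\}_{k\in\mathbb{Z}}\subset\mathbb{D}$ (the Verblunsky coefficients) put $\rho_k=\sqrt{1-|\alpha_k|^2}$ and $$\theta_k=\begin{pmatrix}-\alpha_k&\rho_k\\ \rho_k&\overline{\alpha_k}\end{pmatrix},\quad k\in\mathbb{Z}.$$ Let $V$ be the block-diagonal unitary operator on $\ell^2(\mathbb{Z})$ whose block on the indices $\{2k-1,2k\}$ is $\theta_{2k}$, and $W$ the block-diagonal unitary operator whose block on the indices $\{2k,2k+1\}$ is $\theta_{2k+1}$, $k\in\mathbb{Z}$. The CMV operator is the unitary operator $U=VW$ on $\ell^2(\mathbb{Z})$. Half-lattice operators. If for some $k_0$ the entry $\alpha_{k_0}$ is replaced by $1$ (so $\rho_{k_0}$ is replaced by $0$), all other entries being kept, then the resulting operator $VW$ splits as a direct sum $U_{-,k_0-1}\oplus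 U_{+,k_0}$ on $\ell^2((-\infty,k_0-1]\cap\mathbb{Z})\oplus\ell^2([k_0,\infty)\cap\mathbb{Z})$. This defines $U_{\pm,k_0}$ for all $k_0\in\mathbb{Z}$ ($U_{-,k_0}$ arises by replacing $\alpha_{k_0+1}$ by $1$). Weyl–Titchmarsh functions. For $z\in\mathbb{C}\setminus\partial\mathbb{D}$, $k\in\mathbb{Z}$, let $$m_\pm(z,k)=\pm\big(\delta_k,(U_{\pm,k}+zI)(U_{\pm,k}-zI)^{-1}\delta_k\big),$$ and, with $a_k=1+\alpha_k$, $b_k=1-\alpha_k$, $$M_+(z,k)=m_+(z,k),\qquad M_-(z,k)=\frac{\operatorname{Re}(a_k)+i\operatorname{Im}(b_k)\,m_-(z,k-1)}{i\operatorname{Im}(a_k)+\operatorname{Re}(b_k)\,m_-(z,k-1)}.$$ On $\mathbb{D}$, $M_+(\cdot,k)$ and $-M_-(\cdot,k)$ are analytic with positive real part, so the radial limits $M_\pm(\zeta,k)=\lim_{r\uparrow1}M_\pm(r\zeta,k)$ exist for $\mu_0$-a.e. $\zeta\in\partial\mathbb{D}$. Reflectionless. $\alpha$ (resp. $U$) is called reflectionless if for all $k\in\mathbb{Z}$, $M_+(\zeta,k)=-\overline{M_-(\zeta,k)}$ for $\mu_0$-a.e. $\zeta\in\sigma_{\rm ess}(U)$. *)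

theory Defs
  imports "HOL-Analysis.Analysis"
begin

section \<open>The Hilbert space of square-summable sequences\<close>

text \<open>The space over an index set \<open>S\<close> of integers is realised inside \<open>int \<Rightarrow> complex\<close> by the
  sequences vanishing off \<open>S\<close>. An operator on it is a function on sequences, considered on
  \<open>l2 S\<close> only.\<close>

definition l2 :: "int set \<Rightarrow> (int \<Rightarrow> complex) set" where
  "l2 S = {f. (\<lambda>k. (cmod (f k))\<^sup>2) summable_on UNIV \<and> (\<forall>k. k \<notin> S \<longrightarrow> f k = 0)}"

definition l2_inner :: "(int \<Rightarrow> complex) \<Rightarrow> (int \<Rightarrow> complex) \<Rightarrow> complex" where
  "l2_inner f g = (\<Sum>\<^sub>\<infinity>k. cnj (f k) * g k)"

definition l2_norm :: "(int \<Rightarrow> complex) \<Rightarrow> real" where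
  "l2_norm f = sqrt (\<Sum>\<^sub>\<infinity>k. (cmod (f k))\<^sup>2)"

definition delta :: "int \<Rightarrow> int \<Rightarrow> complex" where
  "delta k = (\<lambda>n. if n = k then 1 else 0)"

type_synonym seq_op = "(int \<Rightarrow> complex) \<Rightarrow> (int \<Rightarrow> complex)"

definition add_scalar :: "seq_op \<Rightarrow> complex \<Rightarrow> seq_op" where
  "add_scalar T z = (\<lambda>f n. T f n + z * f n)"


section \<open>Spectrum and essential spectrum\<close>

definition resolvent :: "int set \<Rightarrow> seq_op \<Rightarrow> complex \<Rightarrow> seq_op" where
  "resolvent S T z = inv_into (l2 S) (add_scalar T (- z))"

definition resolvent_set :: "int set \<Rightarrow> seq_op \<Rightarrow> complex set" where
  "resolvent_set S T = {z. bij_betw (add_scalar T (- z)) (l2 S) (l2 S) \<and>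
     (\<exists>C. \<forall>f\<in>l2 S. l2_norm (resolvent S T z f) \<le> C * l2_norm f)}"

definition op_spectrum :: "int set \<Rightarrow> seq_op \<Rightarrow> complex set" where
  "op_spectrum S T = - resolvent_set S T"

definition eigenspace :: "int set \<Rightarrow> seq_op \<Rightarrow> complex \<Rightarrow> (int \<Rightarrow> complex) set" where
  "eigenspace S T z = {f \<in> l2 S. \<forall>n. T f n = z * f n}"

definition finite_dimensional :: "(int \<Rightarrow> complex) set \<Rightarrow> bool" where
  "finite_dimensional E \<longleftrightarrow>
     (\<exists>B. finite B \<and> B \<subseteq> E \<and> (\<forall>f\<in>E. \<exists>c. f = (\<lambda>n. \<Sum>b\<in>B. c b * b n)))"

text \<open>Isolated eigenvalues of finite multiplicity. The definition is meant for normal operators,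
  for which the geometric and the algebraic multiplicity agree.\<close>

definition discrete_spectrum :: "int set \<Rightarrow> seq_op \<Rightarrow> complex set" where
  "discrete_spectrum S T = {z. z isolated_in op_spectrum S T \<and>
     eigenspace S T z \<noteq> {\<lambda>_. 0} \<and> finite_dimensional (eigenspace S T z)}"

definition essential_spectrum :: "int set \<Rightarrow> seq_op \<Rightarrow> complex set" where
  "essential_spectrum S T = op_spectrum S T - discrete_spectrum S T"


section \<open>CMV operators\<close>

definition rho :: "(int \<Rightarrow> complex) \<Rightarrow> int \<Rightarrow> real" where
  "rho \<alpha> k = sqrt (1 - (cmod (\<alpha> k))\<^sup>2)"

definition theta_block :: "(int \<Rightarrow> complex) \<Rightarrow> int \<Rightarrow> complex^2^2" where
  "theta_block \<alpha> k = vector [vector [- \<alpha> k, of_real (rho \<alpha> k)],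
                            vector [of_real (rho \<alpha> k), cnj (\<alpha> k)]]"

text \<open>The block \<open>theta_block \<alpha> j\<close> always acts on the indices \<open>j - 1, j\<close>; the even \<open>j\<close> belong
  to \<open>V\<close>, the odd ones to \<open>W\<close>.\<close>

definition theta_apply :: "(int \<Rightarrow> complex) \<Rightarrow> int \<Rightarrow> (int \<Rightarrow> complex) \<Rightarrow> complex^2" where
  "theta_apply \<alpha> j f = theta_block \<alpha> j *v vector [f (j - 1), f j]"

definition cmv_V :: "(int \<Rightarrow> complex) \<Rightarrow> seq_op" where
  "cmv_V \<alpha> f = (\<lambda>n. if even n then theta_apply \<alpha> n f $ 2 else theta_apply \<alpha> (n + 1) f $ 1)"

definition cmv_W :: "(int \<Rightarrow> complex) \<Rightarrow> seq_op" where
  "cmv_W \<alpha> f = (\<lambda>n. if odd n then theta_apply \<alpha> n f $ 2 else theta_apply \<alpha> (n + 1) f $ 1)"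

definition cmv :: "(int \<Rightarrow> complex) \<Rightarrow> seq_op" where
  "cmv \<alpha> = cmv_V \<alpha> \<circ> cmv_W \<alpha>"

text \<open>Half-lattice operators: replacing \<open>\<alpha> k\<close> by \<open>1\<close> makes \<open>cmv\<close> leave \<open>l2 {..k - 1}\<close> and
  \<open>l2 {k..}\<close> invariant. The operator \<open>cmv_plus \<alpha> k\<close> is to be read on \<open>l2 {k..}\<close>, and
  \<open>cmv_minus \<alpha> k\<close> on \<open>l2 {..k}\<close>.\<close>

definition cmv_plus :: "(int \<Rightarrow> complex) \<Rightarrow> int \<Rightarrow> seq_op" where
  "cmv_plus \<alpha> k = cmv (\<alpha>(k := 1))"

definition cmv_minus :: "(int \<Rightarrow> complex) \<Rightarrow> int \<Rightarrow> seq_op" where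
  "cmv_minus \<alpha> k = cmv (\<alpha>(k + 1 := 1))"

lemma cmv_splits:
  "(\<And>n. n < k \<Longrightarrow> f n = 0) \<Longrightarrow> n < k \<Longrightarrow> cmv (\<alpha>(k := 1)) f n = 0"
  "(\<And>n. n \<ge> k \<Longrightarrow> f n = 0) \<Longrightarrow> n \<ge> k \<Longrightarrow> cmv (\<alpha>(k := 1)) f n = 0"
  by (cases "n = k"; cases "n + 1 = k";
      force simp: cmv_def cmv_V_def cmv_W_def theta_apply_def theta_block_def rho_def
        matrix_vector_mult_def sum_2)+


section \<open>Weyl--Titchmarsh functions\<close>

definition m_plus :: "(int \<Rightarrow> complex) \<Rightarrow> complex \<Rightarrow> int \<Rightarrow> complex" where
  "m_plus \<alpha> z k = l2_inner (delta k)
     (add_scalar (cmv_plus \<alpha> k) z (resolvent {k..} (cmv_plus \<alpha> k) z (delta k)))"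

definition m_minus :: "(int \<Rightarrow> complex) \<Rightarrow> complex \<Rightarrow> int \<Rightarrow> complex" where
  "m_minus \<alpha> z k = - l2_inner (delta k)
     (add_scalar (cmv_minus \<alpha> k) z (resolvent {..k} (cmv_minus \<alpha> k) z (delta k)))"

definition M_plus :: "(int \<Rightarrow> complex) \<Rightarrow> complex \<Rightarrow> int \<Rightarrow> complex" where
  "M_plus \<alpha> z k = m_plus \<alpha> z k"

definition M_minus :: "(int \<Rightarrow> complex) \<Rightarrow> complex \<Rightarrow> int \<Rightarrow> complex" where
  "M_minus \<alpha> z k = (let a = 1 + \<alpha> k; b = 1 - \<alpha> k in
     (of_real (Re a) + \<i> * of_real (Im b) * m_minus \<alpha> z (k - 1)) /
     (\<i> * of_real (Im a) + of_real (Re b) * m_minus \<alpha> z (k - 1)))"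


section \<open>Reflectionless Verblunsky coefficients\<close>

definition mu0 :: "complex measure" where
  "mu0 = distr (uniform_measure lborel {0..2 * pi}) (restrict_space borel (sphere 0 1)) cis"

lemma emeasure_mu0_sphere: "emeasure mu0 (sphere 0 1) = 1"
proof -
  have "cis \<in> borel_measurable borel"
    by (intro borel_measurable_continuous_onI continuous_intros)
  then have cis: "cis \<in> measurable (uniform_measure lborel {0..2 * pi})
      (restrict_space borel (sphere 0 1))"
    by (auto intro!: measurable_restrict_space2 simp: dist_norm)
  show ?thesis
    unfolding mu0_def
    by (subst emeasure_distr[OF cis])
       (auto simp: sets_restrict_space vimage_def ennreal_divide_self)
qed

definition has_radial_limit :: "(complex \<Rightarrow> complex) \<Rightarrow> complex \<Rightarrow> complex \<Rightarrow> bool" where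
  "has_radial_limit F \<zeta> w \<longleftrightarrow> ((\<lambda>r::real. F (of_real r * \<zeta>)) \<longlongrightarrow> w) (at_left 1)"

text \<open>The radial limits exist almost everywhere on the unit circle, so demanding their existence
  inside the almost-everywhere quantifier excludes nothing.\<close>

definition reflectionless :: "(int \<Rightarrow> complex) \<Rightarrow> bool" where
  "reflectionless \<alpha> \<longleftrightarrow>
     (\<forall>k. AE \<zeta> in mu0. \<zeta> \<in> essential_spectrum UNIV (cmv \<alpha>) \<longrightarrow>
        (\<exists>w\<^sub>p w\<^sub>m. has_radial_limit (\<lambda>z. M_plus \<alpha> z k) \<zeta> w\<^sub>p \<and>
                 has_radial_limit (\<lambda>z. M_minus \<alpha> z k) \<zeta> w\<^sub>m \<and>
                 w\<^sub>p = - cnj w\<^sub>m))"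


section \<open>Arcs\<close>

definition arc_closed :: "real \<Rightarrow> real \<Rightarrow> complex set" where
  "arc_closed s t = {cis \<theta> |\<theta>. s \<le> \<theta> \<and> \<theta> \<le> t}"

definition arc_open :: "real \<Rightarrow> real \<Rightarrow> complex set" where
  "arc_open s t = {cis \<theta> |\<theta>. s < \<theta> \<and> \<theta> < t}"

end

theory Submission
  imports Defs "HOL-Complex_Analysis.Complex_Analysis"
begin

text \<open>
  Decouple the lattice at \<open>k\<close>. The two half-lattice operators yield Schur functions
  \<open>S\<^sub>+ = (M\<^sub>+ - 1) / (M\<^sub>+ + 1)\<close> and \<open>S\<^sub>- = (M\<^sub>- + 1) / (M\<^sub>- - 1)\<close> with \<open>S\<^sub>+(0) = 0\<close> and
  \<open>S\<^sub>-(0) = \<alpha>\<^sub>k\<close>. Reflectionlessness says \<open>S\<^sub>+ = cnj S\<^sub>-\<close> almost everywhere on the arc, so \<open>S\<^sub>+\<close>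
  inside the disc and the reflection of \<open>S\<^sub>-\<close> outside glue to one holomorphic function bounded by
  1 on the sphere minus the gap, with value \<open>0\<close> at \<open>0\<close> and \<open>cnj \<alpha>\<^sub>k\<close> at infinity. Uniformizing that
  domain by a half-plane, the Schwarz lemma gives \<open>\<bar>\<alpha>\<^sub>k\<bar> \<le> cos ((\<theta>\<^sub>1 - \<theta>\<^sub>0) / 4)\<close>.

  The diagonal Green function is \<open>(1 + S\<^sub>+ S\<^sub>-) / (1 - S\<^sub>+ S\<^sub>-)\<close>. It has positive real part on the
  half-plane, and since the gap lies in the resolvent set it is continuous and purely imaginary
  there. Hence it extends by reflection to an odd function holomorphic off \<open>0\<close>, and by Liouville's
  theorem it must be \<open>a p + b / p\<close>. Its derivative at the point over \<open>0\<close> determines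
  \<open>\<alpha>\<^sub>k cnj \<alpha>\<^sub>k\<^sub>+\<^sub>1\<close>, whose modulus is the square of the above bound, so equality holds for every \<open>k\<close>.
\<close>

section \<open>CMV operators as isometries\<close>

text \<open>The boundary identity is known only almost everywhere and only along radii, so the two
  halves cannot be pasted directly. Their primitives can: a bounded function has a Lipschitz
  primitive, continuous up to the boundary, and dominated convergence turns the identity into
  equality of the primitives up to a constant. Differentiating gives back the functions, now with
  genuine limits at every point of the open arc. Nothing is known at the two endpoints of the arc.
  The uniformization places them at \<open>p = 0\<close> and at infinity, where the only control on
  the Green function is the bound of size \<open>(cmod p + 1)^2 / Re p\<close> that the Schwarz
  lemma provides. It degenerates along the imaginary axis, and repairing this is what makes
  Liouville's theorem applicable. The derivative argument requires a gap. The full circle is treated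
  by the upper bound alone, applied to proper subarcs that exhaust it.\<close>

definition square_summable :: "(int \<Rightarrow> complex) \<Rightarrow> bool" where
  "square_summable f \<longleftrightarrow> (\<lambda>k. (cmod (f k))\<^sup>2) summable_on UNIV"

definition energy :: "(int \<Rightarrow> complex) \<Rightarrow> real" where
  "energy f = (\<Sum>\<^sub>\<infinity>k. (cmod (f k))\<^sup>2)"

lemma l2_UNIV_iff: "f \<in> l2 UNIV \<longleftrightarrow> square_summable f"
  by (simp add: l2_def square_summable_def)

lemma l2_iff: "f \<in> l2 S \<longleftrightarrow> square_summable f \<and> (\<forall>k. k \<notin> S \<longrightarrow> f k = 0)"
  by (simp add: l2_def square_summable_def)

lemma energy_nonneg: "0 \<le> energy f"
  unfolding energy_def by (intro infsum_nonneg) auto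

lemma norm_sq_le_energy: "square_summable f \<Longrightarrow> (cmod (f k))\<^sup>2 \<le> energy f"
  using finite_sum_le_infsum[of "\<lambda>k. (cmod (f k))\<^sup>2" UNIV "{k}"]
  by (simp add: square_summable_def energy_def)

lemma cmod_add_sq_le: "(cmod (a + b))\<^sup>2 \<le> 2 * (cmod a)\<^sup>2 + 2 * (cmod b)\<^sup>2"
proof -
  have "(cmod (a + b))\<^sup>2 \<le> (cmod a + cmod b)\<^sup>2"
    by (intro power_mono norm_triangle_ineq) auto
  also have "\<dots> \<le> 2 * (cmod a)\<^sup>2 + 2 * (cmod b)\<^sup>2"
    using sum_squares_bound[of "cmod a" "cmod b"] by (simp add: power2_sum)
  finally show ?thesis .
qed

lemma square_summable_add:
  assumes "square_summable f" "square_summable g"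
  shows "square_summable (\<lambda>n. f n + g n)"
    and "energy (\<lambda>n. f n + g n) \<le> 2 * energy f + 2 * energy g"
proof -
  have s: "(\<lambda>k. 2 * (cmod (f k))\<^sup>2 + 2 * (cmod (g k))\<^sup>2) summable_on UNIV"
    using assms by (intro summable_on_add summable_on_cmult_right) (auto simp: square_summable_def)
  show 1: "square_summable (\<lambda>n. f n + g n)"
    unfolding square_summable_def
    by (rule summable_on_comparison_test[OF s]) (auto simp: cmod_add_sq_le)
  have "energy (\<lambda>n. f n + g n) \<le> (\<Sum>\<^sub>\<infinity>k. 2 * (cmod (f k))\<^sup>2 + 2 * (cmod (g k))\<^sup>2)"
    unfolding energy_def using 1
    by (intro infsum_mono s) (auto simp: square_summable_def cmod_add_sq_le)
  also have "\<dots> = 2 * energy f + 2 * energy g"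
    using assms unfolding energy_def square_summable_def
    by (subst infsum_add) (auto intro: summable_on_cmult_right simp: infsum_cmult_right)
  finally show "energy (\<lambda>n. f n + g n) \<le> 2 * energy f + 2 * energy g" .
qed

lemma square_summable_scale:
  assumes "square_summable f"
  shows "square_summable (\<lambda>n. c * f n)" "energy (\<lambda>n. c * f n) = (cmod c)\<^sup>2 * energy f"
  using assms unfolding square_summable_def energy_def
  by (auto simp: norm_mult power_mult_distrib infsum_cmult_right intro: summable_on_cmult_right)

lemma square_summable_diff:
  assumes "square_summable f" "square_summable g"
  shows "square_summable (\<lambda>n. f n - g n)"
  using square_summable_add(1)[OF assms(1) square_summable_scale(1)[OF assms(2), of "-1"]] by simp

lemma energy_delta: "square_summable (delta k)" "energy (delta k) = 1"
proof -
  have s: "((\<lambda>n. (cmod (delta k n))\<^sup>2) has_sum 1) UNIV"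
    by (rule has_sum_finite_neutralI[of "{k}"]) (auto simp: delta_def)
  show "square_summable (delta k)"
    unfolding square_summable_def using s by (auto simp: summable_on_def)
  show "energy (delta k) = 1"
    unfolding energy_def using s by (rule infsumI)
qed

text \<open>Only the entry at \<open>k\<close> changes. This is how norm identities for the
  resolvent equation become statements about a single diagonal entry.\<close>

lemma energy_add_delta:
  assumes "square_summable f"
  shows "energy (\<lambda>n. f n + delta k n) = energy f + 2 * Re (f k) + 1"
proof -
  have eq: "(cmod (f n + delta k n))\<^sup>2 = (cmod (f n))\<^sup>2 + (if n = k then 2 * Re (f k) + 1 else 0)" for n
    unfolding cmod_power2 by (auto simp: delta_def power2_eq_square algebra_simps)
  have s: "((\<lambda>n. if n = k then 2 * Re (f k) + 1 else 0) has_sum (2 * Re (f k) + 1)) UNIV"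
    by (rule has_sum_finite_neutralI[of "{k}"]) auto
  have "((\<lambda>n. (cmod (f n))\<^sup>2 + (if n = k then 2 * Re (f k) + 1 else 0)) has_sum
      (energy f + (2 * Re (f k) + 1))) UNIV"
    unfolding energy_def using assms
    by (intro has_sum_add s has_sum_infsum) (simp add: square_summable_def)
  then show ?thesis
    unfolding energy_def eq by (simp add: infsumI)
qed

text \<open>Sum the hypothesis over all \<open>n\<close>: reindexing along the bijection
  \<open>p\<close> shows that each total occurs twice on its side. No regrouping into blocks of two
  is involved.\<close>

lemma energy_eq_by_pairs:
  assumes f: "square_summable f" and p: "bij_betw p UNIV UNIV"
    and eq: "\<And>n. (cmod (g n))\<^sup>2 + (cmod (g (p n)))\<^sup>2 = (cmod (f n))\<^sup>2 + (cmod (f (p n)))\<^sup>2"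
  shows "square_summable g" "energy g = energy f"
proof -
  have fp: "(\<lambda>n. (cmod (f (p n)))\<^sup>2) summable_on UNIV"
    using f summable_on_reindex_bij_betw[OF p, of "\<lambda>n. (cmod (f n))\<^sup>2"]
    by (simp add: square_summable_def)
  have fs: "(\<lambda>n. (cmod (f n))\<^sup>2) summable_on UNIV"
    using f by (simp add: square_summable_def)
  have gs: "(\<lambda>n. (cmod (g n))\<^sup>2) summable_on UNIV"
    by (rule summable_on_comparison_test[OF summable_on_add[OF fs fp]])
       (auto simp: eq[symmetric])
  then show "square_summable g"
    by (simp add: square_summable_def)
  have gp: "(\<lambda>n. (cmod (g (p n)))\<^sup>2) summable_on UNIV"
    using gs summable_on_reindex_bij_betw[OF p, of "\<lambda>n. (cmod (g n))\<^sup>2"] by simp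
  have "2 * energy g = energy g + (\<Sum>\<^sub>\<infinity>n. (cmod (g (p n)))\<^sup>2)"
    unfolding energy_def using infsum_reindex_bij_betw[OF p, of "\<lambda>n. (cmod (g n))\<^sup>2"] by simp
  also have "\<dots> = energy f + (\<Sum>\<^sub>\<infinity>n. (cmod (f (p n)))\<^sup>2)"
    unfolding energy_def by (simp add: infsum_add[symmetric] gs gp fs fp eq)
  also have "\<dots> = 2 * energy f"
    unfolding energy_def using infsum_reindex_bij_betw[OF p, of "\<lambda>n. (cmod (f n))\<^sup>2"] by simp
  finally show "energy g = energy f"
    by simp
qed

lemma theta_apply_nth:
  "theta_apply \<alpha> j f $ 1 = - \<alpha> j * f (j - 1) + of_real (rho \<alpha> j) * f j"
  "theta_apply \<alpha> j f $ 2 = of_real (rho \<alpha> j) * f (j - 1) + cnj (\<alpha> j) * f j"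
  by (simp_all add: theta_apply_def theta_block_def matrix_vector_mult_def sum_2)

lemma cmv_V_apply:
  "cmv_V \<alpha> f n = (if even n then of_real (rho \<alpha> n) * f (n - 1) + cnj (\<alpha> n) * f n
     else - \<alpha> (n + 1) * f n + of_real (rho \<alpha> (n + 1)) * f (n + 1))"
  by (simp add: cmv_V_def theta_apply_nth)

lemma cmv_W_apply:
  "cmv_W \<alpha> f n = (if odd n then of_real (rho \<alpha> n) * f (n - 1) + cnj (\<alpha> n) * f n
     else - \<alpha> (n + 1) * f n + of_real (rho \<alpha> (n + 1)) * f (n + 1))"
  by (simp add: cmv_W_def theta_apply_nth)

lemma rho_sq: "cmod (\<alpha> k) \<le> 1 \<Longrightarrow> (rho \<alpha> k)\<^sup>2 = 1 - (cmod (\<alpha> k))\<^sup>2"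
  by (simp add: rho_def power_le_one)

lemma rho_cnj [simp]: "rho (\<lambda>n. cnj (\<alpha> n)) k = rho \<alpha> k"
  by (simp add: rho_def)

lemma block_isometry:
  assumes "r\<^sup>2 = 1 - (cmod a)\<^sup>2"
  shows "(cmod (- a * x + of_real r * y))\<^sup>2 + (cmod (of_real r * x + cnj a * y))\<^sup>2
    = (cmod x)\<^sup>2 + (cmod y)\<^sup>2"
proof -
  have "(cmod (- a * x + of_real r * y))\<^sup>2 + (cmod (of_real r * x + cnj a * y))\<^sup>2
    = ((cmod a)\<^sup>2 + r\<^sup>2) * ((cmod x)\<^sup>2 + (cmod y)\<^sup>2)"
    unfolding cmod_power2 by (simp add: power2_eq_square algebra_simps)
  then show ?thesis
    using assms by simp
qed

lemma even_partner_bij: "bij_betw (\<lambda>n::int. if even n then n - 1 else n + 1) UNIV UNIV"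
  by (rule bij_betw_byWitness[where f' = "\<lambda>n. if even n then n - 1 else n + 1"]) auto

lemma odd_partner_bij: "bij_betw (\<lambda>n::int. if odd n then n - 1 else n + 1) UNIV UNIV"
  by (rule bij_betw_byWitness[where f' = "\<lambda>n. if odd n then n - 1 else n + 1"]) auto

text \<open>The bound on the coefficients is not strict, so that the decoupled sequence
  \<open>\<alpha>(k := 1)\<close>, with a vanishing \<open>rho\<close> at \<open>k\<close>, is
  covered as well.\<close>

lemma cmv_V_isometry:
  assumes "\<And>k. cmod (\<alpha> k) \<le> 1" "square_summable f"
  shows "square_summable (cmv_V \<alpha> f)" "energy (cmv_V \<alpha> f) = energy f"
proof -
  have "(cmod (cmv_V \<alpha> f n))\<^sup>2 + (cmod (cmv_V \<alpha> f (if even n then n - 1 else n + 1)))\<^sup>2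
      = (cmod (f n))\<^sup>2 + (cmod (f (if even n then n - 1 else n + 1)))\<^sup>2" for n
  proof (cases "even n")
    case True
    have "cmv_V \<alpha> f n = of_real (rho \<alpha> n) * f (n - 1) + cnj (\<alpha> n) * f n"
      "cmv_V \<alpha> f (n - 1) = - \<alpha> n * f (n - 1) + of_real (rho \<alpha> n) * f n"
      using True by (simp_all add: cmv_V_apply)
    note eq = this
    have "(cmod (cmv_V \<alpha> f n))\<^sup>2 + (cmod (cmv_V \<alpha> f (n - 1)))\<^sup>2
        = (cmod (f n))\<^sup>2 + (cmod (f (n - 1)))\<^sup>2"
      unfolding eq add.commute[of "(cmod (f n))\<^sup>2"]
      by (rule trans[OF add.commute block_isometry[OF rho_sq[where \<alpha> = \<alpha>, OF assms(1)[of n]]]])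
    then show ?thesis
      using True by (simp only: if_True not_False_eq_True)
  next
    case False
    have "cmv_V \<alpha> f n = - \<alpha> (n + 1) * f n + of_real (rho \<alpha> (n + 1)) * f (n + 1)"
      "cmv_V \<alpha> f (n + 1) = of_real (rho \<alpha> (n + 1)) * f n + cnj (\<alpha> (n + 1)) * f (n + 1)"
      using False by (simp_all add: cmv_V_apply)
    then have "(cmod (cmv_V \<alpha> f n))\<^sup>2 + (cmod (cmv_V \<alpha> f (n + 1)))\<^sup>2
        = (cmod (f n))\<^sup>2 + (cmod (f (n + 1)))\<^sup>2"
      using block_isometry[OF rho_sq[where \<alpha> = \<alpha>, OF assms(1)[of "n + 1"]], of "f n" "f (n + 1)"]
      by (simp only:)
    then show ?thesis
      using False by (simp only: if_False not_True_eq_False)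
  qed
  note pairs = this
  show "square_summable (cmv_V \<alpha> f)"
    by (rule energy_eq_by_pairs(1)[where g = "cmv_V \<alpha> f", OF assms(2) even_partner_bij]) (rule pairs)
  show "energy (cmv_V \<alpha> f) = energy f"
    by (rule energy_eq_by_pairs(2)[where g = "cmv_V \<alpha> f", OF assms(2) even_partner_bij]) (rule pairs)
qed

lemma cmv_W_isometry:
  assumes "\<And>k. cmod (\<alpha> k) \<le> 1" "square_summable f"
  shows "square_summable (cmv_W \<alpha> f)" "energy (cmv_W \<alpha> f) = energy f"
proof -
  have "(cmod (cmv_W \<alpha> f n))\<^sup>2 + (cmod (cmv_W \<alpha> f (if odd n then n - 1 else n + 1)))\<^sup>2
      = (cmod (f n))\<^sup>2 + (cmod (f (if odd n then n - 1 else n + 1)))\<^sup>2" for n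
  proof (cases "odd n")
    case True
    have "cmv_W \<alpha> f n = of_real (rho \<alpha> n) * f (n - 1) + cnj (\<alpha> n) * f n"
      "cmv_W \<alpha> f (n - 1) = - \<alpha> n * f (n - 1) + of_real (rho \<alpha> n) * f n"
      using True by (simp_all add: cmv_W_apply)
    note eq = this
    have "(cmod (cmv_W \<alpha> f n))\<^sup>2 + (cmod (cmv_W \<alpha> f (n - 1)))\<^sup>2
        = (cmod (f n))\<^sup>2 + (cmod (f (n - 1)))\<^sup>2"
      unfolding eq add.commute[of "(cmod (f n))\<^sup>2"]
      by (rule trans[OF add.commute block_isometry[OF rho_sq[where \<alpha> = \<alpha>, OF assms(1)[of n]]]])
    then show ?thesis
      using True by (simp only: if_True not_False_eq_True)
  next
    case False
    have "cmv_W \<alpha> f n = - \<alpha> (n + 1) * f n + of_real (rho \<alpha> (n + 1)) * f (n + 1)"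
      "cmv_W \<alpha> f (n + 1) = of_real (rho \<alpha> (n + 1)) * f n + cnj (\<alpha> (n + 1)) * f (n + 1)"
      using False by (simp_all add: cmv_W_apply)
    then have "(cmod (cmv_W \<alpha> f n))\<^sup>2 + (cmod (cmv_W \<alpha> f (n + 1)))\<^sup>2
        = (cmod (f n))\<^sup>2 + (cmod (f (n + 1)))\<^sup>2"
      using block_isometry[OF rho_sq[where \<alpha> = \<alpha>, OF assms(1)[of "n + 1"]], of "f n" "f (n + 1)"]
      by (simp only:)
    then show ?thesis
      using False by (simp only: if_False not_True_eq_False)
  qed
  note pairs = this
  show "square_summable (cmv_W \<alpha> f)"
    by (rule energy_eq_by_pairs(1)[where g = "cmv_W \<alpha> f", OF assms(2) odd_partner_bij]) (rule pairs)
  show "energy (cmv_W \<alpha> f) = energy f"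
    by (rule energy_eq_by_pairs(2)[where g = "cmv_W \<alpha> f", OF assms(2) odd_partner_bij]) (rule pairs)
qed

lemma cmv_isometry:
  assumes "\<And>k. cmod (\<alpha> k) \<le> 1" "square_summable f"
  shows "square_summable (cmv \<alpha> f)" "energy (cmv \<alpha> f) = energy f"
  using assms by (simp_all add: cmv_def cmv_V_isometry cmv_W_isometry)

text \<open>Each block is symmetric, so its adjoint is its entrywise conjugate, and that is the
  block of the conjugate coefficient. The factors change order, as in the adjoint of any
  product.\<close>

definition cmv_adj :: "(int \<Rightarrow> complex) \<Rightarrow> seq_op" where
  "cmv_adj \<alpha> = cmv_W (\<lambda>n. cnj (\<alpha> n)) \<circ> cmv_V (\<lambda>n. cnj (\<alpha> n))"

lemma cmv_adj_isometry:
  assumes "\<And>k. cmod (\<alpha> k) \<le> 1" "square_summable f"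
  shows "square_summable (cmv_adj \<alpha> f)" "energy (cmv_adj \<alpha> f) = energy f"
  using assms by (simp_all add: cmv_adj_def cmv_V_isometry cmv_W_isometry)

lemma block_involution:
  assumes "r\<^sup>2 = 1 - (cmod a)\<^sup>2"
  shows "- a * (- cnj a * x + of_real r * y) + of_real r * (of_real r * x + a * y) = x"
    and "of_real r * (- cnj a * x + of_real r * y) + cnj a * (of_real r * x + a * y) = y"
proof -
  have r: "complex_of_real r * of_real r + a * cnj a = 1"
  proof -
    have "complex_of_real r * of_real r + a * cnj a = of_real (r\<^sup>2 + (cmod a)\<^sup>2)"
      by (simp only: of_real_add complex_norm_square) (simp add: power2_eq_square)
    then show ?thesis
      using assms by simp
  qed
  have "- a * (- cnj a * x + of_real r * y) + of_real r * (of_real r * x + a * y)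
      = (complex_of_real r * of_real r + a * cnj a) * x"
    "of_real r * (- cnj a * x + of_real r * y) + cnj a * (of_real r * x + a * y)
      = (complex_of_real r * of_real r + a * cnj a) * y"
    by (simp_all add: algebra_simps)
  then show "- a * (- cnj a * x + of_real r * y) + of_real r * (of_real r * x + a * y) = x"
    and "of_real r * (- cnj a * x + of_real r * y) + cnj a * (of_real r * x + a * y) = y"
    by (simp_all add: r)
qed

section \<open>Inversion, linearity and invariance of the half-lattices\<close>

lemma cmv_V_inverse:
  assumes "\<And>k. cmod (\<alpha> k) \<le> 1"
  shows "cmv_V \<alpha> (cmv_V (\<lambda>n. cnj (\<alpha> n)) f) = f"
proof
  fix n show "cmv_V \<alpha> (cmv_V (\<lambda>n. cnj (\<alpha> n)) f) n = f n"
    using block_involution(2)[OF rho_sq[where \<alpha> = \<alpha>, OF assms(1)[of n]], of "f (n - 1)" "f n"]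
      block_involution(1)[OF rho_sq[where \<alpha> = \<alpha>, OF assms(1)[of "n + 1"]], of "f n" "f (n + 1)"]
    by (auto simp: cmv_V_apply)
qed

lemma cmv_W_inverse:
  assumes "\<And>k. cmod (\<alpha> k) \<le> 1"
  shows "cmv_W \<alpha> (cmv_W (\<lambda>n. cnj (\<alpha> n)) f) = f"
proof
  fix n show "cmv_W \<alpha> (cmv_W (\<lambda>n. cnj (\<alpha> n)) f) n = f n"
    using block_involution(2)[OF rho_sq[where \<alpha> = \<alpha>, OF assms(1)[of n]], of "f (n - 1)" "f n"]
      block_involution(1)[OF rho_sq[where \<alpha> = \<alpha>, OF assms(1)[of "n + 1"]], of "f n" "f (n + 1)"]
    by (auto simp: cmv_W_apply)
qed

lemma cmv_cmv_adj:
  assumes "\<And>k. cmod (\<alpha> k) \<le> 1"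
  shows "cmv \<alpha> (cmv_adj \<alpha> f) = f"
  using assms by (simp add: cmv_def cmv_adj_def cmv_V_inverse cmv_W_inverse)

lemma cmv_V_linear:
  "cmv_V \<alpha> (\<lambda>n. a * f n + b * g n) n = a * cmv_V \<alpha> f n + b * cmv_V \<alpha> g n"
  by (simp add: cmv_V_apply algebra_simps)

lemma cmv_W_linear:
  "cmv_W \<alpha> (\<lambda>n. a * f n + b * g n) n = a * cmv_W \<alpha> f n + b * cmv_W \<alpha> g n"
  by (simp add: cmv_W_apply algebra_simps)

lemma cmv_linear:
  "cmv \<alpha> (\<lambda>n. a * f n + b * g n) n = a * cmv \<alpha> f n + b * cmv \<alpha> g n"
  unfolding cmv_def o_def cmv_W_linear[abs_def] by (rule cmv_V_linear)

lemma cmv_diff: "cmv \<alpha> (\<lambda>n. f n - g n) n = cmv \<alpha> f n - cmv \<alpha> g n"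
  using cmv_linear[of \<alpha> 1 f "-1" g n] by simp

text \<open>Every entry of the image depends on two entries of the argument only, so convergence of
  each entry separately is enough and series can be handled without a topology on sequences.\<close>

lemma cmv_V_sums:
  assumes "\<And>n. (\<lambda>m. x m n) sums f n"
  shows "(\<lambda>m. cmv_V \<alpha> (x m) n) sums cmv_V \<alpha> f n"
  unfolding cmv_V_apply by (cases "even n") (simp_all only: not_True_eq_False not_False_eq_True if_True if_False sums_add sums_mult assms)

lemma cmv_W_sums:
  assumes "\<And>n. (\<lambda>m. x m n) sums f n"
  shows "(\<lambda>m. cmv_W \<alpha> (x m) n) sums cmv_W \<alpha> f n"
  unfolding cmv_W_apply by (cases "even n") (simp_all only: not_True_eq_False not_False_eq_True if_True if_False sums_add sums_mult assms)

lemma cmv_sums: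
  assumes "\<And>n. (\<lambda>m. x m n) sums f n"
  shows "(\<lambda>m. cmv \<alpha> (x m) n) sums cmv \<alpha> f n"
  unfolding cmv_def o_def by (intro cmv_V_sums cmv_W_sums assms)

lemma cmv_V_splits:
  assumes "\<alpha> k = 1"
  shows "(\<And>n. n < k \<Longrightarrow> f n = 0) \<Longrightarrow> n < k \<Longrightarrow> cmv_V \<alpha> f n = 0"
    and "(\<And>n. n \<ge> k \<Longrightarrow> f n = 0) \<Longrightarrow> n \<ge> k \<Longrightarrow> cmv_V \<alpha> f n = 0"
proof -
  have r: "rho \<alpha> k = 0"
    using assms by (simp add: rho_def)
  show "cmv_V \<alpha> f n = 0" if "\<And>n. n < k \<Longrightarrow> f n = 0" "n < k"
    using that r by (cases "n + 1 = k") (auto simp: cmv_V_apply)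
  show "cmv_V \<alpha> f n = 0" if "\<And>n. n \<ge> k \<Longrightarrow> f n = 0" "n \<ge> k"
    using that r by (cases "n = k") (auto simp: cmv_V_apply)
qed

lemma cmv_W_splits:
  assumes "\<alpha> k = 1"
  shows "(\<And>n. n < k \<Longrightarrow> f n = 0) \<Longrightarrow> n < k \<Longrightarrow> cmv_W \<alpha> f n = 0"
    and "(\<And>n. n \<ge> k \<Longrightarrow> f n = 0) \<Longrightarrow> n \<ge> k \<Longrightarrow> cmv_W \<alpha> f n = 0"
proof -
  have r: "rho \<alpha> k = 0"
    using assms by (simp add: rho_def)
  show "cmv_W \<alpha> f n = 0" if "\<And>n. n < k \<Longrightarrow> f n = 0" "n < k"
    using that r by (cases "n + 1 = k") (auto simp: cmv_W_apply)
  show "cmv_W \<alpha> f n = 0" if "\<And>n. n \<ge> k \<Longrightarrow> f n = 0" "n \<ge> k"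
    using that r by (cases "n = k") (auto simp: cmv_W_apply)
qed

text \<open>With \<open>rho\<close> zero at \<open>k\<close> no block links \<open>k - 1\<close> to
  \<open>k\<close>. Hence the iterates of the inverse on a delta, and the series built from them,
  stay on one half-lattice.\<close>

lemma cmv_adj_splits:
  assumes "\<alpha> k = 1"
  shows "(\<And>n. n < k \<Longrightarrow> f n = 0) \<Longrightarrow> n < k \<Longrightarrow> cmv_adj \<alpha> f n = 0"
    and "(\<And>n. n \<ge> k \<Longrightarrow> f n = 0) \<Longrightarrow> n \<ge> k \<Longrightarrow> cmv_adj \<alpha> f n = 0"
proof -
  have c: "(\<lambda>n. cnj (\<alpha> n)) k = 1"
    using assms by simp
  show "cmv_adj \<alpha> f n = 0" if "\<And>n. n < k \<Longrightarrow> f n = 0" "n < k"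
    unfolding cmv_adj_def o_apply
    by (rule cmv_W_splits(1)[where \<alpha> = "\<lambda>n. cnj (\<alpha> n)" and k = k, OF c cmv_V_splits(1)[where \<alpha> = "\<lambda>n. cnj (\<alpha> n)" and k = k, OF c that(1)] that(2)])
  show "cmv_adj \<alpha> f n = 0" if "\<And>n. n \<ge> k \<Longrightarrow> f n = 0" "n \<ge> k"
    unfolding cmv_adj_def o_apply
    by (rule cmv_W_splits(2)[where \<alpha> = "\<lambda>n. cnj (\<alpha> n)" and k = k, OF c cmv_V_splits(2)[where \<alpha> = "\<lambda>n. cnj (\<alpha> n)" and k = k, OF c that(1)] that(2)])
qed

section \<open>Solutions of the resolvent equation inside the disc\<close>

text \<open>Coefficients of the Neumann series: for unitary \<open>U\<close> and \<open>z\<close> in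
  the disc, the inverse of \<open>U - z\<close> is the sum of \<open>z ^ m\<close> times the inverse
  of \<open>U ^ Suc m\<close>. \<open>weyl_sol\<close> sums it entry by entry.\<close>

definition weyl_coeff :: "(int \<Rightarrow> complex) \<Rightarrow> int \<Rightarrow> nat \<Rightarrow> int \<Rightarrow> complex" where
  "weyl_coeff \<alpha> k m = (cmv_adj \<alpha> ^^ Suc m) (delta k)"

definition weyl_sol :: "(int \<Rightarrow> complex) \<Rightarrow> int \<Rightarrow> complex \<Rightarrow> int \<Rightarrow> complex" where
  "weyl_sol \<alpha> k z n = (\<Sum>m. weyl_coeff \<alpha> k m n * z ^ m)"

context
  fixes \<alpha> :: "int \<Rightarrow> complex"
  assumes contr: "\<And>k. cmod (\<alpha> k) \<le> 1"
begin

lemma weyl_coeff_energy: "square_summable (weyl_coeff \<alpha> k m)" "energy (weyl_coeff \<alpha> k m) = 1"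
proof -
  have "square_summable ((cmv_adj \<alpha> ^^ m) (delta k)) \<and> energy ((cmv_adj \<alpha> ^^ m) (delta k)) = 1" for m
    by (induction m) (simp_all add: energy_delta cmv_adj_isometry contr)
  then show "square_summable (weyl_coeff \<alpha> k m)" "energy (weyl_coeff \<alpha> k m) = 1"
    unfolding weyl_coeff_def by blast+
qed

lemma weyl_coeff_le_1: "cmod (weyl_coeff \<alpha> k m n) \<le> 1"
  using norm_sq_le_energy[OF weyl_coeff_energy(1), of k m n] weyl_coeff_energy(2)[of k m]
  by (simp add: power_le_one_iff)

lemma cmv_weyl_coeff_0: "cmv \<alpha> (weyl_coeff \<alpha> k 0) = delta k"
  by (simp add: weyl_coeff_def cmv_cmv_adj contr)

lemma cmv_weyl_coeff_Suc: "cmv \<alpha> (weyl_coeff \<alpha> k (Suc m)) = weyl_coeff \<alpha> k m"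
  by (simp add: weyl_coeff_def cmv_cmv_adj contr)

lemma weyl_sol_sums:
  assumes "cmod z < 1"
  shows "(\<lambda>m. weyl_coeff \<alpha> k m n * z ^ m) sums weyl_sol \<alpha> k z n"
proof -
  have "summable (\<lambda>m. weyl_coeff \<alpha> k m n * z ^ m)"
  proof (rule summable_comparison_test)
    show "\<exists>N. \<forall>m\<ge>N. norm (weyl_coeff \<alpha> k m n * z ^ m) \<le> cmod z ^ m"
      by (auto simp: norm_mult norm_power intro!: mult_left_le_one_le weyl_coeff_le_1)
    show "summable (\<lambda>m. cmod z ^ m)"
      using assms by (simp add: summable_geometric)
  qed
  then show ?thesis
    by (simp add: weyl_sol_def summable_sums)
qed

lemma weyl_sol_eq:
  assumes "cmod z < 1"
  shows "cmv \<alpha> (weyl_sol \<alpha> k z) n = z * weyl_sol \<alpha> k z n + delta k n"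
proof -
  have scale: "cmv \<alpha> (\<lambda>n. weyl_coeff \<alpha> k m n * z ^ m) n = z ^ m * cmv \<alpha> (weyl_coeff \<alpha> k m) n" for m
    using cmv_linear[of \<alpha> "z ^ m" "weyl_coeff \<alpha> k m" 0 "\<lambda>_. 0" n] by (simp add: mult.commute)
  have "(\<lambda>m. z ^ m * cmv \<alpha> (weyl_coeff \<alpha> k m) n) sums cmv \<alpha> (weyl_sol \<alpha> k z) n"
    unfolding scale[symmetric] by (rule cmv_sums[OF weyl_sol_sums[OF assms]])
  moreover have "(\<lambda>m. z ^ Suc m * cmv \<alpha> (weyl_coeff \<alpha> k (Suc m)) n) sums (z * weyl_sol \<alpha> k z n)"
    using sums_mult[OF weyl_sol_sums[OF assms], of z k n]
    by (simp add: cmv_weyl_coeff_Suc mult_ac)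
  then have "(\<lambda>m. z ^ m * cmv \<alpha> (weyl_coeff \<alpha> k m) n) sums (z * weyl_sol \<alpha> k z n + delta k n)"
    by (subst (asm) sums_Suc_iff) (simp add: cmv_weyl_coeff_0)
  ultimately show ?thesis
    by (rule sums_unique2)
qed

text \<open>Minkowski's inequality on a finite index set and a partial sum: every coefficient
  sequence has energy 1, so the geometric series bounds the norm uniformly in both
  truncations.\<close>

lemma weyl_sol_square_summable:
  assumes z: "cmod z < 1"
  shows "square_summable (weyl_sol \<alpha> k z)"
  unfolding square_summable_def
proof (rule nonneg_bdd_above_summable_on)
  let ?c = "1 / (1 - cmod z)"
  show "bdd_above (sum (\<lambda>n. (cmod (weyl_sol \<alpha> k z n))\<^sup>2) ` {F. F \<subseteq> UNIV \<and> finite F})"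
  proof (rule bdd_aboveI2)
    fix F :: "int set" assume "F \<in> {F. F \<subseteq> UNIV \<and> finite F}"
    then have F: "finite F" by simp
    have partial: "L2_set (\<lambda>n. cmod (\<Sum>m<N. weyl_coeff \<alpha> k m n * z ^ m)) F \<le> (\<Sum>m<N. cmod z ^ m)" for N
    proof (induction N)
      case 0
      then show ?case by (simp add: L2_set_def)
    next
      case (Suc N)
      have "(\<Sum>n\<in>F. (cmod (weyl_coeff \<alpha> k N n))\<^sup>2) \<le> energy (weyl_coeff \<alpha> k N)"
        unfolding energy_def using weyl_coeff_energy(1) F
        by (intro finite_sum_le_infsum) (auto simp: square_summable_def)
      then have one: "L2_set (\<lambda>n. cmod (weyl_coeff \<alpha> k N n)) F \<le> 1"
        by (simp add: L2_set_def weyl_coeff_energy)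
      have "L2_set (\<lambda>n. cmod (\<Sum>m<Suc N. weyl_coeff \<alpha> k m n * z ^ m)) F
          \<le> L2_set (\<lambda>n. cmod (\<Sum>m<N. weyl_coeff \<alpha> k m n * z ^ m)
                + cmod z ^ N * cmod (weyl_coeff \<alpha> k N n)) F"
        by (rule L2_set_mono)
           (auto intro!: order_trans[OF norm_triangle_ineq] simp: norm_mult norm_power)
      also have "\<dots> \<le> L2_set (\<lambda>n. cmod (\<Sum>m<N. weyl_coeff \<alpha> k m n * z ^ m)) F
          + cmod z ^ N * L2_set (\<lambda>n. cmod (weyl_coeff \<alpha> k N n)) F"
        by (rule order_trans[OF L2_set_triangle_ineq]) (simp add: L2_set_right_distrib)
      also have "\<dots> \<le> (\<Sum>m<N. cmod z ^ m) + cmod z ^ N * 1"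
        by (intro add_mono Suc mult_left_mono one) auto
      finally show ?case by simp
    qed
    have geo: "(\<Sum>m<N. cmod z ^ m) \<le> ?c" for N
      using z sum_le_suminf[of "\<lambda>m. cmod z ^ m" "{..<N}"]
      by (simp add: suminf_geometric summable_geometric)
    have "(\<Sum>n\<in>F. (cmod (\<Sum>m<N. weyl_coeff \<alpha> k m n * z ^ m))\<^sup>2) \<le> ?c\<^sup>2" for N
    proof -
      have "sqrt (\<Sum>n\<in>F. (cmod (\<Sum>m<N. weyl_coeff \<alpha> k m n * z ^ m))\<^sup>2) \<le> ?c"
        using order_trans[OF partial geo] by (simp add: L2_set_def)
      then show ?thesis
        by (rule sqrt_le_D)
    qed
    moreover have "(\<lambda>N. \<Sum>n\<in>F. (cmod (\<Sum>m<N. weyl_coeff \<alpha> k m n * z ^ m))\<^sup>2)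
        \<longlonglongrightarrow> (\<Sum>n\<in>F. (cmod (weyl_sol \<alpha> k z n))\<^sup>2)"
      using weyl_sol_sums[OF z] by (auto intro!: tendsto_intros simp: sums_def)
    ultimately show "(\<Sum>n\<in>F. (cmod (weyl_sol \<alpha> k z n))\<^sup>2) \<le> ?c\<^sup>2"
      by (intro LIMSEQ_le_const2) auto
  qed
qed auto

lemma weyl_sol_vanish:
  assumes "\<alpha> k = 1"
  shows "n < k \<Longrightarrow> weyl_sol \<alpha> k z n = 0" "n \<ge> k \<Longrightarrow> weyl_sol \<alpha> (k - 1) z n = 0"
proof -
  have "\<forall>n<k. (cmv_adj \<alpha> ^^ m) (delta k) n = 0" for m
    by (induction m) (auto simp: delta_def intro: cmv_adj_splits(1)[where \<alpha> = \<alpha>, OF assms])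
  then have a: "\<forall>n<k. weyl_coeff \<alpha> k m n = 0" for m
    unfolding weyl_coeff_def by blast
  have "\<forall>n\<ge>k. (cmv_adj \<alpha> ^^ m) (delta (k - 1)) n = 0" for m
    by (induction m) (auto simp: delta_def intro: cmv_adj_splits(2)[where \<alpha> = \<alpha>, OF assms])
  then have b: "\<forall>n\<ge>k. weyl_coeff \<alpha> (k - 1) m n = 0" for m
    unfolding weyl_coeff_def by blast
  show "n < k \<Longrightarrow> weyl_sol \<alpha> k z n = 0" "n \<ge> k \<Longrightarrow> weyl_sol \<alpha> (k - 1) z n = 0"
    using a b by (simp_all add: weyl_sol_def)
qed

lemma weyl_sol_holomorphic: "(\<lambda>z. weyl_sol \<alpha> k z n) holomorphic_on ball 0 1"
  by (rule power_series_holomorphic[where a = "\<lambda>m. weyl_coeff \<alpha> k m n" and z = 0])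
     (simp add: weyl_sol_sums)

lemma weyl_sol_0: "weyl_sol \<alpha> k 0 n = cmv_adj \<alpha> (delta k) n"
  by (simp add: weyl_sol_def weyl_coeff_def powser_zero)

text \<open>The isometry equates the energies of the two sides of the resolvent equation. In the
  disc this yields a positive real part; for \<open>z\<close> on the circle the right-hand side
  vanishes, which is why the Green function is purely imaginary in the gap.\<close>

lemma resolvent_eq_energy:
  assumes "square_summable f" and eq: "\<And>n. cmv \<alpha> f n = z * f n + delta k n"
  shows "1 + 2 * Re (z * f k) = (1 - (cmod z)\<^sup>2) * energy f"
proof -
  have "energy f = energy (\<lambda>n. z * f n + delta k n)"
    using cmv_isometry(2)[of \<alpha> f] contr assms(1) by (simp add: eq[abs_def, symmetric])
  also have "\<dots> = (cmod z)\<^sup>2 * energy f + 2 * Re (z * f k) + 1"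
    using assms(1) by (simp add: energy_add_delta square_summable_scale del: times_complex.sel)
  finally show ?thesis
    by (simp add: algebra_simps)
qed

section \<open>Uniqueness for the resolvent equation and the diagonal entry\<close>

lemma cmv_no_eigenvalue_in_disc:
  assumes "square_summable f" and eq: "\<And>n. cmv \<alpha> f n = z * f n" and z: "cmod z < 1"
  shows "f = (\<lambda>_. 0)"
proof -
  have "energy f = (cmod z)\<^sup>2 * energy f"
    using cmv_isometry(2)[of \<alpha> f] contr assms(1)
    by (simp add: eq[abs_def] square_summable_scale)
  moreover have "(cmod z)\<^sup>2 < 1"
    using z by (simp add: power_less_one_iff)
  ultimately have "energy f = 0"
    by simp
  then show ?thesis
    using norm_sq_le_energy[OF assms(1)] by auto
qed

text \<open>\<open>resolvent\<close> is an \<open>inv_into\<close>, so injectivity on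
  \<open>l2 S\<close> and one explicit preimage determine its value.\<close>

lemma resolvent_delta_eq:
  assumes z: "cmod z < 1" and mem: "weyl_sol \<alpha> k z \<in> l2 S"
  shows "resolvent S (cmv \<alpha>) z (delta k) = weyl_sol \<alpha> k z"
proof -
  have inj: "inj_on (add_scalar (cmv \<alpha>) (- z)) (l2 S)"
  proof (rule inj_onI)
    fix f g assume fg: "f \<in> l2 S" "g \<in> l2 S"
      "add_scalar (cmv \<alpha>) (- z) f = add_scalar (cmv \<alpha>) (- z) g"
    have "(\<lambda>n. f n - g n) = (\<lambda>_. 0)"
    proof (rule cmv_no_eigenvalue_in_disc[OF _ _ z])
      show "square_summable (\<lambda>n. f n - g n)"
        using fg by (intro square_summable_diff) (auto simp: l2_iff)
      show "cmv \<alpha> (\<lambda>n. f n - g n) n = z * (f n - g n)" for n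
        using fun_cong[OF fg(3), of n] by (simp add: add_scalar_def cmv_diff algebra_simps)
    qed
    then show "f = g"
      by (auto simp: fun_eq_iff)
  qed
  have "delta k = add_scalar (cmv \<alpha>) (- z) (weyl_sol \<alpha> k z)"
    by (auto simp: add_scalar_def weyl_sol_eq[OF z])
  then show ?thesis
    unfolding resolvent_def by (simp add: inv_into_f_f[OF inj mem])
qed

lemma inner_delta: "l2_inner (delta k) f = f k"
proof -
  have "((\<lambda>n. cnj (delta k n) * f n) has_sum f k) UNIV"
    by (rule has_sum_finite_neutralI[of "{k}"]) (auto simp: delta_def)
  then show ?thesis
    unfolding l2_inner_def by (rule infsumI)
qed

text \<open>Writing \<open>U + z\<close> as \<open>(U - z) + 2 z\<close> turns the Cayley-type
  expression in \<open>m_plus\<close> and \<open>m_minus\<close> into 1 plus a multiple of one entry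
  of the resolvent solution.\<close>

lemma cayley_weyl_sol:
  assumes "cmod z < 1" "weyl_sol \<alpha> k z \<in> l2 S"
  shows "l2_inner (delta k) (add_scalar (cmv \<alpha>) z (resolvent S (cmv \<alpha>) z (delta k)))
    = 1 + 2 * z * weyl_sol \<alpha> k z k"
proof -
  have "delta k k = 1"
    by (simp add: delta_def)
  then show ?thesis
    using weyl_sol_eq[OF assms(1), of k k]
    by (simp add: resolvent_delta_eq[OF assms] inner_delta add_scalar_def)
qed

lemma weyl_sol_Re_pos:
  assumes "cmod z < 1"
  shows "0 < 1 + 2 * Re (z * weyl_sol \<alpha> k z k)"
proof -
  have sq: "square_summable (weyl_sol \<alpha> k z)"
    by (rule weyl_sol_square_summable[OF assms])
  have "energy (weyl_sol \<alpha> k z) \<noteq> 0"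
  proof
    assume "energy (weyl_sol \<alpha> k z) = 0"
    then have "weyl_sol \<alpha> k z = (\<lambda>_. 0)"
      using norm_sq_le_energy[OF sq] by auto
    then show False
      using weyl_sol_eq[OF assms, of k k] cmv_linear[of \<alpha> 0 "\<lambda>_. 0" 0 "\<lambda>_. 0" k]
      by (simp add: delta_def)
  qed
  moreover have "(cmod z)\<^sup>2 < 1"
    using assms by (simp add: power_less_one_iff)
  ultimately show ?thesis
    using energy_nonneg[of "weyl_sol \<alpha> k z"] resolvent_eq_energy[OF sq weyl_sol_eq[OF assms]]
    by (simp add: zero_less_mult_iff)
qed

end

section \<open>Gluing bounded holomorphic functions along an arc\<close>

text \<open>A point of \<open>B\<close> near \<open>b0\<close> is replaced by a nearby point of
  \<open>A\<close>, where \<open>f\<close> is already known to be close to both values. The lemma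
  converts boundary limits into the continuity that pasting across a line requires.\<close>

lemma continuous_on_limit_extension:
  fixes f :: "'a::metric_space \<Rightarrow> 'b::metric_space"
  assumes lim: "\<And>b. b \<in> A \<union> B \<Longrightarrow> (f \<longlongrightarrow> f b) (at b within A)"
    and B: "B \<subseteq> closure A"
  shows "continuous_on (A \<union> B) f"
  unfolding continuous_on_iff
proof (intro ballI allI impI)
  fix b0 and e :: real assume b0: "b0 \<in> A \<union> B" and e: "0 < e"
  have near: "\<exists>d>0. \<forall>a\<in>A. dist a b < d \<longrightarrow> dist (f a) (f b) < e / 2" if mem: "b \<in> A \<union> B" for b
  proof -
    obtain d where d: "d > 0" "\<And>a. a \<in> A \<Longrightarrow> 0 < dist a b \<Longrightarrow> dist a b < d \<Longrightarrow> dist (f a) (f b) < e / 2"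
      using lim[OF mem] e unfolding Lim_within by (metis half_gt_zero)
    then have "\<forall>a\<in>A. dist a b < d \<longrightarrow> dist (f a) (f b) < e / 2"
      using e by (metis dist_self half_gt_zero zero_less_dist_iff)
    with d show ?thesis by blast
  qed
  from near[OF b0] obtain d where d: "d > 0"
    "\<And>a. a \<in> A \<Longrightarrow> dist a b0 < d \<Longrightarrow> dist (f a) (f b0) < e / 2" by blast
  have "dist (f b) (f b0) < e" if b: "b \<in> A \<union> B" "dist b b0 < d" for b
  proof -
    from near[OF b(1)] obtain d' where d': "d' > 0"
      "\<And>a. a \<in> A \<Longrightarrow> dist a b < d' \<Longrightarrow> dist (f a) (f b) < e / 2" by blast
    have "b \<in> closure A"
      using b(1) B closure_subset by auto
    moreover have "0 < min d' (d - dist b b0)"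
      using d'(1) b(2) by simp
    ultimately obtain a where a: "a \<in> A" "dist a b < min d' (d - dist b b0)"
      unfolding closure_approachable by blast
    then have "dist a b0 < d"
      using dist_triangle[of a b0 b] by simp
    then have "dist (f a) (f b0) < e / 2" "dist (f a) (f b) < e / 2"
      using d(2) d'(2) a by auto
    then show ?thesis
      using dist_triangle3[of "f b" "f b0" "f a"] by simp
  qed
  then show "\<exists>d>0. \<forall>b\<in>A \<union> B. dist b b0 < d \<longrightarrow> dist (f b) (f b0) < e"
    using d(1) by blast
qed

text \<open>The function itself may behave badly at the boundary, but a primitive of a function
  bounded by 1 is 1-Lipschitz and so extends continuously to the closed half-plane.\<close>

lemma upper_half_plane_primitive:
  assumes hol: "f holomorphic_on {w. 0 < Im w}" and bound: "\<And>w. 0 < Im w \<Longrightarrow> cmod (f w) \<le> 1"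
  obtains P where "continuous_on {w. 0 \<le> Im w} P"
    "\<And>w. 0 < Im w \<Longrightarrow> (P has_field_derivative f w) (at w)"
proof -
  let ?U = "{w. 0 < Im w}"
  have U: "convex ?U" "open ?U"
    by (auto simp: convex_halfspace_Im_gt open_halfspace_Im_gt)
  obtain P where P: "\<And>w. w \<in> ?U \<Longrightarrow> (P has_field_derivative f w) (at w within ?U)"
    using holomorphic_convex_primitive'[OF U hol] by metis
  have "uniformly_continuous_on ?U P"
    unfolding uniformly_continuous_on_def
  proof (intro allI impI)
    fix e :: real assume e: "0 < e"
    have "dist (P w') (P w) < e" if "w \<in> ?U" "w' \<in> ?U" "dist w' w < e" for w w'
    proof -
      have "cmod (P w' - P w) \<le> 1 * cmod (w' - w)"
        by (rule field_differentiable_bound[OF U(1) P]) (use bound that in auto)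
      then show ?thesis
        using that(3) by (simp add: dist_norm)
    qed
    then show "\<exists>d>0. \<forall>w\<in>?U. \<forall>w'\<in>?U. dist w' w < d \<longrightarrow> dist (P w') (P w) < e"
      using e by blast
  qed
  then obtain Q where Q: "uniformly_continuous_on (closure ?U) Q" "\<And>w. w \<in> ?U \<Longrightarrow> P w = Q w"
    by (rule uniformly_continuous_on_extension_on_closure) blast
  have clU: "closure ?U = {w. 0 \<le> Im w}"
    using closure_halfspace_gt[of \<i> 0] by simp
  show ?thesis
  proof
    show "continuous_on {w. 0 \<le> Im w} Q"
      using Q(1) by (simp add: clU uniformly_continuous_imp_continuous)
    show "(Q has_field_derivative f w) (at w)" if "0 < Im w" for w
      using P[of w] that U(2) Q(2)
      by (auto simp: at_within_open[OF _ U(2)] intro: has_field_derivative_transform_within_open)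
  qed
qed

text \<open>The increment of \<open>P - cnj Q\<close> along a horizontal segment at height
  \<open>y\<close> is the integral of \<open>f - cnj h\<close>, which tends to 0 with
  \<open>y\<close> by dominated convergence (both functions are bounded by 1). So the primitives
  differ by a constant on the real segment and can be pasted there; \<open>E\<close> is the
  derivative of the result.\<close>

lemma glue_across_real_segment:
  fixes f h :: "complex \<Rightarrow> complex"
  assumes f: "f holomorphic_on {w. 0 < Im w}" "\<And>w. 0 < Im w \<Longrightarrow> cmod (f w) \<le> 1"
    and h: "h holomorphic_on {w. 0 < Im w}" "\<And>w. 0 < Im w \<Longrightarrow> cmod (h w) \<le> 1"
    and lim: "AE t in lborel. t \<in> {a<..<b} \<longrightarrow>
      ((\<lambda>y. f (Complex t y) - cnj (h (Complex t y))) \<longlongrightarrow> 0) (at_right 0)"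
  obtains E where "E holomorphic_on {w. a < Re w \<and> Re w < b}"
    "\<And>w. a < Re w \<Longrightarrow> Re w < b \<Longrightarrow> 0 < Im w \<Longrightarrow> E w = f w"
    "\<And>w. a < Re w \<Longrightarrow> Re w < b \<Longrightarrow> 0 < Im w \<Longrightarrow> E (cnj w) = cnj (h w)"
proof -
  obtain P where P: "continuous_on {w. 0 \<le> Im w} P"
    "\<And>w. 0 < Im w \<Longrightarrow> (P has_field_derivative f w) (at w)"
    by (rule upper_half_plane_primitive[OF f]) blast+
  obtain Q where Q: "continuous_on {w. 0 \<le> Im w} Q"
    "\<And>w. 0 < Im w \<Longrightarrow> (Q has_field_derivative h w) (at w)"
    by (rule upper_half_plane_primitive[OF h]) blast+
  define D where "D w = P w - cnj (Q w)" for w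
  have D_const: "D (of_real x1) = D (of_real x2)" if x: "a < x1" "x1 \<le> x2" "x2 < b" for x1 x2
  proof -
    \<comment> \<open>Dominated convergence is applied along a sequence, so the height tends to 0
      through these values.\<close>
    define y where "y n = 1 / real (Suc n)" for n
    have y_pos: "y n > 0" for n
      by (simp add: y_def)
    have y_lim: "filterlim y (at_right 0) sequentially"
      unfolding filterlim_at y_def
      using LIMSEQ_inverse_real_of_nat by (auto simp: inverse_eq_divide)
    define d where "d n t = f (Complex t (y n)) - cnj (h (Complex t (y n)))" for n t
    have Cx: "Complex t s = of_real t + \<i> * of_real s" for t s
      by (simp add: complex_eq_iff)
    have cont: "continuous_on UNIV (d n)" for n
    proof -
      have "continuous_on UNIV (\<lambda>t. g (Complex t (y n)))"
        if "g holomorphic_on {w. 0 < Im w}" for g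
        unfolding Cx
        by (rule continuous_on_compose2[OF holomorphic_on_imp_continuous_on[OF that]])
           (auto intro!: continuous_intros simp: y_pos)
      then show ?thesis
        unfolding d_def using f(1) h(1) by (auto intro!: continuous_intros)
    qed
    have deriv: "((\<lambda>t. D (Complex t (y n))) has_vector_derivative d n t) (at t within X)" for n t X
    proof -
      have line: "((\<lambda>t. Complex t (y n)) has_vector_derivative 1) (at t within X)"
        unfolding Cx by (auto intro!: derivative_eq_intros)
      have "((\<lambda>t. P (Complex t (y n))) has_vector_derivative 1 * f (Complex t (y n))) (at t within X)"
        using field_vector_diff_chain_within[OF line, of P "f (Complex t (y n))"]
          has_field_derivative_at_within[OF P(2)] y_pos by (simp add: o_def)
      moreover have "((\<lambda>t. Q (Complex t (y n))) has_vector_derivative 1 * h (Complex t (y n))) (at t within X)"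
        using field_vector_diff_chain_within[OF line, of Q "h (Complex t (y n))"]
          has_field_derivative_at_within[OF Q(2)] y_pos by (simp add: o_def)
      ultimately show ?thesis
        unfolding D_def d_def
        by (auto intro!: has_vector_derivative_diff has_vector_derivative_cnj)
    qed
    have "((d n) has_integral (D (Complex x2 (y n)) - D (Complex x1 (y n)))) {x1..x2}" for n
      by (rule fundamental_theorem_of_calculus[OF x(2) deriv])
    then have int: "integral {x1..x2} (d n) = D (Complex x2 (y n)) - D (Complex x1 (y n))" for n
      by (rule integral_unique)
    have si: "set_integrable lborel {x1..x2} (d n)" for n
      using borel_integrable_compact[of "{x1..x2}" "d n"] continuous_on_subset[OF cont]
      by (simp add: set_integrable_def indicator_scaleR_eq_if if_distrib)
    have "(\<lambda>n. LINT t:{x1..x2}|lborel. d n t) \<longlonglongrightarrow> (LINT t|(lborel :: real measure). (0::complex))"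
      unfolding set_lebesgue_integral_def
    proof (rule integral_dominated_convergence[where w = "\<lambda>t. indicator {x1..x2} t *\<^sub>R 2"])
      show "AE t in lborel. (\<lambda>n. indicator {x1..x2} t *\<^sub>R d n t) \<longlonglongrightarrow> 0"
        using lim
      proof (rule AE_mp, intro AE_I2 impI)
        fix t assume t: "t \<in> {a<..<b} \<longrightarrow>
          ((\<lambda>y. f (Complex t y) - cnj (h (Complex t y))) \<longlongrightarrow> 0) (at_right 0)"
        show "(\<lambda>n. indicator {x1..x2} t *\<^sub>R d n t) \<longlonglongrightarrow> 0"
        proof (cases "t \<in> {x1..x2}")
          case True
          then have "t \<in> {a<..<b}" using x by auto
          with t have "(\<lambda>n. d n t) \<longlonglongrightarrow> 0"
            unfolding d_def by (intro filterlim_compose[OF _ y_lim]) simp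
          then show ?thesis using True by simp
        qed simp
      qed
      show "AE t in lborel. norm (indicator {x1..x2} t *\<^sub>R d n t) \<le> indicator {x1..x2} t *\<^sub>R 2" for n
      proof (intro AE_I2)
        fix t
        have "norm (d n t) \<le> norm (f (Complex t (y n))) + norm (h (Complex t (y n)))"
          unfolding d_def by (rule order_trans[OF norm_triangle_ineq4]) simp
        also have "\<dots> \<le> 2"
          using f(2)[of "Complex t (y n)"] h(2)[of "Complex t (y n)"] y_pos[of n] by simp
        finally show "norm (indicator {x1..x2} t *\<^sub>R d n t) \<le> indicator {x1..x2} t *\<^sub>R 2"
          by (simp add: indicator_def)
      qed
    qed (use si in \<open>auto simp: set_integrable_def emeasure_lborel_Icc_eq intro!: integrable_real_indicator\<close>)
    then have "(\<lambda>n. D (Complex x2 (y n)) - D (Complex x1 (y n))) \<longlonglongrightarrow> 0"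
      by (simp add: set_borel_integral_eq_integral(2)[OF si] int)
    moreover have "(\<lambda>n. D (Complex x (y n))) \<longlonglongrightarrow> D (of_real x)" for x
    proof -
      have c: "continuous_on {w. 0 \<le> Im w} D"
        unfolding D_def by (intro continuous_intros P(1) Q(1))
      have "(\<lambda>n. Complex x (y n)) \<longlonglongrightarrow> of_real x + \<i> * of_real 0"
        unfolding Cx using y_lim by (intro tendsto_intros) (simp add: filterlim_at)
      then show ?thesis
        by (intro continuous_on_tendsto_compose[OF c]) (auto simp: y_pos less_imp_le)
    qed
    then have "(\<lambda>n. D (Complex x2 (y n)) - D (Complex x1 (y n))) \<longlonglongrightarrow> D (of_real x2) - D (of_real x1)"
      by (intro tendsto_intros)
    ultimately show ?thesis
      using LIMSEQ_unique by fastforce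
  qed
  define c where "c = D (of_real ((a + b) / 2))"
  have D_c: "D (of_real x) = c" if "a < x" "x < b" for x
    using D_const[of x "(a + b) / 2"] D_const[of "(a + b) / 2" x] that
    unfolding c_def by (cases "x \<le> (a + b) / 2") auto
  let ?S = "{w. a < Re w \<and> Re w < b}"
  \<comment> \<open>The constant \<open>c\<close> makes the two formulas agree on the real segment;
    it disappears again in \<open>deriv G\<close>.\<close>
  define G where "G w = (if 0 \<le> Im w then P w else cnj (Q (cnj w)) + c)" for w
  have S: "open ?S"
    by (simp add: open_Collect_conj open_halfspace_Re_gt open_halfspace_Re_lt)
  have contG: "continuous_on ?S G"
  proof -
    have U: "(?S \<inter> {w. 0 \<le> Im w}) \<union> (?S \<inter> {w. Im w \<le> 0}) = ?S"
      by auto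
    have "continuous_on ((?S \<inter> {w. 0 \<le> Im w}) \<union> (?S \<inter> {w. Im w \<le> 0})) 
        (\<lambda>w. if 0 \<le> Im w then P w else cnj (Q (cnj w)) + c)"
    proof (rule continuous_on_cases_local)
      show "closedin (top_of_set (?S \<inter> {w. 0 \<le> Im w} \<union> ?S \<inter> {w. Im w \<le> 0})) (?S \<inter> {w. 0 \<le> Im w})"
        unfolding U by (rule closedin_closed_Int[OF closed_halfspace_Im_ge])
      show "closedin (top_of_set (?S \<inter> {w. 0 \<le> Im w} \<union> ?S \<inter> {w. Im w \<le> 0})) (?S \<inter> {w. Im w \<le> 0})"
        unfolding U by (rule closedin_closed_Int[OF closed_halfspace_Im_le])
      show "continuous_on (?S \<inter> {w. 0 \<le> Im w}) P"
        by (rule continuous_on_subset[OF P(1)]) auto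
      show "continuous_on (?S \<inter> {w. Im w \<le> 0}) (\<lambda>w. cnj (Q (cnj w)) + c)"
        by (intro continuous_intros continuous_on_compose2[OF Q(1)]) auto
      show "P w = cnj (Q (cnj w)) + c"
        if "w \<in> ?S \<inter> {w. 0 \<le> Im w} \<and> \<not> 0 \<le> Im w \<or> w \<in> ?S \<inter> {w. Im w \<le> 0} \<and> 0 \<le> Im w" for w
      proof -
        from that have "Im w = 0" "a < Re w" "Re w < b" by auto
        then have "w = of_real (Re w)" "D (of_real (Re w)) = c"
          by (auto simp: complex_eq_iff D_c)
        then show ?thesis
          unfolding D_def by (metis add.commute complex_cnj_complex_of_real diff_eq_eq)
      qed
    qed
    then show ?thesis
      unfolding U G_def[abs_def] .
  qed
  have derG1: "(G has_field_derivative f w) (at w)" if "0 < Im w" for w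
    by (rule has_field_derivative_transform_within_open[OF P(2)[OF that] open_halfspace_Im_gt[of 0]])
       (use that in \<open>auto simp: G_def\<close>)
  have derG2: "(G has_field_derivative cnj (h (cnj w))) (at w)" if "Im w < 0" for w
  proof -
    have "(cnj \<circ> Q \<circ> cnj has_field_derivative cnj (h (cnj w))) (at w)"
      using Q(2)[of "cnj w"] that by (intro has_field_derivative_cnj_cnj) auto
    then have "((\<lambda>w. (cnj \<circ> Q \<circ> cnj) w + c) has_field_derivative cnj (h (cnj w)) + 0) (at w)"
      by (intro DERIV_add DERIV_const)
    then show ?thesis
      unfolding add_0_right
      by (rule has_field_derivative_transform_within_open[OF _ open_halfspace_Im_lt[of 0]])
         (use that in \<open>auto simp: G_def\<close>)
  qed
  have "G holomorphic_on ?S"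
  proof (rule holomorphic_on_paste_across_line[OF S, where d = \<i> and k = 0])
    have "G holomorphic_on {w. Im w < 0}"
      unfolding holomorphic_on_open[OF open_halfspace_Im_lt] using derG2 by blast
    then show "G holomorphic_on (?S \<inter> {z. \<i> \<bullet> z < 0})"
      by (rule holomorphic_on_subset) auto
    have "G holomorphic_on {w. 0 < Im w}"
      unfolding holomorphic_on_open[OF open_halfspace_Im_gt] using derG1 by blast
    then show "G holomorphic_on (?S \<inter> {z. 0 < \<i> \<bullet> z})"
      by (rule holomorphic_on_subset) auto
  qed (use contG in auto)
  then have "deriv G holomorphic_on ?S"
    by (rule holomorphic_deriv[OF _ S])
  moreover have "deriv G w = f w" if "0 < Im w" for w
    by (rule DERIV_imp_deriv[OF derG1[OF that]])
  moreover have "deriv G (cnj w) = cnj (h w)" if "0 < Im w" for w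
    using DERIV_imp_deriv[OF derG2[of "cnj w"]] that by simp
  ultimately show ?thesis
    by (intro that[of "deriv G"])
qed

text \<open>The map \<open>w\<close> to \<open>exp (\<i> * w)\<close> carries the upper half-plane
  into the disc and vertical approach to \<open>t\<close> into radial approach to
  \<open>cis t\<close>. Gluing upgrades radial limits of the difference almost everywhere to limits
  of each function within the disc at every point of the open arc.\<close>

lemma glue_across_arc:
  fixes f h :: "complex \<Rightarrow> complex"
  assumes f: "f holomorphic_on ball 0 1" "\<And>z. cmod z < 1 \<Longrightarrow> cmod (f z) \<le> 1"
    and h: "h holomorphic_on ball 0 1" "\<And>z. cmod z < 1 \<Longrightarrow> cmod (h z) \<le> 1"
    and lim: "AE t in lborel. t \<in> {a<..<b} \<longrightarrow>
      ((\<lambda>r. f (of_real r * cis t) - cnj (h (of_real r * cis t))) \<longlongrightarrow> 0) (at_left 1)"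
    and t: "a < t" "t < b"
  obtains w where "(f \<longlongrightarrow> w) (at (cis t) within ball 0 1)"
    "(h \<longlongrightarrow> cnj w) (at (cis t) within ball 0 1)"
proof -
  have disc: "exp (\<i> * w) \<in> ball 0 1" if "0 < Im w" for w
    using that by simp
  define fe he where "fe w = f (exp (\<i> * w))" and "he w = h (exp (\<i> * w))" for w
  have hol: "(\<lambda>w. g (exp (\<i> * w))) holomorphic_on {w. 0 < Im w}" if "g holomorphic_on ball 0 1" for g
  proof -
    have "g \<circ> (\<lambda>w. exp (\<i> * w)) holomorphic_on {w. 0 < Im w}"
      by (rule holomorphic_on_compose_gen[OF _ that]) (use disc in \<open>auto intro!: holomorphic_intros\<close>)
    then show ?thesis
      by (simp add: o_def)
  qed
  have holfe: "fe holomorphic_on {w. 0 < Im w}" and holhe: "he holomorphic_on {w. 0 < Im w}"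
    unfolding fe_def[abs_def] he_def[abs_def] using f(1) h(1) by (auto intro: hol)
  have bfe: "cmod (fe w) \<le> 1" and bhe: "cmod (he w) \<le> 1" if "0 < Im w" for w
    using disc[OF that] f(2) h(2) by (auto simp: fe_def he_def)
  have lim': "AE t in lborel. t \<in> {a<..<b} \<longrightarrow>
      ((\<lambda>y. fe (Complex t y) - cnj (he (Complex t y))) \<longlongrightarrow> 0) (at_right 0)"
    using lim
  proof (rule AE_mp, intro AE_I2 impI)
    fix t assume t: "t \<in> {a<..<b} \<longrightarrow>
      ((\<lambda>r. f (of_real r * cis t) - cnj (h (of_real r * cis t))) \<longlongrightarrow> 0) (at_left 1)" "t \<in> {a<..<b}"
    have eq: "exp (\<i> * Complex t y) = of_real (exp (- y)) * cis t" for y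
      by (simp add: exp_eq_polar)
    have "filterlim (\<lambda>y::real. exp (- y)) (at_left 1) (at_right 0)"
      unfolding filterlim_at
      by (auto simp: eventually_at_filter intro!: tendsto_eq_intros)
    from filterlim_compose[OF _ this] t
    show "((\<lambda>y. fe (Complex t y) - cnj (he (Complex t y))) \<longlongrightarrow> 0) (at_right 0)"
      unfolding eq fe_def he_def by blast
  qed
  obtain E where E: "E holomorphic_on {w. a < Re w \<and> Re w < b}"
    "\<And>w. a < Re w \<Longrightarrow> Re w < b \<Longrightarrow> 0 < Im w \<Longrightarrow> E w = fe w"
    "\<And>w. a < Re w \<Longrightarrow> Re w < b \<Longrightarrow> 0 < Im w \<Longrightarrow> E (cnj w) = cnj (he w)"
    using glue_across_real_segment[OF holfe bfe holhe bhe lim'] by blast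
  let ?F = "at (cis t) within ball 0 1"
  \<comment> \<open>Local inverse of \<open>exp (\<i> * w)\<close> near \<open>of_real t\<close>.
    Dividing by \<open>cis t\<close> moves the point to 1, away from the branch cut of
    \<open>Ln\<close>.\<close>
  define \<xi> where "\<xi> z = of_real t - \<i> * Ln (z / cis t)" for z
  have \<xi>_lim: "(\<xi> \<longlongrightarrow> of_real t) ?F"
  proof -
    have "((\<lambda>z. z / cis t) \<longlongrightarrow> cis t / cis t) ?F"
      by (intro tendsto_intros) simp
    then have "((\<lambda>z. Ln (z / cis t)) \<longlongrightarrow> Ln 1) ?F"
      by (intro tendsto_Ln) auto
    then have "(\<xi> \<longlongrightarrow> of_real t - \<i> * Ln 1) ?F"
      unfolding \<xi>_def by (intro tendsto_diff tendsto_mult tendsto_const)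
    then show ?thesis by simp
  qed
  have S: "open {w. a < Re w \<and> Re w < b}"
    by (simp add: open_Collect_conj open_halfspace_Re_gt open_halfspace_Re_lt)
  have E_lim: "isCont E (of_real t)"
    using continuous_on_interior[of _ E] holomorphic_on_imp_continuous_on[OF E(1)] t
    by (auto simp: interior_open[OF S])
  have ev: "\<forall>\<^sub>F z in ?F. a < Re (\<xi> z) \<and> Re (\<xi> z) < b \<and> 0 < Im (\<xi> z) \<and> exp (\<i> * \<xi> z) = z"
  proof -
    have "\<forall>\<^sub>F z in ?F. \<xi> z \<in> {w. a < Re w \<and> Re w < b}"
      using topological_tendstoD[OF \<xi>_lim S] t by auto
    moreover have "\<forall>\<^sub>F z in ?F. z \<noteq> 0"
      by (rule eventually_neq_at_within)
    moreover have "\<forall>\<^sub>F z in ?F. z \<in> ball 0 1"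
      by (simp add: eventually_at_filter)
    ultimately show ?thesis
    proof eventually_elim
      case (elim z)
      have "exp (\<i> * \<xi> z) = exp (\<i> * of_real t) * exp (Ln (z / cis t))"
        by (simp add: \<xi>_def algebra_simps exp_add)
      also have "\<dots> = z"
        using elim by (simp add: cis_conv_exp[symmetric])
      finally have "exp (\<i> * \<xi> z) = z" .
      moreover have "0 < Im (\<xi> z)"
        using elim by (simp add: \<xi>_def norm_divide)
      ultimately show ?case
        using elim by simp
    qed
  qed
  show ?thesis
  proof
    show "(f \<longlongrightarrow> E (of_real t)) ?F"
    proof (rule Lim_transform_eventually)
      show "((\<lambda>z. E (\<xi> z)) \<longlongrightarrow> E (of_real t)) ?F"
        by (rule isCont_tendsto_compose[OF E_lim \<xi>_lim])
      show "\<forall>\<^sub>F z in ?F. E (\<xi> z) = f z"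
        using ev by eventually_elim (simp add: E(2) fe_def)
    qed
    show "(h \<longlongrightarrow> cnj (E (of_real t))) ?F"
    proof (rule Lim_transform_eventually)
      have "((\<lambda>z. cnj (\<xi> z)) \<longlongrightarrow> of_real t) ?F"
        using tendsto_cnj[OF \<xi>_lim] by simp
      then show "((\<lambda>z. cnj (E (cnj (\<xi> z)))) \<longlongrightarrow> cnj (E (of_real t))) ?F"
        by (intro tendsto_cnj isCont_tendsto_compose[OF E_lim])
      show "\<forall>\<^sub>F z in ?F. cnj (E (cnj (\<xi> z))) = h z"
        using ev by eventually_elim (simp add: E(3) he_def)
    qed
  qed
qed

section \<open>Holomorphic functions on the right half-plane\<close>

text \<open>The exact value in the second part is what later turns the Schwarz estimate into an
  explicit growth bound.\<close>

lemma half_plane_moebius_norm: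
  assumes "0 < Re \<kappa>" "0 < Re p"
  shows "cmod ((p - \<kappa>) / (p + cnj \<kappa>)) < 1"
    and "1 - (cmod ((p - \<kappa>) / (p + cnj \<kappa>)))\<^sup>2 = 4 * Re p * Re \<kappa> / (cmod (p + cnj \<kappa>))\<^sup>2"
proof -
  have "Re (p + cnj \<kappa>) > 0" using assms by simp
  then have nz: "(cmod (p + cnj \<kappa>))\<^sup>2 > 0" by (auto simp: complex_eq_iff)
  have "(cmod (p + cnj \<kappa>))\<^sup>2 - (cmod (p - \<kappa>))\<^sup>2 = 4 * Re p * Re \<kappa>"
    unfolding cmod_power2 by (simp add: power2_eq_square algebra_simps)
  then show eq: "1 - (cmod ((p - \<kappa>) / (p + cnj \<kappa>)))\<^sup>2 = 4 * Re p * Re \<kappa> / (cmod (p + cnj \<kappa>))\<^sup>2"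
    using nz by (simp add: norm_divide power_divide field_simps)
  have "0 < 4 * Re p * Re \<kappa> / (cmod (p + cnj \<kappa>))\<^sup>2"
    using assms nz by simp
  with eq have "(cmod ((p - \<kappa>) / (p + cnj \<kappa>)))\<^sup>2 < 1"
    by simp
  then show "cmod ((p - \<kappa>) / (p + cnj \<kappa>)) < 1"
    by (simp add: power_less_one_iff)
qed

lemma half_plane_Schwarz:
  assumes hol: "f holomorphic_on {p. 0 < Re p}" and bound: "\<And>p. 0 < Re p \<Longrightarrow> cmod (f p) \<le> 1"
    and zero: "f \<kappa> = 0" and \<kappa>: "0 < Re \<kappa>" and p: "0 < Re p"
  shows "cmod (f p) \<le> cmod ((p - \<kappa>) / (p + cnj \<kappa>))"
proof -
  \<comment> \<open>Inverse of the map \<open>(p - \<kappa>) / (p + cnj \<kappa>)\<close>, hence a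
    parametrization of the half-plane by the disc with 0 over \<open>\<kappa>\<close>.\<close>
  define \<phi> where "\<phi> w = (\<kappa> + cnj \<kappa> * w) / (1 - w)" for w
  have \<phi>: "0 < Re (\<phi> w)" if w: "cmod w < 1" for w
  proof -
    have "w \<noteq> 1" using w by auto
    then have nz: "(cmod (1 - w))\<^sup>2 > 0" by simp
    have w2: "(Re w)\<^sup>2 + (Im w)\<^sup>2 < 1"
      using w power_less_one_iff[of "cmod w" 2] by (simp add: cmod_power2)
    have "Re (\<phi> w) = Re ((\<kappa> + cnj \<kappa> * w) * cnj (1 - w)) / (cmod (1 - w))\<^sup>2"
      unfolding \<phi>_def complex_div_cnj[of _ "1 - w"]
      by (metis Re_divide_of_real of_real_power)
    also have "Re ((\<kappa> + cnj \<kappa> * w) * cnj (1 - w)) = Re \<kappa> * (1 - ((Re w)\<^sup>2 + (Im w)\<^sup>2))"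
      by (simp add: power2_eq_square algebra_simps)
    finally show ?thesis
      using nz w2 \<kappa> by simp
  qed
  define w where "w = (p - \<kappa>) / (p + cnj \<kappa>)"
  have w: "cmod w < 1"
    unfolding w_def by (rule half_plane_moebius_norm[OF \<kappa> p])
  have "p + cnj \<kappa> \<noteq> 0" "\<kappa> + cnj \<kappa> \<noteq> 0"
    using \<kappa> p by (auto simp: complex_eq_iff)
  moreover have "\<kappa> + cnj \<kappa> * w = p * (\<kappa> + cnj \<kappa>) / (p + cnj \<kappa>)"
    "1 - w = (\<kappa> + cnj \<kappa>) / (p + cnj \<kappa>)"
    using calculation(1) by (simp_all add: w_def field_simps)
  ultimately have \<phi>w: "\<phi> w = p"
    by (simp add: \<phi>_def)
  \<comment> \<open>The Schwarz lemma is stated for functions of modulus strictly below 1, whereas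
    \<open>f\<close> may reach 1; scaling by \<open>c < 1\<close> bridges this, and \<open>c\<close>
    is arbitrary.\<close>
  have "c * cmod (f p) \<le> cmod w" if c: "0 < c" "c < 1" for c
  proof -
    have "norm ((\<lambda>w. of_real c * f (\<phi> w)) w) \<le> norm w"
    proof (rule Schwarz_Lemma(1))
      have "\<phi> holomorphic_on ball 0 1"
        unfolding \<phi>_def by (intro holomorphic_intros) auto
      then have "f \<circ> \<phi> holomorphic_on ball 0 1"
        by (rule holomorphic_on_compose_gen[OF _ hol]) (auto simp: \<phi>)
      then show "(\<lambda>w. of_real c * f (\<phi> w)) holomorphic_on ball 0 1"
        by (auto simp: o_def intro!: holomorphic_intros)
      show "of_real c * f (\<phi> 0) = 0"
        by (simp add: \<phi>_def zero)
      show "norm (of_real c * f (\<phi> w)) < 1" if "norm w < 1" for w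
      proof -
        have "norm (of_real c * f (\<phi> w)) \<le> c * 1"
          using bound[OF \<phi>[OF that]] c by (simp add: norm_mult)
        then show ?thesis using c by simp
      qed
    qed (rule w)
    then show ?thesis
      using c by (simp add: norm_mult \<phi>w)
  qed
  then have "cmod (f p) \<le> cmod w"
    by (rule field_le_mult_one_interval)
  then show ?thesis
    by (simp only: w_def)
qed

text \<open>The factor multiplying \<open>T\<close> below vanishes at the two points where the circle meets the
  imaginary axis, which cancels the blow-up of the bound there.\<close>

lemma remove_imaginary_axis_blowup:
  assumes hol: "T holomorphic_on - {0}"
    and bound: "\<And>p. Re p \<noteq> 0 \<Longrightarrow> cmod (T p) \<le> C * (cmod p + 1)\<^sup>2 / \<bar>Re p\<bar>"
    and C: "0 \<le> C" and p: "p \<noteq> 0"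
  shows "cmod (T p) \<le> 12 * C * (cmod p + 1)\<^sup>2 / cmod p"
\<comment> \<open>In the first case \<open>cmod p\<close> is at most 5 times the modulus of
  \<open>Re p\<close>, and the given bound suffices. Otherwise the maximum principle is used on the
  disc of radius \<open>t / 2\<close> about the projection of \<open>p\<close> to the imaginary
  axis, which avoids 0 and gives the constant 45/4. The number 12 covers both.\<close>
proof (cases "\<bar>Im p\<bar> \<le> 4 * \<bar>Re p\<bar>")
  case True
  then have "Re p \<noteq> 0"
    using p by (auto simp: complex_eq_iff)
  have "cmod p \<le> 12 * \<bar>Re p\<bar>"
    using cmod_le[of p] True by simp
  then have "1 / \<bar>Re p\<bar> \<le> 12 / cmod p"
    using p \<open>Re p \<noteq> 0\<close> by (simp add: field_simps)
  then have "C * (cmod p + 1)\<^sup>2 * (1 / \<bar>Re p\<bar>) \<le> C * (cmod p + 1)\<^sup>2 * (12 / cmod p)"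
    using C by (intro mult_left_mono) auto
  then show ?thesis
    using bound[OF \<open>Re p \<noteq> 0\<close>] by (simp add: mult_ac)
next
  case False
  define t where "t = \<bar>Im p\<bar>"
  define c where "c = \<i> * of_real (Im p)"
  have t: "0 < t" "4 * \<bar>Re p\<bar> < t"
    using False by (auto simp: t_def)
  define \<phi> where "\<phi> q = T q * ((q - c)\<^sup>2 + of_real (t\<^sup>2 / 4))" for q
  have norm_c: "cmod c = t"
    by (simp add: c_def t_def norm_mult)
  have "0 \<notin> cball c (t / 2)"
    using t by (simp add: norm_c)
  then have hol\<phi>: "\<phi> holomorphic_on cball c (t / 2)"
    unfolding \<phi>_def by (intro holomorphic_intros holomorphic_on_subset[OF hol]) auto
  have p_in: "p \<in> cball c (t / 2)"
  proof -
    have "c - p = of_real (- Re p)"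
      by (simp add: c_def complex_eq_iff)
    then have "cmod (c - p) = \<bar>Re p\<bar>"
      by (metis abs_minus_cancel norm_of_real)
    then show ?thesis using t by (simp add: dist_norm)
  qed
  have "cmod (\<phi> p) \<le> C * (3 * t / 2 + 1)\<^sup>2 * t"
  proof (rule maximum_modulus_frontier[of \<phi> "cball c (t / 2)"])
    show "\<phi> holomorphic_on interior (cball c (t / 2))"
      by (rule holomorphic_on_subset[OF hol\<phi>]) (simp add: interior_subset)
    show "continuous_on (closure (cball c (t / 2))) \<phi>"
      using holomorphic_on_imp_continuous_on[OF hol\<phi>] by simp
    show "cmod (\<phi> q) \<le> C * (3 * t / 2 + 1)\<^sup>2 * t" if "q \<in> frontier (cball c (t / 2))" for q
    proof -
      define v where "v = q - c"
      have nv: "cmod v = t / 2"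
        using that t by (simp add: frontier_cball dist_norm v_def norm_minus_commute)
      have "v\<^sup>2 + of_real (t\<^sup>2 / 4) = v\<^sup>2 + v * cnj v"
        unfolding complex_norm_square[symmetric] nv by (simp add: power_divide)
      also have "\<dots> = v * of_real (2 * Re v)"
        by (simp add: complex_eq_iff power2_eq_square algebra_simps)
      finally have factor: "cmod (v\<^sup>2 + of_real (t\<^sup>2 / 4)) = t * \<bar>Re q\<bar>"
        using nv by (simp add: norm_mult v_def c_def)
      have nq: "cmod q \<le> 3 * t / 2"
        using norm_triangle_ineq[of v c] nv by (simp add: v_def norm_c)
      have "cmod (\<phi> q) = cmod (T q) * (t * \<bar>Re q\<bar>)"
        using factor by (simp add: \<phi>_def norm_mult v_def)
      also have "\<dots> \<le> C * (cmod q + 1)\<^sup>2 * t"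
      proof (cases "Re q = 0")
        case True
        then show ?thesis using C t by simp
      next
        case False
        have "cmod (T q) * (t * \<bar>Re q\<bar>) \<le> C * (cmod q + 1)\<^sup>2 / \<bar>Re q\<bar> * (t * \<bar>Re q\<bar>)"
          using t by (intro mult_right_mono bound False) auto
        then show ?thesis using False by simp
      qed
      also have "\<dots> \<le> C * (3 * t / 2 + 1)\<^sup>2 * t"
        using nq t C by (intro mult_right_mono mult_left_mono power_mono add_mono) auto
      finally show ?thesis .
    qed
  qed (use p_in in auto)
  moreover have "t\<^sup>2 / 4 \<le> cmod ((p - c)\<^sup>2 + of_real (t\<^sup>2 / 4))"
  proof -
    have "(p - c)\<^sup>2 + of_real (t\<^sup>2 / 4) = of_real ((Re p)\<^sup>2 + t\<^sup>2 / 4)"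
      by (simp add: c_def complex_eq_iff power2_eq_square)
    then have "cmod ((p - c)\<^sup>2 + of_real (t\<^sup>2 / 4)) = \<bar>(Re p)\<^sup>2 + t\<^sup>2 / 4\<bar>"
      by (metis norm_of_real)
    then show ?thesis by simp
  qed
  then have "cmod (T p) * (t\<^sup>2 / 4) \<le> cmod (\<phi> p)"
    unfolding \<phi>_def norm_mult by (intro mult_left_mono) auto
  ultimately have "cmod (T p) * (t\<^sup>2 / 4) \<le> C * (3 * t / 2 + 1)\<^sup>2 * t"
    by simp
  then have "cmod (T p) * (t\<^sup>2 / 4) * (4 / t\<^sup>2) \<le> C * (3 * t / 2 + 1)\<^sup>2 * t * (4 / t\<^sup>2)"
    by (rule mult_right_mono) simp
  moreover have "C * (3 * t / 2 + 1)\<^sup>2 * t * (4 / t\<^sup>2) = 4 * C * (3 * t / 2 + 1)\<^sup>2 * (1 / t)"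
    using t by (simp add: power2_eq_square[of t])
  ultimately have *: "cmod (T p) \<le> 4 * C * (3 * t / 2 + 1)\<^sup>2 * (1 / t)"
    using t by simp
  have "t \<le> cmod p"
    by (simp add: t_def abs_Im_le_cmod)
  then have "(3 * t / 2 + 1)\<^sup>2 \<le> (3 / 2 * (cmod p + 1))\<^sup>2"
    using t by (intro power_mono) auto
  also have "\<dots> = 9 / 4 * (cmod p + 1)\<^sup>2"
    by (simp only: power_mult_distrib) (simp add: power2_eq_square)
  finally have a: "4 * C * (3 * t / 2 + 1)\<^sup>2 \<le> 4 * C * (9 / 4 * (cmod p + 1)\<^sup>2)"
    using C by (intro mult_left_mono) auto
  have "cmod p \<le> 5 / 4 * t"
    using cmod_le[of p] t(2) unfolding t_def by linarith
  then have b: "1 / t \<le> 5 / 4 / cmod p"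
    using t(1) p by (simp add: divide_simps)
  have "4 * C * (3 * t / 2 + 1)\<^sup>2 * (1 / t) \<le> 4 * C * (9 / 4 * (cmod p + 1)\<^sup>2) * (5 / 4 / cmod p)"
    by (rule mult_mono[OF a b]) (use C t in auto)
  also have "\<dots> = 45 / 4 * (C * (cmod p + 1)\<^sup>2 / cmod p)"
    by simp
  also have "\<dots> \<le> 12 * (C * (cmod p + 1)\<^sup>2 / cmod p)"
    using C by (intro mult_right_mono) auto
  also have "\<dots> = 12 * C * (cmod p + 1)\<^sup>2 / cmod p"
    by simp
  finally show ?thesis
    by (rule order_trans[OF *])
qed

text \<open>After removal of the blow-up, \<open>p * T p\<close> is bounded near 0 and grows at most
  quadratically, so it extends to a polynomial of degree at most 2. Oddness of \<open>T\<close>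
  makes this polynomial even and kills its linear term.\<close>

lemma odd_extension_rational:
  assumes hol: "T holomorphic_on - {0}"
    and bound: "\<And>p. Re p \<noteq> 0 \<Longrightarrow> cmod (T p) \<le> C * (cmod p + 1)\<^sup>2 / \<bar>Re p\<bar>"
    and C: "0 \<le> C" and odd: "\<And>p. Re p \<noteq> 0 \<Longrightarrow> T (- p) = - T p"
  obtains a b where "\<And>p. p \<noteq> 0 \<Longrightarrow> T p = a * p + b / p"
proof -
  have growth: "cmod (p * T p) \<le> 12 * C * (cmod p + 1)\<^sup>2" if "p \<noteq> 0" for p
    using remove_imaginary_axis_blowup[OF hol bound C that] that
    by (simp add: norm_mult field_simps)
  have "\<exists>B. eventually (\<lambda>p. norm (p * T p) \<le> B) (at 0)"
  proof (intro exI)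
    have "\<forall>\<^sub>F p in at (0::complex). p \<noteq> 0 \<and> dist p 0 < 1"
      by (auto simp: eventually_at intro!: exI[of _ 1])
    then show "\<forall>\<^sub>F p in at 0. norm (p * T p) \<le> 12 * C * (1 + 1)\<^sup>2"
    proof eventually_elim
      case (elim p)
      have "12 * C * (cmod p + 1)\<^sup>2 \<le> 12 * C * (1 + 1)\<^sup>2"
        using elim C by (intro mult_left_mono power_mono) auto
      then show ?case
        using growth[of p] elim by simp
    qed
  qed
  moreover have "(\<lambda>p. p * T p) holomorphic_on UNIV - {0}"
    using hol by (auto intro!: holomorphic_intros simp: Compl_eq_Diff_UNIV)
  ultimately obtain E where E: "E holomorphic_on UNIV" "\<And>p. p \<noteq> 0 \<Longrightarrow> E p = p * T p"
    using holomorphic_on_extend_bounded[of "\<lambda>p. p * T p" UNIV 0] by auto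
  have "norm (E p) \<le> 48 * C * norm p ^ 2" if "1 \<le> norm p" for p
  proof -
    have "(cmod p + 1)\<^sup>2 \<le> (2 * cmod p)\<^sup>2"
      using that by (intro power_mono) auto
    then have "12 * C * (cmod p + 1)\<^sup>2 \<le> 12 * C * (2 * cmod p)\<^sup>2"
      using C by (intro mult_left_mono) auto
    moreover have "p \<noteq> 0" using that by auto
    ultimately show ?thesis
      using growth[of p] E(2)[of p] by (simp add: power_mult_distrib)
  qed
  from Liouville_polynomial[OF E(1) this]
  have poly: "E p = (\<Sum>k\<le>2. (deriv ^^ k) E 0 / fact k * p ^ k)" for p by blast
  define c where "c k = (deriv ^^ k) E 0 / fact k" for k
  have E_eq: "E p = c 0 + c 1 * p + c 2 * p\<^sup>2" for p
    using poly[of p] by (simp add: c_def numeral_2_eq_2)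
  have "E (- 1) = E 1"
    using E(2)[of 1] E(2)[of "-1"] odd[of 1] by simp
  then have "c 1 = 0"
    using E_eq[of 1] E_eq[of "-1"] by (simp add: equation_minus_iff)
  show ?thesis
  proof (rule that)
    fix p :: complex assume "p \<noteq> 0"
    then have "T p = E p / p"
      by (simp add: E(2))
    with \<open>p \<noteq> 0\<close> \<open>c 1 = 0\<close> show "T p = c 2 * p + c 0 / p"
      by (simp add: E_eq field_simps power2_eq_square)
  qed
qed

text \<open>The sharper bound \<open>(1 + b) / (1 - b)\<close> is weakened to a multiple of
  \<open>1 / (1 - b^2)\<close>, because \<open>1 - b^2\<close> is the quantity that
  \<open>half_plane_moebius_norm\<close> evaluates.\<close>

lemma cayley_bound:
  assumes "cmod s \<le> b" "b < 1"
  shows "cmod ((1 + s) / (1 - s)) \<le> 4 / (1 - b\<^sup>2)"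
proof -
  have b: "0 \<le> b"
    using assms(1) norm_ge_zero order_trans by blast
  have "1 - b \<le> cmod (1 - s)"
    using norm_triangle_ineq2[of 1 s] assms by simp
  moreover have "cmod (1 + s) \<le> 1 + b"
    using norm_triangle_ineq[of 1 s] assms by simp
  ultimately have "cmod ((1 + s) / (1 - s)) \<le> (1 + b) / (1 - b)"
    unfolding norm_divide using assms b by (intro frac_le) auto
  also have "\<dots> = (1 + b)\<^sup>2 / (1 - b\<^sup>2)"
  proof -
    have "1 - b\<^sup>2 = (1 - b) * (1 + b)"
      by (simp add: power2_eq_square algebra_simps)
    then show ?thesis
      using assms b by (simp add: power2_eq_square)
  qed
  also have "\<dots> \<le> (1 + 1)\<^sup>2 / (1 - b\<^sup>2)"
    using assms b by (intro divide_right_mono power_mono) (auto simp: power_le_one)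
  finally show ?thesis by simp
qed

text \<open>Imaginary boundary values allow reflection in the imaginary axis, and combined with
  \<open>sym\<close> this becomes oddness under \<open>p\<close> to \<open>- p\<close>. The
  conclusion is the finite Blaschke product of the half-plane with zeros \<open>\<kappa>\<close> and
  \<open>cnj \<kappa>\<close>.\<close>

lemma half_plane_rigidity:
  fixes s :: "complex \<Rightarrow> complex"
  assumes hol: "s holomorphic_on {p. 0 < Re p}" and bound: "\<And>p. 0 < Re p \<Longrightarrow> cmod (s p) \<le> 1"
    and zero: "s \<kappa> = 0" and \<kappa>: "0 < Re \<kappa>" "0 < Im \<kappa>" "cmod \<kappa> = 1"
    and sym: "\<And>p. 0 < Re p \<Longrightarrow> s (cnj p) = cnj (s p)"
    and lim: "\<And>y. 0 < y \<Longrightarrow> \<exists>L. Re L = 0 \<and>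
      ((\<lambda>p. (1 + s p) / (1 - s p)) \<longlongrightarrow> L) (at (\<i> * of_real y) within {p. 0 < Re p})"
    and p: "0 < Re p"
  shows "s p = (p - \<kappa>) * (p - cnj \<kappa>) / ((p + \<kappa>) * (p + cnj \<kappa>))"
proof -
  define F where "F p = (1 + s p) / (1 - s p)" for p
  let ?H = "{p. 0 < Re p}"
  have s_lt: "cmod (s p) < 1" if "0 < Re p" for p
    using half_plane_Schwarz[OF hol bound zero \<kappa>(1) that] half_plane_moebius_norm(1)[OF \<kappa>(1) that]
    by simp
  have s_ne: "1 - s p \<noteq> 0" if "0 < Re p" for p
    using s_lt[OF that] by auto
  have holF: "F holomorphic_on ?H"
    unfolding F_def by (intro holomorphic_intros hol) (use s_ne in auto)
  have F_bound: "cmod (F p) \<le> 1 / Re \<kappa> * (cmod p + 1)\<^sup>2 / \<bar>Re p\<bar>" if p: "0 < Re p" for p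
  proof -
    let ?b = "cmod ((p - \<kappa>) / (p + cnj \<kappa>))"
    have "cmod (F p) \<le> 4 / (1 - ?b\<^sup>2)"
      unfolding F_def
      by (rule cayley_bound[OF half_plane_Schwarz[OF hol bound zero \<kappa>(1) p] half_plane_moebius_norm(1)[OF \<kappa>(1) p]])
    also have "\<dots> = (cmod (p + cnj \<kappa>))\<^sup>2 / (Re p * Re \<kappa>)"
      unfolding half_plane_moebius_norm(2)[OF \<kappa>(1) p] by simp
    also have "\<dots> \<le> (cmod p + 1)\<^sup>2 / (Re p * Re \<kappa>)"
      using p \<kappa> norm_triangle_ineq[of p "cnj \<kappa>"]
      by (intro divide_right_mono power_mono) auto
    finally show ?thesis
      using p \<kappa> by (simp add: mult.commute)
  qed
  have F_sym: "F (cnj p) = cnj (F p)" if "0 < Re p" for p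
    by (simp add: F_def sym[OF that])
  have lim': "\<exists>L. Re L = 0 \<and> (F \<longlongrightarrow> L) (at q within ?H) \<and> (F \<longlongrightarrow> - L) (at (- q) within ?H)"
    if "Re q = 0" "q \<noteq> 0" for q
  proof -
    have main: "\<exists>L. Re L = 0 \<and> (F \<longlongrightarrow> L) (at (\<i> * of_real y) within ?H) \<and>
        (F \<longlongrightarrow> - L) (at (- (\<i> * of_real y)) within ?H)" if y: "0 < y" for y
    proof -
      obtain L where L: "Re L = 0" "(F \<longlongrightarrow> L) (at (\<i> * of_real y) within ?H)"
        using lim[OF y] unfolding F_def by blast
      \<comment> \<open>Conjugation carries the limit to the opposite boundary point as
        \<open>cnj L\<close>, which is \<open>- L\<close> since \<open>L\<close> is imaginary:
        precisely the sign that an odd extension needs.\<close>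
      have "filterlim cnj (at (\<i> * of_real y) within ?H) (at (- (\<i> * of_real y)) within ?H)"
        unfolding filterlim_at
        by (auto simp: eventually_at_filter complex_eq_iff intro!: tendsto_eq_intros)
      then have "((\<lambda>p. cnj (F (cnj p))) \<longlongrightarrow> cnj L) (at (- (\<i> * of_real y)) within ?H)"
        by (intro tendsto_cnj filterlim_compose[OF L(2)])
      then have "(F \<longlongrightarrow> cnj L) (at (- (\<i> * of_real y)) within ?H)"
        by (rule Lim_transform_eventually) (auto simp: eventually_at_filter F_sym)
      moreover have "cnj L = - L"
        using L(1) by (simp add: complex_eq_iff)
      ultimately show ?thesis using L by auto
    qed
    show ?thesis
    proof (cases "0 < Im q")
      case True
      then have "q = \<i> * of_real (Im q)" using that by (simp add: complex_eq_iff)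
      with main[OF True] show ?thesis by metis
    next
      case False
      then have "0 < - Im q" using that by (auto simp: complex_eq_iff)
      moreover have "q = - (\<i> * of_real (- Im q))" using that by (simp add: complex_eq_iff)
      ultimately obtain L where "Re L = 0" "(F \<longlongrightarrow> L) (at (- q) within ?H)"
        "(F \<longlongrightarrow> - L) (at q within ?H)"
        using main[of "- Im q"] by (metis minus_minus)
      then show ?thesis by (intro exI[of _ "- L"]) auto
    qed
  qed
  \<comment> \<open>On the axis the value is the limit from the right. The limit from the left is
    minus the limit of \<open>F\<close> at the opposite point, hence the same by
    \<open>lim'\<close>.\<close>
  define T where "T p = (if 0 < Re p then F p else if Re p < 0 then - F (- p) else Lim (at p within ?H) F)" for p
  have holT1: "T holomorphic_on {p. 0 < Re p}"
    by (rule holomorphic_transform[OF holF]) (simp add: T_def)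
  have holT2: "T holomorphic_on {p. Re p < 0}"
  proof -
    have "F \<circ> uminus holomorphic_on {p. Re p < 0}"
      by (rule holomorphic_on_compose_gen[OF _ holF]) (auto intro!: holomorphic_intros)
    then have "(\<lambda>p. - F (- p)) holomorphic_on {p. Re p < 0}"
      by (auto simp: o_def intro!: holomorphic_intros)
    then show ?thesis
      by (rule holomorphic_transform) (simp add: T_def)
  qed
  let ?A = "{p. Re p < 0} \<union> {p. 0 < Re p}"
  have contA: "continuous_on ?A T"
    by (rule continuous_on_open_Un[OF open_halfspace_Re_lt open_halfspace_Re_gt
          holomorphic_on_imp_continuous_on[OF holT2] holomorphic_on_imp_continuous_on[OF holT1]])
  have clH: "closure ?H = {p. 0 \<le> Re p}"
    using closure_halfspace_gt[of "1::complex" 0] by simp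
  have "continuous_on (?A \<union> {p. Re p = 0 \<and> p \<noteq> 0}) T"
  proof (rule continuous_on_limit_extension)
    show "{p. Re p = 0 \<and> p \<noteq> 0} \<subseteq> closure ?A"
      unfolding closure_Un clH by auto
    fix q assume "q \<in> ?A \<union> {p. Re p = 0 \<and> p \<noteq> 0}"
    then consider "q \<in> ?A" | "Re q = 0" "q \<noteq> 0" by blast
    then show "(T \<longlongrightarrow> T q) (at q within ?A)"
    proof cases
      case 1
      then show ?thesis using contA by (auto simp: continuous_on_def)
    next
      case 2
      obtain L where L: "Re L = 0" "(F \<longlongrightarrow> L) (at q within ?H)" "(F \<longlongrightarrow> - L) (at (- q) within ?H)"
        using lim'[OF 2] by blast
      have "at q within ?H \<noteq> bot"
      proof -
        have "?H - {q} = ?H" "q \<in> closure ?H"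
          using 2 by (auto simp: clH)
        then show ?thesis
          by (simp only: at_within_eq_bot_iff not_not)
      qed
      then have Tq: "T q = L"
        using tendsto_Lim[OF _ L(2)] 2 by (simp add: T_def)
      have right: "(T \<longlongrightarrow> L) (at q within ?H)"
        by (rule Lim_transform_eventually[OF L(2)]) (auto simp: eventually_at_filter T_def)
      have left: "(T \<longlongrightarrow> L) (at q within {p. Re p < 0})"
      proof -
        have "filterlim uminus (at (- q) within ?H) (at q within {p. Re p < 0})"
          unfolding filterlim_at
          by (auto simp: eventually_at_filter intro!: tendsto_eq_intros)
        then have "((\<lambda>p. - F (- p)) \<longlongrightarrow> - (- L)) (at q within {p. Re p < 0})"
          by (intro tendsto_minus filterlim_compose[OF L(3)])
        moreover have "\<forall>\<^sub>F p in at q within {p. Re p < 0}. - F (- p) = T p"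
          by (simp add: eventually_at_filter T_def)
        ultimately show ?thesis
          using Lim_transform_eventually by fastforce
      qed
      show ?thesis
        unfolding Tq by (rule Lim_Un[OF left right])
    qed
  qed
  moreover have "?A \<union> {p. Re p = 0 \<and> p \<noteq> 0} = - {0}"
    by (auto simp: complex_eq_iff)
  ultimately have contT: "continuous_on (- {0}) T"
    by simp
  have holT: "T holomorphic_on - {0}"
  proof (rule holomorphic_on_paste_across_line[where d = 1 and k = 0])
    show "T holomorphic_on (- {0} \<inter> {z. 1 \<bullet> z < 0})"
      by (rule holomorphic_on_subset[OF holT2]) auto
    show "T holomorphic_on (- {0} \<inter> {z. 0 < 1 \<bullet> z})"
      by (rule holomorphic_on_subset[OF holT1]) auto
  qed (use contT in auto)
  have T_bound: "cmod (T p) \<le> 1 / Re \<kappa> * (cmod p + 1)\<^sup>2 / \<bar>Re p\<bar>" if "Re p \<noteq> 0" for p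
    using that F_bound[of p] F_bound[of "- p"] by (auto simp: T_def)
  have T_odd: "T (- p) = - T p" if "Re p \<noteq> 0" for p
    using that by (auto simp: T_def)
  obtain a b where ab: "\<And>p. p \<noteq> 0 \<Longrightarrow> T p = a * p + b / p"
    by (rule odd_extension_rational[OF holT T_bound _ T_odd]) (use \<kappa> in auto)
  have \<kappa>\<kappa>: "\<kappa> * cnj \<kappa> = 1"
    using \<kappa>(3) by (simp add: complex_norm_square[symmetric])
  have ne: "\<kappa> \<noteq> 0" "cnj \<kappa> \<noteq> 0" using \<kappa> by auto
  have inv: "1 / \<kappa> = cnj \<kappa>" "1 / cnj \<kappa> = \<kappa>"
    using \<kappa>\<kappa> ne by (simp_all add: divide_eq_eq mult.commute)
  \<comment> \<open>Both zeros of \<open>s\<close> give \<open>F\<close> the value 1. As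
    \<open>1 / \<kappa> = cnj \<kappa>\<close>, the two equations for \<open>a\<close> and
    \<open>b\<close> are mirror images and force \<open>a = b\<close>.\<close>
  have "F \<kappa> = 1" "F (cnj \<kappa>) = 1"
    using F_sym[OF \<kappa>(1)] by (simp_all add: F_def zero)
  then have "a * \<kappa> + b * (1 / \<kappa>) = 1" "a * cnj \<kappa> + b * (1 / cnj \<kappa>) = 1"
    using ab[OF ne(1)] ab[OF ne(2)] \<kappa>(1) by (simp_all add: T_def)
  then have e1: "a * \<kappa> + b * cnj \<kappa> = 1" and e2: "a * cnj \<kappa> + b * \<kappa> = 1"
    unfolding inv by auto
  have "(a - b) * (\<kappa> - cnj \<kappa>) = 0"
    using e1 e2 by (simp add: algebra_simps)
  moreover have "\<kappa> - cnj \<kappa> \<noteq> 0"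
    using \<kappa> by (auto simp: complex_eq_iff)
  ultimately have "a = b" by simp
  with e1 have a: "a * (\<kappa> + cnj \<kappa>) = 1"
    by (simp add: algebra_simps)
  have "p \<noteq> 0" using p by auto
  then have "F p = a * p + a / p"
    using ab[of p] p \<open>a = b\<close> by (simp add: T_def)
  then have "1 + s p = (a * p + a / p) * (1 - s p)"
    using s_ne[OF p] by (simp add: F_def field_simps)
  then have "p * (1 + s p) = a * (p\<^sup>2 + 1) * (1 - s p)"
    using \<open>p \<noteq> 0\<close> by (simp add: field_simps power2_eq_square)
  then have "(\<kappa> + cnj \<kappa>) * (p * (1 + s p)) = (a * (\<kappa> + cnj \<kappa>)) * (p\<^sup>2 + 1) * (1 - s p)"
    by (simp only: mult_ac)
  then have "s p * (p\<^sup>2 + 1 + (\<kappa> + cnj \<kappa>) * p) = p\<^sup>2 + 1 - (\<kappa> + cnj \<kappa>) * p"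
    unfolding a by algebra
  moreover have "(p + \<kappa>) * (p + cnj \<kappa>) = p\<^sup>2 + 1 + (\<kappa> + cnj \<kappa>) * p"
    "(p - \<kappa>) * (p - cnj \<kappa>) = p\<^sup>2 + 1 - (\<kappa> + cnj \<kappa>) * p"
    unfolding \<kappa>\<kappa>[symmetric] by algebra+
  ultimately have "s p * ((p + \<kappa>) * (p + cnj \<kappa>)) = (p - \<kappa>) * (p - cnj \<kappa>)"
    by simp
  moreover have "p + \<kappa> \<noteq> 0" "p + cnj \<kappa> \<noteq> 0"
    using p \<kappa> by (auto simp: complex_eq_iff)
  then have "(p + \<kappa>) * (p + cnj \<kappa>) \<noteq> 0"
    by (rule no_zero_divisors)
  ultimately show ?thesis
    by (simp only: nonzero_eq_divide_eq not_False_eq_True)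
qed

section \<open>Schur functions\<close>

text \<open>\<open>1 + 2 * x\<close> is the half-lattice function \<open>m_plus\<close>, and
  \<open>x / (1 + x)\<close> is its Cayley transform \<open>(m - 1) / (m + 1)\<close>.\<close>

definition schur_plus :: "(int \<Rightarrow> complex) \<Rightarrow> int \<Rightarrow> complex \<Rightarrow> complex" where
  "schur_plus \<alpha> k z = (let x = z * weyl_sol (\<alpha>(k := 1)) k z k in x / (1 + x))"

text \<open>The same transform for the left half-lattice, which ends at \<open>k - 1\<close> and
  does not see \<open>\<alpha> k\<close>. The Moebius map in \<open>schur_minus\<close> attaches
  this coefficient.\<close>

definition schur_tau :: "(int \<Rightarrow> complex) \<Rightarrow> int \<Rightarrow> complex \<Rightarrow> complex" where
  "schur_tau \<alpha> k z = (let y = z * weyl_sol (\<alpha>(k := 1)) (k - 1) z (k - 1) in y / (1 + y))"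

definition disc_moebius :: "complex \<Rightarrow> complex \<Rightarrow> complex" where
  "disc_moebius a w = (a - w) / (1 - cnj a * w)"

definition schur_minus :: "(int \<Rightarrow> complex) \<Rightarrow> int \<Rightarrow> complex \<Rightarrow> complex" where
  "schur_minus \<alpha> k z = disc_moebius (\<alpha> k) (schur_tau \<alpha> k z)"

text \<open>Mirror image of \<open>schur_minus\<close>: here \<open>\<alpha> k\<close> is attached
  to the right half-lattice. The pair of \<open>schur_sigma\<close> and \<open>schur_tau\<close>
  serves the diagonal entry at \<open>k - 1\<close> as \<open>schur_plus\<close> and
  \<open>schur_minus\<close> serve the one at \<open>k\<close>.\<close>

definition schur_sigma :: "(int \<Rightarrow> complex) \<Rightarrow> int \<Rightarrow> complex \<Rightarrow> complex" where
  "schur_sigma \<alpha> k z = disc_moebius (cnj (\<alpha> k)) (schur_plus \<alpha> k z)"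

lemma one_minus_ne_0: "cmod a < 1 \<Longrightarrow> cmod b \<le> 1 \<Longrightarrow> 1 - a * b \<noteq> 0"
proof
  assume ab: "cmod a < 1" "cmod b \<le> 1" and "1 - a * b = 0"
  then have "cmod a * cmod b = 1"
    by (metis eq_iff_diff_eq_0 norm_mult norm_one)
  moreover have "cmod a * cmod b \<le> cmod a * 1"
    using ab by (intro mult_left_mono) auto
  ultimately show False using ab by simp
qed

lemma disc_moebius_lt_1:
  assumes "cmod a < 1" "cmod w < 1"
  shows "cmod (disc_moebius a w) < 1"
proof -
  have "(cmod (1 - cnj a * w))\<^sup>2 - (cmod (a - w))\<^sup>2 = (1 - (cmod a)\<^sup>2) * (1 - (cmod w)\<^sup>2)"
    unfolding cmod_power2 by (simp add: power2_eq_square algebra_simps)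
  moreover have "(cmod a)\<^sup>2 < 1" "(cmod w)\<^sup>2 < 1"
    using assms by (simp_all add: power_less_one_iff)
  then have "0 < (1 - (cmod a)\<^sup>2) * (1 - (cmod w)\<^sup>2)"
    by (intro mult_pos_pos) auto
  ultimately have "(cmod (a - w))\<^sup>2 < (cmod (1 - cnj a * w))\<^sup>2"
    by linarith
  then have "cmod (a - w) < cmod (1 - cnj a * w)"
    by (rule power2_less_imp_less) simp
  then show ?thesis
    unfolding disc_moebius_def norm_divide by (subst divide_less_eq_1) auto
qed

lemma disc_moebius_involution:
  assumes "cmod a < 1" "cmod w < 1"
  shows "disc_moebius a (disc_moebius a w) = w"
proof -
  have d: "1 - cnj a * w \<noteq> 0" "1 - cnj a * a \<noteq> 0"
    using one_minus_ne_0[of "cnj a" w] one_minus_ne_0[of "cnj a" a] assms by auto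
  have "a - disc_moebius a w = w * (1 - cnj a * a) / (1 - cnj a * w)"
    "1 - cnj a * disc_moebius a w = (1 - cnj a * a) / (1 - cnj a * w)"
    using d by (simp_all add: disc_moebius_def field_simps)
  then show ?thesis
    unfolding disc_moebius_def[of a "disc_moebius a w"] using d by simp
qed

lemma cnj_disc_moebius: "cnj (disc_moebius a w) = disc_moebius (cnj a) (cnj w)"
  by (simp add: disc_moebius_def)

lemma disc_moebius_holomorphic:
  assumes "cmod a < 1" "f holomorphic_on S" "\<And>z. z \<in> S \<Longrightarrow> cmod (f z) < 1"
  shows "(\<lambda>z. disc_moebius a (f z)) holomorphic_on S"
  unfolding disc_moebius_def
  using one_minus_ne_0[of "cnj a"] assms by (intro holomorphic_intros) (auto simp: less_imp_le)

lemma disc_moebius_tendsto: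
  assumes "cmod a < 1" "cmod w \<le> 1" "(f \<longlongrightarrow> w) F"
  shows "((\<lambda>z. disc_moebius a (f z)) \<longlongrightarrow> disc_moebius a w) F"
  unfolding disc_moebius_def
  using one_minus_ne_0[of "cnj a" w] assms by (intro tendsto_intros) auto

text \<open>The hypothesis says that \<open>x\<close> is closer to 0 than to -1.\<close>

lemma moebius_of_Re_pos:
  assumes "0 < 1 + 2 * Re x"
  shows "1 + x \<noteq> 0" "cmod (x / (1 + x)) < 1"
proof -
  have "0 < Re (1 + x)"
    using assms by simp
  then show nz: "1 + x \<noteq> 0"
    by (metis less_irrefl zero_complex.sel(1))
  have "(cmod (1 + x))\<^sup>2 - (cmod x)\<^sup>2 = 1 + 2 * Re x"
    unfolding cmod_power2 by (simp add: power2_eq_square algebra_simps)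
  then have "(cmod x)\<^sup>2 < (cmod (1 + x))\<^sup>2"
    using assms by linarith
  then have "cmod x < cmod (1 + x)"
    by (rule power2_less_imp_less) simp
  then show "cmod (x / (1 + x)) < 1"
    unfolding norm_divide using nz by (subst divide_less_eq_1) auto
qed

section \<open>The Schur functions of a sequence of Verblunsky coefficients and the Green
  function\<close>

context
  fixes \<alpha> :: "int \<Rightarrow> complex"
  assumes verb: "\<And>k. cmod (\<alpha> k) < 1"
begin

lemma decoupled_le_1: "cmod ((\<alpha>(k := 1)) j) \<le> 1"
  using verb[of j] by (simp add: less_imp_le)

lemma weyl_sol_decoupled_l2:
  assumes "cmod z < 1"
  shows "weyl_sol (\<alpha>(k := 1)) k z \<in> l2 {k..}" "weyl_sol (\<alpha>(k := 1)) (k - 1) z \<in> l2 {..k - 1}"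
proof -
  have 1: "(\<alpha>(k := 1)) k = 1"
    by simp
  show "weyl_sol (\<alpha>(k := 1)) k z \<in> l2 {k..}"
    using weyl_sol_square_summable[where \<alpha> = "\<alpha>(k := 1)", OF decoupled_le_1[of k] assms] weyl_sol_vanish(1)[where \<alpha> = "\<alpha>(k := 1)" and k = k, OF decoupled_le_1[of k] 1]
    by (auto simp: l2_iff)
  show "weyl_sol (\<alpha>(k := 1)) (k - 1) z \<in> l2 {..k - 1}"
    using weyl_sol_square_summable[where \<alpha> = "\<alpha>(k := 1)", OF decoupled_le_1[of k] assms] weyl_sol_vanish(2)[where \<alpha> = "\<alpha>(k := 1)" and k = k, OF decoupled_le_1[of k] 1]
    by (auto simp: l2_iff)
qed

lemma m_plus_eq:
  "cmod z < 1 \<Longrightarrow> m_plus \<alpha> z k = 1 + 2 * (z * weyl_sol (\<alpha>(k := 1)) k z k)"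
  unfolding m_plus_def cmv_plus_def
  using cayley_weyl_sol[where \<alpha> = "\<alpha>(k := 1)", OF decoupled_le_1[of k] _ weyl_sol_decoupled_l2(1)] by (simp add: mult.assoc)

lemma m_minus_eq:
  "cmod z < 1 \<Longrightarrow> m_minus \<alpha> z (k - 1) = - (1 + 2 * (z * weyl_sol (\<alpha>(k := 1)) (k - 1) z (k - 1)))"
  unfolding m_minus_def cmv_minus_def
  using cayley_weyl_sol[where \<alpha> = "\<alpha>(k := 1)", OF decoupled_le_1[of k] _ weyl_sol_decoupled_l2(2)] by (simp add: mult.assoc)

lemma weyl_pos:
  assumes "cmod z < 1"
  shows "0 < 1 + 2 * Re (z * weyl_sol (\<alpha>(k := 1)) j z j)"
  by (rule weyl_sol_Re_pos[where \<alpha> = "\<alpha>(k := 1)", OF decoupled_le_1[of k] assms])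

lemma schur_lt_1:
  assumes "cmod z < 1"
  shows "cmod (schur_plus \<alpha> k z) < 1" "cmod (schur_tau \<alpha> k z) < 1"
    "cmod (schur_minus \<alpha> k z) < 1" "cmod (schur_sigma \<alpha> k z) < 1"
proof -
  show 1: "cmod (schur_plus \<alpha> k z) < 1" "cmod (schur_tau \<alpha> k z) < 1"
    unfolding schur_plus_def schur_tau_def Let_def
    by (rule moebius_of_Re_pos(2)[OF weyl_pos[OF assms]])+
  show "cmod (schur_minus \<alpha> k z) < 1" "cmod (schur_sigma \<alpha> k z) < 1"
    unfolding schur_minus_def schur_sigma_def
    using 1 verb[of k] by (auto intro!: disc_moebius_lt_1)
qed

lemma schur_holomorphic:
  "schur_plus \<alpha> k holomorphic_on ball 0 1" "schur_tau \<alpha> k holomorphic_on ball 0 1"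
  "schur_minus \<alpha> k holomorphic_on ball 0 1" "schur_sigma \<alpha> k holomorphic_on ball 0 1"
proof -
  have hol: "(\<lambda>z. z * weyl_sol (\<alpha>(k := 1)) j z j / (1 + z * weyl_sol (\<alpha>(k := 1)) j z j)) holomorphic_on ball 0 1"
    for j
  proof (intro holomorphic_intros weyl_sol_holomorphic[where \<alpha> = "\<alpha>(k := 1)", OF decoupled_le_1[of k]])
    fix z :: complex assume "z \<in> ball 0 1"
    then have "cmod z < 1" by simp
    then show "1 + z * weyl_sol (\<alpha>(k := 1)) j z j \<noteq> 0"
      by (rule moebius_of_Re_pos(1)[OF weyl_pos])
  qed
  show 1: "schur_plus \<alpha> k holomorphic_on ball 0 1" "schur_tau \<alpha> k holomorphic_on ball 0 1"
    unfolding schur_plus_def[abs_def] schur_tau_def[abs_def] Let_def by (rule hol)+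
  show "schur_minus \<alpha> k holomorphic_on ball 0 1"
    unfolding schur_minus_def[abs_def]
    by (rule disc_moebius_holomorphic[OF verb 1(2)]) (simp add: schur_lt_1)
  show "schur_sigma \<alpha> k holomorphic_on ball 0 1"
    unfolding schur_sigma_def[abs_def]
    by (rule disc_moebius_holomorphic[OF _ 1(1)]) (simp_all add: schur_lt_1 verb)
qed

lemma schur_at_0:
  "schur_plus \<alpha> k 0 = 0" "schur_tau \<alpha> k 0 = 0"
  "schur_minus \<alpha> k 0 = \<alpha> k" "schur_sigma \<alpha> k 0 = cnj (\<alpha> k)"
  by (simp_all add: schur_plus_def schur_tau_def schur_minus_def schur_sigma_def disc_moebius_def)

text \<open>The derivative at 0 is the diagonal entry of the inverse of the decoupled operator. For
  even \<open>k\<close> the decoupled \<open>V\<close> maps the deltas at \<open>k\<close> and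
  \<open>k - 1\<close> to themselves up to sign, so the entry is read off from
  \<open>W\<close>.\<close>

lemma schur_deriv_0:
  assumes "even k"
  shows "(schur_plus \<alpha> k has_field_derivative - cnj (\<alpha> (k + 1))) (at 0)"
    and "(schur_tau \<alpha> k has_field_derivative - \<alpha> (k - 1)) (at 0)"
proof -
  have deriv: "((\<lambda>z. z * weyl_sol (\<alpha>(k := 1)) j z j / (1 + z * weyl_sol (\<alpha>(k := 1)) j z j))
    has_field_derivative weyl_sol (\<alpha>(k := 1)) j 0 j) (at 0)" for j
  proof -
    obtain d where "((\<lambda>z. weyl_sol (\<alpha>(k := 1)) j z j) has_field_derivative d) (at 0)"
      using holomorphic_derivI[OF weyl_sol_holomorphic[where \<alpha> = "\<alpha>(k := 1)", OF decoupled_le_1[of k]] open_ball, of 0] by auto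
    note [derivative_intros] = this
    show ?thesis
      by (rule derivative_eq_intros refl | simp)+
  qed
  have "weyl_sol (\<alpha>(k := 1)) k 0 k = - cnj (\<alpha> (k + 1))"
    using assms
    by (simp add: weyl_sol_0[where \<alpha> = "\<alpha>(k := 1)", OF decoupled_le_1[of k]] cmv_adj_def cmv_V_apply cmv_W_apply delta_def rho_def)
  then show "(schur_plus \<alpha> k has_field_derivative - cnj (\<alpha> (k + 1))) (at 0)"
    using deriv[of k] unfolding schur_plus_def[abs_def] Let_def by simp
  have "weyl_sol (\<alpha>(k := 1)) (k - 1) 0 (k - 1) = - \<alpha> (k - 1)"
    using assms
    by (simp add: weyl_sol_0[where \<alpha> = "\<alpha>(k := 1)", OF decoupled_le_1[of k]] cmv_adj_def cmv_V_apply cmv_W_apply delta_def rho_def)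
  then show "(schur_tau \<alpha> k has_field_derivative - \<alpha> (k - 1)) (at 0)"
    using deriv[of "k - 1"] unfolding schur_tau_def[abs_def] Let_def by simp
qed

lemma schur_plus_M_plus:
  assumes "cmod z < 1"
  shows "schur_plus \<alpha> k z = (M_plus \<alpha> z k - 1) / (M_plus \<alpha> z k + 1)" "0 < Re (M_plus \<alpha> z k)"
proof -
  define x where "x = z * weyl_sol (\<alpha>(k := 1)) k z k"
  have M: "M_plus \<alpha> z k = 1 + 2 * x"
    unfolding M_plus_def m_plus_eq[OF assms] x_def by simp
  have "schur_plus \<alpha> k z = x / (1 + x)"
    by (simp add: schur_plus_def Let_def x_def)
  also have "\<dots> = (2 * x) / (2 * (1 + x))"
    by (rule mult_divide_mult_cancel_left[symmetric]) simp
  also have "\<dots> = (M_plus \<alpha> z k - 1) / (M_plus \<alpha> z k + 1)"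
    by (simp add: M algebra_simps)
  finally show "schur_plus \<alpha> k z = (M_plus \<alpha> z k - 1) / (M_plus \<alpha> z k + 1)" .
  show "0 < Re (M_plus \<alpha> z k)"
    using weyl_pos[OF assms, of k k] by (simp add: M x_def)
qed

text \<open>With \<open>M_minus = n / d\<close> the claim concerns \<open>(n + d) / (n - d)\<close>.
  Sum and difference contain the coefficient only through \<open>a\<close> and \<open>cnj a\<close>
  instead of real and imaginary parts, and both have the factor \<open>2 * (1 + y)\<close>.\<close>

lemma schur_minus_M_minus:
  assumes "cmod z < 1"
  shows "schur_minus \<alpha> k z = (M_minus \<alpha> z k + 1) / (M_minus \<alpha> z k - 1)"
proof -
  define a where "a = \<alpha> k"
  define y where "y = z * weyl_sol (\<alpha>(k := 1)) (k - 1) z (k - 1)"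
  define m where "m = m_minus \<alpha> z (k - 1)"
  have m: "m = - (1 + 2 * y)"
    unfolding m_def y_def by (rule m_minus_eq[OF assms])
  have y: "1 + y \<noteq> 0"
    unfolding y_def by (rule moebius_of_Re_pos(1)[OF weyl_pos[OF assms]])
  define \<tau> where "\<tau> = y / (1 + y)"
  have \<tau>: "cmod \<tau> < 1"
    using schur_lt_1(2)[OF assms, of k] by (simp add: schur_tau_def Let_def \<tau>_def y_def)
  have a: "cmod a < 1"
    by (simp add: a_def verb)
  define n where "n = of_real (Re (1 + a)) + \<i> * of_real (Im (1 - a)) * m"
  define d where "d = \<i> * of_real (Im (1 + a)) + of_real (Re (1 - a)) * m"
  have M: "M_minus \<alpha> z k = n / d"
    by (simp add: M_minus_def Let_def n_def d_def a_def m_def)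
  have ReIm: "complex_of_real (Re a) = (a + cnj a) / 2" "\<i> * complex_of_real (Im a) = (a - cnj a) / 2"
    by (simp_all add: complex_eq_iff)
  have n': "n = (2 + a + cnj a) / 2 - (a - cnj a) / 2 * m"
  proof -
    have "n = 1 + complex_of_real (Re a) - (\<i> * complex_of_real (Im a)) * m"
      by (simp add: n_def algebra_simps)
    then show ?thesis unfolding ReIm by (simp add: add_divide_distrib)
  qed
  have d': "d = (a - cnj a) / 2 + (2 - a - cnj a) / 2 * m"
  proof -
    have "d = \<i> * complex_of_real (Im a) + (1 - complex_of_real (Re a)) * m"
      by (simp add: d_def)
    then show ?thesis unfolding ReIm by (simp add: diff_divide_distrib add_divide_distrib)
  qed
  have \<tau>y: "(1 + y) * \<tau> = y"
    using y by (simp add: \<tau>_def)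
  have "n + d = (1 + a) + m * (1 - a)" "n - d = (1 + cnj a) - m * (1 - cnj a)"
    unfolding n' d' by (simp_all add: field_simps)
  then have "n + d = 2 * (a * (1 + y) - y)" "n - d = 2 * ((1 + y) - cnj a * y)"
    unfolding m by (simp_all add: algebra_simps)
  moreover have "a * (1 + y) - y = (1 + y) * (a - \<tau>)"
    unfolding right_diff_distrib \<tau>y by simp
  moreover have "(1 + y) - cnj a * y = (1 + y) * (1 - cnj a * \<tau>)"
    unfolding right_diff_distrib mult.left_commute[of "1 + y"] \<tau>y by simp
  ultimately have nd: "n + d = 2 * (1 + y) * (a - \<tau>)" "n - d = 2 * (1 + y) * (1 - cnj a * \<tau>)"
    by (simp_all only: mult.assoc)
  have "2 * d = (n + d) - (n - d)"
    by simp
  also have "\<dots> = - 2 * (1 + y) * ((1 - a) + \<tau> * (1 - cnj a))"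
    unfolding nd by (simp add: algebra_simps)
  finally have d2: "2 * d = - 2 * (1 + y) * ((1 - a) + \<tau> * (1 - cnj a))" .
  \<comment> \<open>Ensures \<open>d \<noteq> 0\<close>: the two terms cannot cancel, as
    \<open>1 - a\<close> and \<open>1 - cnj a\<close> have the same nonzero modulus and
    \<open>\<tau>\<close> has modulus below 1.\<close>
  have "(1 - a) + \<tau> * (1 - cnj a) \<noteq> 0"
  proof
    assume "(1 - a) + \<tau> * (1 - cnj a) = 0"
    then have "1 - a = - (\<tau> * (1 - cnj a))"
      by (simp add: eq_neg_iff_add_eq_0)
    then have "cmod (1 - a) = cmod (\<tau> * (1 - cnj a))"
      by (metis norm_minus_cancel)
    moreover have "cmod (1 - cnj a) = cmod (1 - a)"
      by (metis complex_cnj_diff complex_cnj_one complex_mod_cnj)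
    ultimately have "cmod (1 - a) = cmod \<tau> * cmod (1 - a)"
      by (simp only: norm_mult)
    then have "cmod (1 - a) * (1 - cmod \<tau>) = 0"
      by (simp add: algebra_simps)
    then have "1 - a = 0"
      using \<tau> by simp
    then show False
      using a by auto
  qed
  with d2 y have "d \<noteq> 0"
    by auto
  then have "(M_minus \<alpha> z k + 1) / (M_minus \<alpha> z k - 1) = (n + d) / (n - d)"
    unfolding M by (simp add: divide_simps)
  also have "\<dots> = (a - \<tau>) / (1 - cnj a * \<tau>)"
    unfolding nd using y by (intro mult_divide_mult_cancel_left) (simp only: mult_eq_0_iff, simp)
  also have "\<dots> = schur_minus \<alpha> k z"
    by (simp add: schur_minus_def disc_moebius_def schur_tau_def Let_def \<tau>_def y_def a_def)
  finally show ?thesis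
    by simp
qed

text \<open>A solution of the resolvent equation on the whole lattice is a combination of the two
  half-lattice ones. Only even \<open>k\<close> are treated: the entries at \<open>k\<close> and \<open>k - 1\<close> together cover
  all diagonal entries.\<close>

lemma green_function:
  assumes k: "even k" and z: "cmod z < 1"
  obtains u v where "square_summable u" "\<And>n. cmv \<alpha> u n = z * u n + delta k n"
      "1 + 2 * z * u k = (1 + schur_plus \<alpha> k z * schur_minus \<alpha> k z) / (1 - schur_plus \<alpha> k z * schur_minus \<alpha> k z)"
    "square_summable v" "\<And>n. cmv \<alpha> v n = z * v n + delta (k - 1) n"
      "1 + 2 * z * v (k - 1) = (1 + schur_sigma \<alpha> k z * schur_tau \<alpha> k z) / (1 - schur_sigma \<alpha> k z * schur_tau \<alpha> k z)"
proof -
  define \<beta> where "\<beta> = \<alpha>(k := 1)"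
  define a where "a = \<alpha> k"
  define r where "r = complex_of_real (rho \<alpha> k)"
  define f where "f = weyl_sol \<beta> k z"
  define h where "h = weyl_sol \<beta> (k - 1) z"
  define x where "x = z * f k"
  define y where "y = z * h (k - 1)"
  define S where "S = x / (1 + x)"
  define \<tau> where "\<tau> = y / (1 + y)"
  have rr: "r * r = 1 - a * cnj a"
  proof -
    have "r * r = of_real ((rho \<alpha> k)\<^sup>2)"
      by (simp add: r_def power2_eq_square)
    also have "\<dots> = 1 - a * cnj a"
      unfolding rho_sq[OF less_imp_le[OF verb]] by (simp add: a_def complex_norm_square[symmetric])
    finally show ?thesis .
  qed
  have ff: "square_summable f" "\<And>n. n < k \<Longrightarrow> f n = 0" "\<And>n. cmv \<beta> f n = z * f n + delta k n"
    using weyl_sol_decoupled_l2(1)[OF z, of k] weyl_sol_eq[where \<alpha> = "\<alpha>(k := 1)" and k = k, OF decoupled_le_1[of k] z]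
    by (auto simp: f_def \<beta>_def l2_iff)
  have hh: "square_summable h" "\<And>n. n \<ge> k \<Longrightarrow> h n = 0" "\<And>n. cmv \<beta> h n = z * h n + delta (k - 1) n"
    using weyl_sol_decoupled_l2(2)[OF z, of k] weyl_sol_eq[where \<alpha> = "\<alpha>(k := 1)" and k = "k - 1", OF decoupled_le_1[of k] z]
    by (auto simp: h_def \<beta>_def l2_iff)
  have x: "1 + x \<noteq> 0" and y: "1 + y \<noteq> 0"
    unfolding x_def y_def f_def h_def \<beta>_def by (rule moebius_of_Re_pos(1)[OF weyl_pos[OF z]])+
  \<comment> \<open>Block \<open>k\<close> belongs to \<open>V\<close> for even \<open>k\<close>, so
    decoupling there leaves \<open>W\<close> unchanged.\<close>
  have W: "cmv_W \<alpha> q = cmv_W \<beta> q" for q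
    using k by (auto simp: fun_eq_iff cmv_W_apply \<beta>_def rho_def)
  have V: "cmv_V \<alpha> q n = (if n = k then r * q (k - 1) + cnj a * q k
      else if n = k - 1 then - a * q (k - 1) + r * q k else cmv_V \<beta> q n)" for q n
    using k by (auto simp: cmv_V_apply \<beta>_def a_def r_def rho_def)
  have V\<beta>: "cmv_V \<beta> q k = q k" "cmv_V \<beta> q (k - 1) = - q (k - 1)" for q
    using k by (simp_all add: cmv_V_apply \<beta>_def rho_def)
  have Wf: "cmv_W \<beta> f k = 1 + x" "cmv_W \<beta> f (k - 1) = 0"
    using V\<beta>[of "cmv_W \<beta> f"] ff(3)[of k] ff(3)[of "k - 1"] ff(2)[of "k - 1"]
    by (simp_all add: cmv_def x_def delta_def)
  have Wh: "cmv_W \<beta> h k = 0" "cmv_W \<beta> h (k - 1) = - (1 + y)"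
    using V\<beta>[of "cmv_W \<beta> h"] hh(3)[of k] hh(3)[of "k - 1"] hh(2)[of k]
    by (simp_all add: cmv_def y_def delta_def minus_equation_iff[of _ "1 + z * h (k - 1)"] algebra_simps)
  \<comment> \<open>For the coupled operator, \<open>f\<close> and \<open>h\<close> solve the
    resolvent equation up to a defect supported on \<open>k\<close> and \<open>k - 1\<close>.
    \<open>A\<close> and \<open>B\<close> are the diagonal entries of the 2 by 2 matrix of these
    defects, and \<open>D\<close> below is its determinant.\<close>
  define A where "A = 1 - (1 - a) * (1 + y)"
  define B where "B = 1 - (1 - cnj a) * (1 + x)"
  have Uf: "cmv \<alpha> f n = z * f n + (B * delta k n + r * (1 + x) * delta (k - 1) n)" for n
  proof -
    have "cmv \<alpha> f n = (if n = k then cnj a * (1 + x) else if n = k - 1 then r * (1 + x) else z * f n + delta k n)"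
      using V[of "cmv_W \<beta> f" n] ff(3)[of n] Wf by (auto simp: cmv_def W)
    then show ?thesis
      using ff(2)[of "k - 1"] by (auto simp: delta_def B_def x_def algebra_simps)
  qed
  have Uh: "cmv \<alpha> h n = z * h n + (- r * (1 + y) * delta k n + A * delta (k - 1) n)" for n
  proof -
    have "cmv \<alpha> h n = (if n = k then r * (- (1 + y)) else if n = k - 1 then - a * (- (1 + y)) else z * h n + delta (k - 1) n)"
      using V[of "cmv_W \<beta> h" n] hh(3)[of n] Wh by (auto simp: cmv_def W)
    then show ?thesis
      using hh(2)[of k] by (auto simp: delta_def A_def y_def algebra_simps)
  qed
  define D where "D = A * B + r * r * ((1 + x) * (1 + y))"
  have Sx: "(1 + x) * S = x" and \<tau>y: "(1 + y) * \<tau> = y"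
    using x y by (simp_all add: S_def \<tau>_def)
  have AB: "A = (1 + y) * (a - \<tau>)" "B = (1 + x) * (cnj a - S)"
    unfolding A_def B_def right_diff_distrib[of "1 + _"] Sx \<tau>y by (simp_all add: algebra_simps)
  have SP: "schur_plus \<alpha> k z = S" and TA: "schur_tau \<alpha> k z = \<tau>"
    by (simp_all add: schur_plus_def schur_tau_def Let_def S_def \<tau>_def x_def y_def f_def h_def \<beta>_def)
  have S1: "cmod S < 1" and \<tau>1: "cmod \<tau> < 1"
    using schur_lt_1(1,2)[OF z, of k] by (simp_all add: SP TA)
  have SM: "schur_minus \<alpha> k z = (a - \<tau>) / (1 - cnj a * \<tau>)"
    "schur_sigma \<alpha> k z = (cnj a - S) / (1 - a * S)"
    by (simp_all add: schur_minus_def schur_sigma_def disc_moebius_def a_def SP TA)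
  have a1: "cmod a < 1"
    by (simp add: a_def verb)
  have den: "1 - cnj a * \<tau> \<noteq> 0" "1 - a * S \<noteq> 0"
    using one_minus_ne_0[of "cnj a" \<tau>] one_minus_ne_0[of a S] a1 S1 \<tau>1 by auto
  define N where "N = 1 - a * S - cnj a * \<tau> + \<tau> * S"
  have D_eq: "D = (1 + x) * (1 + y) * N"
    unfolding D_def AB rr N_def by algebra
  have N1: "1 - S * ((a - \<tau>) / (1 - cnj a * \<tau>)) = N / (1 - cnj a * \<tau>)"
    "1 - (cnj a - S) / (1 - a * S) * \<tau> = N / (1 - a * S)"
    using den unfolding N_def by (simp_all add: field_simps)
  \<comment> \<open>The quotient equals \<open>1\<close> minus the product of
    \<open>schur_plus\<close> and \<open>schur_minus\<close>, both of modulus below 1.\<close>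
  have "N / (1 - cnj a * \<tau>) \<noteq> 0"
    unfolding N1(1)[symmetric] SM(1)[symmetric]
    using one_minus_ne_0[OF S1, of "schur_minus \<alpha> k z"] schur_lt_1(3)[OF z, of k] by simp
  then have N0: "N \<noteq> 0"
    by auto
  then have D0: "D \<noteq> 0"
    using x y by (simp add: D_eq)
  \<comment> \<open>Cramer's rule for the right-hand sides \<open>delta k\<close> and
    \<open>delta (k - 1)\<close>.\<close>
  define u where "u n = (A / D) * f n + (- r * (1 + x) / D) * h n" for n
  define v where "v n = (r * (1 + y) / D) * f n + (B / D) * h n" for n
  have "square_summable u" "square_summable v"
    unfolding u_def v_def by (intro square_summable_add square_summable_scale ff(1) hh(1))+
  moreover have "cmv \<alpha> u n = z * u n + delta k n" for n
  proof -
    have "cmv \<alpha> u n = (A / D) * (z * f n + (B * delta k n + r * (1 + x) * delta (k - 1) n))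
        + (- r * (1 + x) / D) * (z * h n + (- r * (1 + y) * delta k n + A * delta (k - 1) n))"
      unfolding u_def cmv_linear Uf Uh ..
    also have "\<dots> = z * u n + (A * B + r * r * ((1 + x) * (1 + y))) / D * delta k n"
      using D0 by (simp add: u_def field_simps)
    finally show ?thesis
      using D0 by (simp add: D_def[symmetric])
  qed
  moreover have "cmv \<alpha> v n = z * v n + delta (k - 1) n" for n
  proof -
    have "cmv \<alpha> v n = (r * (1 + y) / D) * (z * f n + (B * delta k n + r * (1 + x) * delta (k - 1) n))
        + (B / D) * (z * h n + (- r * (1 + y) * delta k n + A * delta (k - 1) n))"
      unfolding v_def cmv_linear Uf Uh ..
    also have "\<dots> = z * v n + (A * B + r * r * ((1 + x) * (1 + y))) / D * delta (k - 1) n"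
      using D0 by (simp add: v_def field_simps)
    finally show ?thesis
      using D0 by (simp add: D_def[symmetric])
  qed
  moreover have "1 + 2 * z * u k = (1 + S * ((a - \<tau>) / (1 - cnj a * \<tau>))) / (1 - S * ((a - \<tau>) / (1 - cnj a * \<tau>)))"
  proof -
    have "z * u k = A * x / D"
      using hh(2)[of k] by (simp add: u_def x_def)
    also have "A * x = (1 + y) * (a - \<tau>) * ((1 + x) * S)"
      by (simp only: Sx AB(1))
    also have "\<dots> = ((1 + x) * (1 + y)) * (S * (a - \<tau>))"
      by (simp only: mult_ac)
    also have "\<dots> / D = S * (a - \<tau>) / N"
      unfolding D_eq by (rule mult_divide_mult_cancel_left) (use x y in simp)
    finally have "1 + 2 * z * u k = (N + 2 * (S * (a - \<tau>))) / N"
      using N0 by (simp add: add_divide_distrib mult.assoc)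
    moreover have "1 + S * ((a - \<tau>) / (1 - cnj a * \<tau>)) = (N + 2 * (S * (a - \<tau>))) / (1 - cnj a * \<tau>)"
      using den(1) unfolding N_def by (simp add: field_simps)
    ultimately show ?thesis
      unfolding N1(1) using den(1) by simp
  qed
  moreover have "1 + 2 * z * v (k - 1) = (1 + (cnj a - S) / (1 - a * S) * \<tau>) / (1 - (cnj a - S) / (1 - a * S) * \<tau>)"
  proof -
    have "z * v (k - 1) = B * y / D"
      using ff(2)[of "k - 1"] by (simp add: v_def y_def)
    also have "B * y = (1 + x) * (cnj a - S) * ((1 + y) * \<tau>)"
      by (simp only: \<tau>y AB(2))
    also have "\<dots> = ((1 + x) * (1 + y)) * (\<tau> * (cnj a - S))"
      by (simp only: mult_ac)
    also have "\<dots> / D = \<tau> * (cnj a - S) / N"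
      unfolding D_eq by (rule mult_divide_mult_cancel_left) (use x y in simp)
    finally have "1 + 2 * z * v (k - 1) = (N + 2 * (\<tau> * (cnj a - S))) / N"
      using N0 by (simp add: add_divide_distrib mult.assoc)
    moreover have "1 + (cnj a - S) / (1 - a * S) * \<tau> = (N + 2 * (\<tau> * (cnj a - S))) / (1 - a * S)"
      using den(2) unfolding N_def by (simp add: field_simps)
    ultimately show ?thesis
      unfolding N1(2) using den(2) by simp
  qed
  ultimately show ?thesis
    using that unfolding SM SP TA by blast
qed

text \<open>With \<open>v\<close> the solution at \<open>\<zeta>\<close>, the resolvent identity
  says that \<open>u z - v\<close> is \<open>z - \<zeta>\<close> times the bounded resolvent at
  \<open>\<zeta>\<close> applied to \<open>u z\<close>. The same identity keeps the energy of
  \<open>u z\<close> bounded near \<open>\<zeta>\<close>, so the difference tends to 0, and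
  \<open>resolvent_eq_energy\<close> at modulus 1 makes the limit imaginary.\<close>

lemma green_function_gap_limit:
  assumes \<zeta>: "\<zeta> \<in> resolvent_set UNIV (cmv \<alpha>)" "cmod \<zeta> = 1"
    and u: "\<And>z. cmod z < 1 \<Longrightarrow> square_summable (u z)"
      "\<And>z n. cmod z < 1 \<Longrightarrow> cmv \<alpha> (u z) n = z * u z n + delta j n"
  obtains L where "Re L = 0" "((\<lambda>z. 1 + 2 * z * u z j) \<longlongrightarrow> L) (at \<zeta> within ball 0 1)"
proof -
  let ?R = "resolvent UNIV (cmv \<alpha>) \<zeta>"
  let ?T = "add_scalar (cmv \<alpha>) (- \<zeta>)"
  obtain C where bij: "bij_betw ?T (l2 UNIV) (l2 UNIV)"
    and C: "\<And>f. f \<in> l2 UNIV \<Longrightarrow> l2_norm (?R f) \<le> C * l2_norm f"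
    using \<zeta>(1) unfolding resolvent_set_def by blast
  have norm: "l2_norm f = sqrt (energy f)" for f
    by (simp add: l2_norm_def energy_def)
  \<comment> \<open>A nonnegative bound, so that the norm estimate may be squared.\<close>
  define K where "K = max C 0"
  have K: "energy (?R f) \<le> K\<^sup>2 * energy f" if "square_summable f" for f
  proof -
    have "sqrt (energy (?R f)) \<le> K * sqrt (energy f)"
      using C[of f] that energy_nonneg[of f] mult_right_mono[of C K "sqrt (energy f)"]
      by (simp add: norm l2_UNIV_iff K_def)
    then have "(sqrt (energy (?R f)))\<^sup>2 \<le> (K * sqrt (energy f))\<^sup>2"
      by (intro power_mono) (auto simp: energy_nonneg)
    then show ?thesis
      by (simp add: power_mult_distrib energy_nonneg)
  qed
  have inv: "?R (?T f) = f" if "square_summable f" for f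
    unfolding resolvent_def using bij that
    by (intro inv_into_f_f) (auto simp: bij_betw_def l2_UNIV_iff)
  define v where "v = ?R (delta j)"
  have "delta j \<in> l2 UNIV"
    by (simp add: l2_UNIV_iff energy_delta)
  then have "?T v = delta j" "v \<in> l2 UNIV"
    using bij unfolding v_def resolvent_def
    by (auto simp: bij_betw_def f_inv_into_f intro: inv_into_into)
  then have v: "square_summable v" "\<And>n. cmv \<alpha> v n = \<zeta> * v n + delta j n"
    by (auto simp: l2_UNIV_iff add_scalar_def fun_eq_iff algebra_simps)
  have Re0: "Re (1 + 2 * \<zeta> * v j) = 0"
    using resolvent_eq_energy[where \<alpha> = \<alpha>, OF less_imp_le[OF verb] v] \<zeta>(2) by (simp add: mult.assoc)
  have diff: "energy (\<lambda>n. u z n - v n) \<le> K\<^sup>2 * ((cmod (z - \<zeta>))\<^sup>2 * energy (u z))" if z: "cmod z < 1" for z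
  proof -
    have "?T (\<lambda>n. u z n - v n) = (\<lambda>n. (z - \<zeta>) * u z n)"
      by (rule ext) (simp add: add_scalar_def cmv_diff u(2)[OF z] v(2) algebra_simps)
    then have "?R (\<lambda>n. (z - \<zeta>) * u z n) = (\<lambda>n. u z n - v n)"
      using inv[OF square_summable_diff[OF u(1)[OF z] v(1)]] by simp
    then show ?thesis
      using K[OF square_summable_scale(1)[OF u(1)[OF z], of "z - \<zeta>"]]
      by (simp add: square_summable_scale(2)[OF u(1)[OF z]])
  qed
  \<comment> \<open>Under \<open>close\<close>, at most half of the energy of \<open>u z\<close>
    appears on the right and is absorbed on the left; this yields the factor 4.\<close>
  have est: "(cmod (u z j - v j))\<^sup>2 \<le> K\<^sup>2 * (cmod (z - \<zeta>))\<^sup>2 * (4 * energy v)"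
    if z: "cmod z < 1" and close: "2 * (K\<^sup>2 * (cmod (z - \<zeta>))\<^sup>2) \<le> 1 / 2" for z
  proof -
    have "energy (u z) = energy (\<lambda>n. (u z n - v n) + v n)"
      by simp
    also have "\<dots> \<le> 2 * energy (\<lambda>n. u z n - v n) + 2 * energy v"
      by (intro square_summable_add square_summable_diff u(1) z v(1))
    also have "2 * energy (\<lambda>n. u z n - v n) \<le> 2 * (K\<^sup>2 * (cmod (z - \<zeta>))\<^sup>2) * energy (u z)"
      using diff[OF z] by (simp add: mult.assoc)
    also have "2 * (K\<^sup>2 * (cmod (z - \<zeta>))\<^sup>2) * energy (u z) \<le> 1 / 2 * energy (u z)"
      by (intro mult_right_mono close energy_nonneg)
    finally have *: "energy (u z) \<le> 4 * energy v"
      by simp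
    have "(cmod (u z j - v j))\<^sup>2 \<le> energy (\<lambda>n. u z n - v n)"
      by (rule norm_sq_le_energy[OF square_summable_diff[OF u(1)[OF z] v(1)]])
    also have "\<dots> \<le> K\<^sup>2 * (cmod (z - \<zeta>))\<^sup>2 * energy (u z)"
      using diff[OF z] by (simp add: mult.assoc)
    also have "\<dots> \<le> K\<^sup>2 * (cmod (z - \<zeta>))\<^sup>2 * (4 * energy v)"
      by (intro mult_left_mono *) auto
    finally show ?thesis .
  qed
  let ?F = "at \<zeta> within ball 0 1"
  have z\<zeta>: "((\<lambda>z. z) \<longlongrightarrow> \<zeta>) ?F"
    by (rule tendsto_ident_at)
  have small: "((\<lambda>z. c * (cmod (z - \<zeta>))\<^sup>2) \<longlongrightarrow> 0) ?F" for c :: real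
  proof -
    have "((\<lambda>z. c * (cmod (z - \<zeta>))\<^sup>2) \<longlongrightarrow> c * (cmod (\<zeta> - \<zeta>))\<^sup>2) ?F"
      by (intro tendsto_intros)
    then show ?thesis by simp
  qed
  have "\<forall>\<^sub>F z in ?F. (2 * K\<^sup>2) * (cmod (z - \<zeta>))\<^sup>2 < 1 / 2"
    by (rule order_tendstoD(2)[OF small]) simp
  moreover have "\<forall>\<^sub>F z in ?F. cmod z < 1"
    by (simp add: eventually_at_filter)
  ultimately have ev: "\<forall>\<^sub>F z in ?F. norm ((cmod (u z j - v j))\<^sup>2) \<le> (K\<^sup>2 * (4 * energy v)) * (cmod (z - \<zeta>))\<^sup>2"
  proof eventually_elim
    case (elim z)
    then show ?case
      using est[of z] by (simp add: mult_ac)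
  qed
  have "((\<lambda>z. (cmod (u z j - v j))\<^sup>2) \<longlongrightarrow> 0) ?F"
    by (rule Lim_null_comparison[OF ev small])
  then have "((\<lambda>z. sqrt ((cmod (u z j - v j))\<^sup>2)) \<longlongrightarrow> sqrt 0) ?F"
    by (rule tendsto_real_sqrt)
  then have "((\<lambda>z. u z j - v j) \<longlongrightarrow> 0) ?F"
    by (simp add: tendsto_norm_zero_iff)
  then have "((\<lambda>z. u z j) \<longlongrightarrow> v j) ?F"
    by (simp add: LIM_zero_iff)
  then have "((\<lambda>z. 1 + 2 * z * u z j) \<longlongrightarrow> 1 + 2 * \<zeta> * v j) ?F"
    by (intro tendsto_intros)
  with Re0 show ?thesis
    using that by blast
qed

end

section \<open>Uniformization of the complement of the gap\<close>

text \<open>The map below sends the open first quadrant into the disc, the positive half-line into the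
  arc and the positive imaginary half-line into the gap. It takes \<open>\<kappa>\<close> to \<open>0\<close> and is
  symmetric under conjugation of \<open>p\<close> and inversion of the value in the unit circle, so that the
  right half-plane uniformizes the sphere minus the gap.\<close>

definition disc_map :: "complex \<Rightarrow> complex \<Rightarrow> complex \<Rightarrow> complex" where
  "disc_map g \<kappa> p = g * (cnj \<kappa> * p\<^sup>2 - \<kappa>) / (\<kappa> * p\<^sup>2 - cnj \<kappa>)"

lemma at_within_disc_ne_bot: "cmod \<zeta> = 1 \<Longrightarrow> at \<zeta> within ball 0 1 \<noteq> bot"
proof -
  assume \<zeta>: "cmod \<zeta> = 1"
  then have "ball 0 1 - {\<zeta>} = ball 0 1" "\<zeta> \<in> closure (ball 0 1)"
    by auto
  then show ?thesis
    by (simp only: at_within_eq_bot_iff not_not)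
qed

context
  fixes g \<kappa> :: complex
  assumes g: "cmod g = 1" and \<kappa>: "0 < Re \<kappa>" "0 < Im \<kappa>" "cmod \<kappa> = 1"
begin

lemma kappa_cnj: "\<kappa> * cnj \<kappa> = 1"
  using \<kappa>(3) by (simp add: complex_norm_square[symmetric])

lemma g_cnj: "g * cnj g = 1"
  using g by (simp add: complex_norm_square[symmetric])

text \<open>In the variable \<open>X = p^2\<close> the map is a Moebius transformation. The
  difference of squared moduli of denominator and numerator has the sign of \<open>Im X\<close>,
  which is positive on the quadrant.\<close>

lemma disc_map_quadrant:
  assumes "0 < Re p" "0 < Im p"
  shows "\<kappa> * p\<^sup>2 - cnj \<kappa> \<noteq> 0" "cmod (disc_map g \<kappa> p) < 1"
proof -
  have "(cmod (\<kappa> * X - cnj \<kappa>))\<^sup>2 - (cmod (cnj \<kappa> * X - \<kappa>))\<^sup>2 = 8 * (Re \<kappa> * Im \<kappa> * Im X)" for X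
    unfolding cmod_power2 by (simp add: power2_eq_square algebra_simps)
  moreover have "0 < Re \<kappa> * Im \<kappa> * Im (p\<^sup>2)"
    using assms \<kappa> by (simp add: power2_eq_square)
  ultimately have "(cmod (cnj \<kappa> * p\<^sup>2 - \<kappa>))\<^sup>2 < (cmod (\<kappa> * p\<^sup>2 - cnj \<kappa>))\<^sup>2"
    by (smt (verit))
  then have lt: "cmod (cnj \<kappa> * p\<^sup>2 - \<kappa>) < cmod (\<kappa> * p\<^sup>2 - cnj \<kappa>)"
    by (rule power2_less_imp_less) simp
  then show "\<kappa> * p\<^sup>2 - cnj \<kappa> \<noteq> 0"
    by (metis norm_ge_zero norm_zero not_less)
  then show "cmod (disc_map g \<kappa> p) < 1"
    unfolding disc_map_def norm_divide norm_mult g using lt by (subst divide_less_eq_1) auto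
qed

text \<open>For real \<open>X\<close> numerator and denominator are conjugate up to the factor
  \<open>g\<close>, so the value lies on the circle. \<open>Re (\<zeta> * cnj (- g))\<close> is the
  cosine of the angle between \<open>\<zeta>\<close> and the midpoint \<open>- g\<close> of the arc.
  Its deviation from the threshold, times a positive quantity, is a positive multiple of
  \<open>X\<close>; thus the sign of \<open>X\<close> separates arc from gap.\<close>

lemma disc_map_axes:
  assumes X: "p\<^sup>2 = of_real X" "X \<noteq> 0"
  shows "\<kappa> * p\<^sup>2 - cnj \<kappa> \<noteq> 0" "cmod (disc_map g \<kappa> p) = 1"
    and "0 < X \<Longrightarrow> (Im \<kappa>)\<^sup>2 - (Re \<kappa>)\<^sup>2 < Re (disc_map g \<kappa> p * cnj (- g))"
    and "X < 0 \<Longrightarrow> Re (disc_map g \<kappa> p * cnj (- g)) < (Im \<kappa>)\<^sup>2 - (Re \<kappa>)\<^sup>2"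
proof -
  define D where "D = \<kappa> * p\<^sup>2 - cnj \<kappa>"
  have D_cnj: "cnj \<kappa> * p\<^sup>2 - \<kappa> = cnj D"
    by (simp add: D_def X)
  have D_parts: "Re D = (X - 1) * Re \<kappa>" "Im D = (X + 1) * Im \<kappa>"
    by (simp_all add: D_def X algebra_simps)
  have D0: "D \<noteq> 0"
  proof (cases "0 < X")
    case True
    then have "0 < Im D" using \<kappa> by (simp add: D_parts)
    then show ?thesis by auto
  next
    case False
    then have "Re D < 0" using X \<kappa> by (simp add: D_parts mult_neg_pos)
    then show ?thesis by auto
  qed
  then show "\<kappa> * p\<^sup>2 - cnj \<kappa> \<noteq> 0"
    by (simp add: D_def)
  have map: "disc_map g \<kappa> p = g * cnj D / D"
    by (simp only: disc_map_def D_cnj D_def)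
  show "cmod (disc_map g \<kappa> p) = 1"
    using D0 by (simp add: map norm_divide norm_mult g)
  define Q where "Q = (cmod D)\<^sup>2"
  have Q: "0 < Q" using D0 by (simp add: Q_def)
  have "disc_map g \<kappa> p * cnj (- g) = - (g * cnj g) * cnj D / D"
    by (simp add: map)
  also have "\<dots> = - (cnj D * cnj D) / (D * cnj D)"
    unfolding g_cnj using D0 by simp
  also have "D * cnj D = of_real Q"
    unfolding Q_def by (rule complex_norm_square[symmetric])
  finally have "Re (disc_map g \<kappa> p * cnj (- g)) = - ((Re D)\<^sup>2 - (Im D)\<^sup>2) / Q"
    by (simp only: Re_divide_of_real) (simp add: power2_eq_square)
  then have RQ: "Re (disc_map g \<kappa> p * cnj (- g)) * Q = (Im D)\<^sup>2 - (Re D)\<^sup>2"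
    using Q by simp
  have QD: "Q = (Re D)\<^sup>2 + (Im D)\<^sup>2"
    by (simp add: Q_def cmod_power2)
  have one: "(Re \<kappa>)\<^sup>2 = 1 - (Im \<kappa>)\<^sup>2"
    using cmod_power2[of \<kappa>] \<kappa>(3) by simp
  have "(Re (disc_map g \<kappa> p * cnj (- g)) - ((Im \<kappa>)\<^sup>2 - (Re \<kappa>)\<^sup>2)) * Q
      = (Im D)\<^sup>2 - (Re D)\<^sup>2 - ((Im \<kappa>)\<^sup>2 - (Re \<kappa>)\<^sup>2) * ((Re D)\<^sup>2 + (Im D)\<^sup>2)"
    unfolding left_diff_distrib RQ by (simp only: QD)
  also have "\<dots> = 8 * ((Im \<kappa>)\<^sup>2 * (1 - (Im \<kappa>)\<^sup>2)) * X"
    unfolding D_parts power_mult_distrib one by (simp add: power2_eq_square algebra_simps)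
  finally have eq: "(Re (disc_map g \<kappa> p * cnj (- g)) - ((Im \<kappa>)\<^sup>2 - (Re \<kappa>)\<^sup>2)) * Q
      = 8 * ((Im \<kappa>)\<^sup>2 * (Re \<kappa>)\<^sup>2) * X"
    by (simp only: one)
  have pos: "0 < 8 * ((Im \<kappa>)\<^sup>2 * (Re \<kappa>)\<^sup>2)"
    using \<kappa> by simp
  show "(Im \<kappa>)\<^sup>2 - (Re \<kappa>)\<^sup>2 < Re (disc_map g \<kappa> p * cnj (- g))" if "0 < X"
    using mult_pos_pos[OF pos that] Q unfolding eq[symmetric] by (simp add: zero_less_mult_iff)
  show "Re (disc_map g \<kappa> p * cnj (- g)) < (Im \<kappa>)\<^sup>2 - (Re \<kappa>)\<^sup>2" if "X < 0"
    using mult_pos_neg[OF pos that] Q unfolding eq[symmetric] by (simp add: mult_less_0_iff)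
qed

lemma disc_map_holomorphic: "disc_map g \<kappa> holomorphic_on {p. 0 < Re p \<and> 0 < Im p}"
  unfolding disc_map_def[abs_def] by (intro holomorphic_intros) (use disc_map_quadrant in auto)

lemma disc_map_boundary:
  assumes "p\<^sup>2 = of_real X" "X \<noteq> 0"
  shows "filterlim (disc_map g \<kappa>) (at (disc_map g \<kappa> p) within ball 0 1) (at p within {p. 0 < Re p \<and> 0 < Im p})"
  unfolding filterlim_at
proof
  have "disc_map g \<kappa> q \<in> ball 0 1 \<and> disc_map g \<kappa> q \<noteq> disc_map g \<kappa> p" if "0 < Re q" "0 < Im q" for q
    using disc_map_quadrant(2)[OF that] disc_map_axes(2)[OF assms] by auto
  then show "\<forall>\<^sub>F q in at p within {p. 0 < Re p \<and> 0 < Im p}.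
      disc_map g \<kappa> q \<in> ball 0 1 \<and> disc_map g \<kappa> q \<noteq> disc_map g \<kappa> p"
    unfolding eventually_at_filter by (intro always_eventually) blast
  show "(disc_map g \<kappa> \<longlongrightarrow> disc_map g \<kappa> p) (at p within {p. 0 < Re p \<and> 0 < Im p})"
    unfolding disc_map_def by (intro tendsto_intros disc_map_axes(1)[OF assms])
qed

lemma disc_map_kappa: "disc_map g \<kappa> \<kappa> = 0"
  using kappa_cnj by (simp add: disc_map_def power2_eq_square mult.assoc[symmetric] mult.commute[of "cnj \<kappa>"])

text \<open>On the positive half-line the value is the common limit of \<open>f\<close> and of the
  reflected \<open>h\<close>; this makes \<open>S\<close> continuous there, and pasting makes it
  holomorphic. Only the open arc enters: its endpoints correspond to 0 and infinity, outside the
  open half-plane.\<close>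

lemma half_plane_extension:
  fixes f h :: "complex \<Rightarrow> complex"
  assumes f: "f holomorphic_on ball 0 1" "\<And>z. cmod z < 1 \<Longrightarrow> cmod (f z) < 1"
    and h: "h holomorphic_on ball 0 1" "\<And>z. cmod z < 1 \<Longrightarrow> cmod (h z) < 1"
    and arc: "\<And>\<zeta>. cmod \<zeta> = 1 \<Longrightarrow> (Im \<kappa>)\<^sup>2 - (Re \<kappa>)\<^sup>2 < Re (\<zeta> * cnj (- g)) \<Longrightarrow>
      \<exists>w. (f \<longlongrightarrow> w) (at \<zeta> within ball 0 1) \<and> (h \<longlongrightarrow> cnj w) (at \<zeta> within ball 0 1)"
  obtains S where "S holomorphic_on {p. 0 < Re p}" "\<And>p. 0 < Re p \<Longrightarrow> cmod (S p) \<le> 1"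
    "\<And>p. 0 < Re p \<Longrightarrow> 0 < Im p \<Longrightarrow> S p = f (disc_map g \<kappa> p)"
    "\<And>p. 0 < Re p \<Longrightarrow> Im p < 0 \<Longrightarrow> S p = cnj (h (disc_map g \<kappa> (cnj p)))"
proof -
  let ?z = "disc_map g \<kappa>"
  define S where "S p = (if 0 < Im p then f (?z p) else if Im p < 0 then cnj (h (?z (cnj p)))
    else Lim (at (?z p) within ball 0 1) f)" for p
  let ?Q = "{p. 0 < Re p \<and> 0 < Im p}" and ?Q' = "{p. 0 < Re p \<and> Im p < 0}"
  let ?B = "{p. 0 < Re p \<and> Im p = 0}"
  have Q: "open ?Q" "open ?Q'"
    by (intro open_Collect_conj open_halfspace_Re_gt open_halfspace_Im_gt open_halfspace_Im_lt)+
  have comp: "(\<lambda>p. q (?z p)) holomorphic_on ?Q" if "q holomorphic_on ball 0 1" for q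
  proof -
    have "q \<circ> ?z holomorphic_on ?Q"
      by (rule holomorphic_on_compose_gen[OF disc_map_holomorphic that]) (use disc_map_quadrant in auto)
    then show ?thesis by (simp add: o_def)
  qed
  have hol1: "S holomorphic_on ?Q"
    by (rule holomorphic_transform[OF comp[OF f(1)]]) (simp add: S_def)
  have hol2: "S holomorphic_on ?Q'"
  proof -
    have "cnj ` ?Q' = ?Q"
      by (auto simp: image_iff intro!: exI[of _ "cnj _"])
    then have "cnj \<circ> (\<lambda>p. h (?z p)) \<circ> cnj holomorphic_on ?Q'"
      using comp[OF h(1)] Q(2) by (intro holomorphic_on_compose_cnj_cnj) auto
    then show ?thesis
      by (rule holomorphic_transform) (simp add: S_def)
  qed
  have real: "(S \<longlongrightarrow> S b) (at b within ?Q)" "(S \<longlongrightarrow> S b) (at b within ?Q')" "cmod (S b) \<le> 1"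
    if b: "b \<in> ?B" for b
  proof -
    have b2: "b\<^sup>2 = of_real ((Re b)\<^sup>2)" "(Re b)\<^sup>2 \<noteq> 0" "0 < (Re b)\<^sup>2"
      using b by (auto simp: complex_eq_iff power2_eq_square)
    note zb = disc_map_axes(2)[OF b2(1,2)] disc_map_axes(3)[OF b2]
    obtain w where w: "(f \<longlongrightarrow> w) (at (?z b) within ball 0 1)" "(h \<longlongrightarrow> cnj w) (at (?z b) within ball 0 1)"
      using arc[OF zb] by blast
    have Sb: "S b = w"
      using b tendsto_Lim[OF at_within_disc_ne_bot[OF zb(1)] w(1)] by (simp add: S_def)
    have "cmod w \<le> 1"
    proof (rule Lim_norm_ubound[OF at_within_disc_ne_bot[OF zb(1)] w(1)])
      show "\<forall>\<^sub>F z in at (?z b) within ball 0 1. norm (f z) \<le> 1"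
        using f(2) by (simp add: eventually_at_filter less_imp_le)
    qed
    then show "cmod (S b) \<le> 1"
      by (simp add: Sb)
    have "((\<lambda>p. f (?z p)) \<longlongrightarrow> w) (at b within ?Q)"
      by (rule filterlim_compose[OF w(1) disc_map_boundary[OF b2(1,2)]])
    then show "(S \<longlongrightarrow> S b) (at b within ?Q)"
      unfolding Sb by (rule Lim_transform_eventually) (simp add: eventually_at_filter S_def)
    have "filterlim cnj (at b within ?Q) (at b within ?Q')"
      unfolding filterlim_at
    proof
      have "cnj b = b" using b by (simp add: complex_eq_iff)
      then show "(cnj \<longlongrightarrow> b) (at b within ?Q')"
        using tendsto_cnj[OF tendsto_ident_at, of b ?Q'] by simp
      show "\<forall>\<^sub>F p in at b within ?Q'. cnj p \<in> ?Q \<and> cnj p \<noteq> b"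
        unfolding eventually_at_filter using b by (intro always_eventually) auto
    qed
    then have "((\<lambda>p. h (?z (cnj p))) \<longlongrightarrow> cnj w) (at b within ?Q')"
      by (intro filterlim_compose[OF filterlim_compose[OF w(2) disc_map_boundary[OF b2(1,2)]]])
    then have "((\<lambda>p. cnj (h (?z (cnj p)))) \<longlongrightarrow> cnj (cnj w)) (at b within ?Q')"
      by (rule tendsto_cnj)
    then show "(S \<longlongrightarrow> S b) (at b within ?Q')"
      unfolding Sb complex_cnj_cnj
      by (rule Lim_transform_eventually) (simp add: eventually_at_filter S_def)
  qed
  have contA: "continuous_on (?Q \<union> ?Q') S"
    by (rule continuous_on_open_Un[OF Q holomorphic_on_imp_continuous_on[OF hol1]
          holomorphic_on_imp_continuous_on[OF hol2]])
  have "continuous_on ((?Q \<union> ?Q') \<union> ?B) S"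
  proof (rule continuous_on_limit_extension)
    show "?B \<subseteq> closure (?Q \<union> ?Q')"
    proof
      fix b assume b: "b \<in> ?B"
      show "b \<in> closure (?Q \<union> ?Q')"
        unfolding closure_approachable
      proof (intro allI impI)
        fix e :: real assume "0 < e"
        then show "\<exists>y\<in>?Q \<union> ?Q'. dist y b < e"
          using b by (intro bexI[of _ "b + \<i> * of_real (e / 2)"]) (auto simp: dist_norm norm_mult)
      qed
    qed
    fix b assume "b \<in> (?Q \<union> ?Q') \<union> ?B"
    then consider "b \<in> ?Q \<union> ?Q'" | "b \<in> ?B" by blast
    then show "(S \<longlongrightarrow> S b) (at b within ?Q \<union> ?Q')"
    proof cases
      case 1
      then show ?thesis using contA unfolding continuous_on_def by blast
    next
      case 2
      show ?thesis by (rule Lim_Un[OF real(1,2)[OF 2]])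
    qed
  qed
  moreover have "(?Q \<union> ?Q') \<union> ?B = {p. 0 < Re p}"
    by auto
  ultimately have cont: "continuous_on {p. 0 < Re p} S"
    by (simp only:)
  show ?thesis
  proof
    show "S holomorphic_on {p. 0 < Re p}"
    proof (rule holomorphic_on_paste_across_line[where d = \<i> and k = 0])
      show "S holomorphic_on ({p. 0 < Re p} \<inter> {z. \<i> \<bullet> z < 0})"
        by (rule holomorphic_on_subset[OF hol2]) auto
      show "S holomorphic_on ({p. 0 < Re p} \<inter> {z. 0 < \<i> \<bullet> z})"
        by (rule holomorphic_on_subset[OF hol1]) auto
    qed (use cont open_halfspace_Re_gt in auto)
    show "S p = f (?z p)" if "0 < Re p" "0 < Im p" for p
      using that by (simp add: S_def)
    show "S p = cnj (h (?z (cnj p)))" if "0 < Re p" "Im p < 0" for p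
      using that by (simp add: S_def)
    show "cmod (S p) \<le> 1" if p: "0 < Re p" for p
    proof -
      consider "0 < Im p" | "Im p < 0" | "Im p = 0" by linarith
      then show ?thesis
      proof cases
        case 1
        then show ?thesis
          using f(2)[OF disc_map_quadrant(2)[OF p]] by (simp add: S_def less_imp_le)
      next
        case 2
        then show ?thesis
          using h(2)[OF disc_map_quadrant(2), of "cnj p"] p by (simp add: S_def less_imp_le)
      next
        case 3
        then show ?thesis using real(3)[of p] p by simp
      qed
    qed
  qed
qed

text \<open>The points \<open>\<kappa>\<close> and \<open>cnj \<kappa>\<close> lie over 0 and
  infinity, and \<open>S\<close> takes the values 0 and \<open>cnj (h 0)\<close> there.
  \<open>Im \<kappa>\<close> is their pseudohyperbolic distance in the right half-plane.\<close>

lemma arc_Schwarz_bound: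
  fixes f h :: "complex \<Rightarrow> complex"
  assumes f: "f holomorphic_on ball 0 1" "\<And>z. cmod z < 1 \<Longrightarrow> cmod (f z) < 1"
    and h: "h holomorphic_on ball 0 1" "\<And>z. cmod z < 1 \<Longrightarrow> cmod (h z) < 1"
    and arc: "\<And>\<zeta>. cmod \<zeta> = 1 \<Longrightarrow> (Im \<kappa>)\<^sup>2 - (Re \<kappa>)\<^sup>2 < Re (\<zeta> * cnj (- g)) \<Longrightarrow>
      \<exists>w. (f \<longlongrightarrow> w) (at \<zeta> within ball 0 1) \<and> (h \<longlongrightarrow> cnj w) (at \<zeta> within ball 0 1)"
    and zero: "f 0 = 0"
  shows "cmod (h 0) \<le> Im \<kappa>"
proof -
  obtain S where S: "S holomorphic_on {p. 0 < Re p}" "\<And>p. 0 < Re p \<Longrightarrow> cmod (S p) \<le> 1"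
    "\<And>p. 0 < Re p \<Longrightarrow> 0 < Im p \<Longrightarrow> S p = f (disc_map g \<kappa> p)"
    "\<And>p. 0 < Re p \<Longrightarrow> Im p < 0 \<Longrightarrow> S p = cnj (h (disc_map g \<kappa> (cnj p)))"
    using half_plane_extension[OF f h arc] by blast
  have "S \<kappa> = 0" "S (cnj \<kappa>) = cnj (h 0)"
    using S(3)[of \<kappa>] S(4)[of "cnj \<kappa>"] \<kappa> by (simp_all add: disc_map_kappa zero)
  then have "cmod (h 0) \<le> cmod ((cnj \<kappa> - \<kappa>) / (cnj \<kappa> + cnj \<kappa>))"
    using half_plane_Schwarz[OF S(1,2), of \<kappa> "cnj \<kappa>"] \<kappa> by simp
  also have "cnj \<kappa> - \<kappa> = - (2 * \<i> * of_real (Im \<kappa>))"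
    by (simp add: complex_eq_iff)
  also have "cnj \<kappa> + cnj \<kappa> = 2 * cnj \<kappa>"
    by simp
  finally show ?thesis
    using \<kappa> by (simp add: norm_divide norm_mult)
qed

text \<open>At a zero the derivative is the value of the cofactor, which spares the quotient rule
  for both maps differentiated at \<open>\<kappa>\<close> below.\<close>

lemma DERIV_at_zero_factor:
  fixes q :: "complex \<Rightarrow> complex"
  assumes "q field_differentiable at a"
  shows "((\<lambda>p. (p - a) * q p) has_field_derivative q a) (at a)"
proof -
  obtain d where "(q has_field_derivative d) (at a)"
    using assms by (auto simp: field_differentiable_def)
  note [derivative_intros] = this
  show ?thesis
    by (rule derivative_eq_intros refl | simp)+
qed

lemma arc_product_derivative:
  fixes f h :: "complex \<Rightarrow> complex"
  assumes f: "f holomorphic_on ball 0 1" "\<And>z. cmod z < 1 \<Longrightarrow> cmod (f z) < 1"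
    and h: "h holomorphic_on ball 0 1" "\<And>z. cmod z < 1 \<Longrightarrow> cmod (h z) < 1"
    and arc: "\<And>\<zeta>. cmod \<zeta> = 1 \<Longrightarrow> (Im \<kappa>)\<^sup>2 - (Re \<kappa>)\<^sup>2 < Re (\<zeta> * cnj (- g)) \<Longrightarrow>
      \<exists>w. (f \<longlongrightarrow> w) (at \<zeta> within ball 0 1) \<and> (h \<longlongrightarrow> cnj w) (at \<zeta> within ball 0 1)"
    and gap: "\<And>\<zeta>. cmod \<zeta> = 1 \<Longrightarrow> Re (\<zeta> * cnj (- g)) < (Im \<kappa>)\<^sup>2 - (Re \<kappa>)\<^sup>2 \<Longrightarrow>
      \<exists>L. Re L = 0 \<and> ((\<lambda>z. (1 + f z * h z) / (1 - f z * h z)) \<longlongrightarrow> L) (at \<zeta> within ball 0 1)"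
    and zero: "f 0 * h 0 = 0"
    and D: "((\<lambda>z. f z * h z) has_field_derivative D) (at 0)"
  shows "D = - (of_real (Im \<kappa>))\<^sup>2 * cnj g"
proof -
  let ?z = "disc_map g \<kappa>"
  let ?H = "{p. 0 < Re p}" and ?Q = "{p. 0 < Re p \<and> 0 < Im p}"
  obtain S where S: "S holomorphic_on ?H" "\<And>p. 0 < Re p \<Longrightarrow> cmod (S p) \<le> 1"
    "\<And>p. 0 < Re p \<Longrightarrow> 0 < Im p \<Longrightarrow> S p = f (?z p)"
    "\<And>p. 0 < Re p \<Longrightarrow> Im p < 0 \<Longrightarrow> S p = cnj (h (?z (cnj p)))"
    using half_plane_extension[OF f h arc] by blast
  \<comment> \<open>Over the first quadrant the conjugated factor contributes \<open>h\<close>, so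
    \<open>s\<close> is the product pulled back. The definition makes sense on the whole half-plane
    and is symmetric under conjugation by construction.\<close>
  define s where "s p = S p * cnj (S (cnj p))" for p
  have s_eq: "s p = f (?z p) * h (?z p)" if "0 < Re p" "0 < Im p" for p
    using S(3)[OF that] S(4)[of "cnj p"] that by (simp add: s_def)
  have s_formula: "s p = (p - \<kappa>) * (p - cnj \<kappa>) / ((p + \<kappa>) * (p + cnj \<kappa>))" if p: "0 < Re p" for p
  proof (rule half_plane_rigidity[OF _ _ _ \<kappa> _ _ p])
    have "cnj ` ?H = ?H"
      by (auto simp: image_iff intro!: exI[of _ "cnj _"])
    then have "cnj \<circ> S \<circ> cnj holomorphic_on ?H"
      using S(1) open_halfspace_Re_gt by (intro holomorphic_on_compose_cnj_cnj) auto
    then show "s holomorphic_on ?H"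
      unfolding s_def[abs_def] using S(1) by (auto simp: o_def intro!: holomorphic_intros)
    show "cmod (s p) \<le> 1" if "0 < Re p" for p
      using S(2)[of p] S(2)[of "cnj p"] that by (auto simp: s_def norm_mult intro!: mult_le_one)
    show "s \<kappa> = 0"
      using s_eq[OF \<kappa>(1,2)] by (simp add: disc_map_kappa zero)
    show "s (cnj p) = cnj (s p)" for p
      by (simp add: s_def mult.commute)
    show "\<exists>L. Re L = 0 \<and> ((\<lambda>p. (1 + s p) / (1 - s p)) \<longlongrightarrow> L) (at (\<i> * of_real y) within ?H)"
      if y: "0 < y" for y
    proof -
      have y2: "(\<i> * complex_of_real y)\<^sup>2 = of_real (- y\<^sup>2)" "- y\<^sup>2 \<noteq> 0" "- y\<^sup>2 < 0"
        using y by (auto simp: power_mult_distrib)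
      obtain L where L: "Re L = 0"
        "((\<lambda>z. (1 + f z * h z) / (1 - f z * h z)) \<longlongrightarrow> L) (at (?z (\<i> * of_real y)) within ball 0 1)"
        using gap[OF disc_map_axes(2)[OF y2(1,2)] disc_map_axes(4)[OF y2]] by blast
      have "((\<lambda>p. (1 + f (?z p) * h (?z p)) / (1 - f (?z p) * h (?z p))) \<longlongrightarrow> L) (at (\<i> * of_real y) within ?Q)"
        by (rule filterlim_compose[OF L(2) disc_map_boundary[OF y2(1,2)]])
      then have "((\<lambda>p. (1 + s p) / (1 - s p)) \<longlongrightarrow> L) (at (\<i> * of_real y) within ?Q)"
        by (rule Lim_transform_eventually) (simp add: eventually_at_filter s_eq)
      \<comment> \<open>Near a point of the positive imaginary axis the half-plane and the quadrant
        coincide.\<close>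
      moreover have "at (\<i> * of_real y) within ?Q = at (\<i> * of_real y) within ?H"
        by (rule at_within_nhd[of _ "{p. 0 < Im p}"]) (use y open_halfspace_Im_gt in auto)
      ultimately show ?thesis
        using L(1) by auto
    qed
  qed
  have nz: "\<kappa> \<noteq> 0" "cnj \<kappa> \<noteq> 0" "\<kappa> + cnj \<kappa> \<noteq> 0" "\<kappa> - cnj \<kappa> \<noteq> 0"
    using \<kappa> by (auto simp: complex_eq_iff)
  have g0: "g \<noteq> 0"
    using g by auto
  have \<kappa>2: "\<kappa> * \<kappa>\<^sup>2 - cnj \<kappa> \<noteq> 0"
    by (rule disc_map_quadrant(1)[OF \<kappa>(1,2)])
  \<comment> \<open>\<open>r\<close> and \<open>m\<close> are the cofactors of
    \<open>p - \<kappa>\<close> in the Blaschke product and in \<open>disc_map\<close>.\<close>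
  define r where "r p = (p - cnj \<kappa>) / ((p + \<kappa>) * (p + cnj \<kappa>))" for p
  define m where "m p = g * cnj \<kappa> * (p + \<kappa>) / (\<kappa> * p\<^sup>2 - cnj \<kappa>)" for p
  have map_m: "?z p = (p - \<kappa>) * m p" for p
  proof -
    have "cnj \<kappa> * p\<^sup>2 - \<kappa> = cnj \<kappa> * p\<^sup>2 - \<kappa> * (\<kappa> * cnj \<kappa>)"
      by (simp only: kappa_cnj mult_1_right)
    also have "\<dots> = cnj \<kappa> * ((p - \<kappa>) * (p + \<kappa>))"
      by (simp add: power2_eq_square algebra_simps)
    finally show ?thesis
      by (simp add: disc_map_def m_def)
  qed
  have "r field_differentiable at \<kappa>" "m field_differentiable at \<kappa>"
    unfolding r_def[abs_def] m_def[abs_def] using nz \<kappa>2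
    by (auto intro!: derivative_intros simp: mult_2[symmetric])
  then have dr: "((\<lambda>p. (p - \<kappa>) * r p) has_field_derivative r \<kappa>) (at \<kappa>)"
    and dm: "(?z has_field_derivative m \<kappa>) (at \<kappa>)"
    unfolding map_m[abs_def] by (auto intro: DERIV_at_zero_factor)
  have "((\<lambda>p. f (?z p) * h (?z p)) has_field_derivative D * m \<kappa>) (at \<kappa>)"
    using DERIV_chain2[OF _ dm, of "\<lambda>z. f z * h z" D] D by (simp add: disc_map_kappa)
  moreover have "((\<lambda>p. f (?z p) * h (?z p)) has_field_derivative r \<kappa>) (at \<kappa>)"
  proof (rule has_field_derivative_transform_within_open[OF dr])
    show "open ?Q"
      by (intro open_Collect_conj open_halfspace_Re_gt open_halfspace_Im_gt)
    show "\<kappa> \<in> ?Q" using \<kappa> by simp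
    show "(p - \<kappa>) * r p = f (?z p) * h (?z p)" if "p \<in> ?Q" for p
      using that s_formula[of p] s_eq[of p] by (simp add: r_def)
  qed
  ultimately have Dm: "D * m \<kappa> = r \<kappa>"
    by (rule DERIV_unique)
  have "\<kappa> * \<kappa>\<^sup>2 - cnj \<kappa> = \<kappa> * ((\<kappa> - cnj \<kappa>) * (\<kappa> + cnj \<kappa>))"
  proof -
    have "\<kappa> * ((\<kappa> - cnj \<kappa>) * (\<kappa> + cnj \<kappa>)) = \<kappa> * \<kappa>\<^sup>2 - cnj \<kappa> * (\<kappa> * cnj \<kappa>)"
      by (simp add: power2_eq_square algebra_simps)
    then show ?thesis by (simp add: kappa_cnj)
  qed
  then have "m \<kappa> = g * (\<kappa> * cnj \<kappa>) * 2 / (\<kappa> * ((\<kappa> - cnj \<kappa>) * (\<kappa> + cnj \<kappa>)))"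
    by (simp add: m_def)
  then have m: "m \<kappa> = 2 * g / (\<kappa> * ((\<kappa> - cnj \<kappa>) * (\<kappa> + cnj \<kappa>)))"
    by (simp add: kappa_cnj mult.commute)
  have r: "r \<kappa> = (\<kappa> - cnj \<kappa>) / (2 * \<kappa> * (\<kappa> + cnj \<kappa>))"
    by (simp add: r_def)
  have "D * (4 * g) = (D * m \<kappa>) * (2 * (\<kappa> * ((\<kappa> - cnj \<kappa>) * (\<kappa> + cnj \<kappa>))))"
    unfolding m using nz by simp
  also have "\<dots> = (\<kappa> - cnj \<kappa>)\<^sup>2"
    unfolding Dm r using nz by (simp add: power2_eq_square)
  also have "\<kappa> - cnj \<kappa> = 2 * \<i> * of_real (Im \<kappa>)"
    by (simp add: complex_eq_iff)
  also have "(2 * \<i> * complex_of_real (Im \<kappa>))\<^sup>2 = 4 * (- (of_real (Im \<kappa>))\<^sup>2)"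
    by (simp only: power_mult_distrib i_squared) simp
  also have "D * (4 * g) = 4 * (D * g)"
    by (simp only: mult_ac)
  finally have "D * g = - (of_real (Im \<kappa>))\<^sup>2"
    by (simp only: mult_cancel_left) simp
  then have "D * g * cnj g = - (of_real (Im \<kappa>))\<^sup>2 * cnj g"
    by (simp only:)
  then show ?thesis
    by (simp only: mult.assoc g_cnj mult_1_right)
qed

end

section \<open>Reflectionless coefficients on an arc\<close>

lemma in_arc_open:
  assumes "cmod \<zeta> = 1" "cos \<phi> < Re (\<zeta> * cnj (cis m))" "0 \<le> \<phi>" "\<phi> \<le> pi"
  obtains t where "\<zeta> = cis t" "m - \<phi> < t" "t < m + \<phi>"
proof -
  define u where "u = Arg (\<zeta> * cnj (cis m))"
  have n: "cmod (\<zeta> * cnj (cis m)) = 1"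
    using assms(1) by (simp add: norm_mult)
  then have "\<zeta> * cnj (cis m) \<noteq> 0"
    by (metis norm_zero zero_neq_one)
  from cis_Arg[OF this] have u: "\<zeta> * cnj (cis m) = cis u"
    unfolding u_def sgn_div_norm n by simp
  have u_bound: "\<bar>u\<bar> \<le> pi"
    using mpi_less_Arg[of "\<zeta> * cnj (cis m)"] Arg_le_pi[of "\<zeta> * cnj (cis m)"]
    by (simp add: u_def abs_le_iff)
  have "cos \<phi> < cos \<bar>u\<bar>"
    using assms(2) unfolding u by simp
  then have "\<bar>u\<bar> < \<phi>"
    using cos_mono_less_eq[of \<phi> "\<bar>u\<bar>"] assms(3,4) u_bound by simp
  moreover have "\<zeta> = cis (m + u)"
  proof -
    have "cis (m + u) = \<zeta> * (cis m * cnj (cis m))"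
      unfolding cis_mult[symmetric] u[symmetric] by (simp only: mult_ac)
    then show ?thesis
      by (simp add: cis_cnj cis_mult)
  qed
  ultimately show ?thesis
    using that[of "m + u"] by auto
qed

lemma arc_closed_Re_ge:
  assumes "\<zeta> \<in> arc_closed (m - \<phi>) (m + \<phi>)" "\<phi> \<le> pi"
  shows "cos \<phi> \<le> Re (\<zeta> * cnj (cis m))"
proof -
  obtain t where t: "\<zeta> = cis t" "m - \<phi> \<le> t" "t \<le> m + \<phi>"
    using assms(1) by (auto simp: arc_closed_def)
  have "cos \<phi> \<le> cos \<bar>t - m\<bar>"
    using t assms(2) by (intro cos_monotone_0_pi_le) auto
  also have "\<dots> = Re (\<zeta> * cnj (cis m))"
    by (simp add: t(1) cis_cnj cis_mult)
  finally show ?thesis .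
qed

text \<open>A connected set with more than one point has no isolated points. Hence the discrete
  spectrum is empty, and the reflectionless condition is available on the whole arc.\<close>

lemma arc_not_isolated:
  assumes "s < t" "t \<le> s + 2 * pi"
  shows "\<not> z isolated_in arc_closed s t"
proof
  assume iso: "z isolated_in arc_closed s t"
  have arc: "arc_closed s t = cis ` {s..t}"
    by (auto simp: arc_closed_def image_def)
  have "connected (arc_closed s t)"
    unfolding arc by (intro connected_continuous_image continuous_intros connected_Icc)
  moreover have "\<nexists>a. arc_closed s t = {a}"
  proof
    assume "\<exists>a. arc_closed s t = {a}"
    \<comment> \<open>The second point is the midpoint and not \<open>cis t\<close>, because the
      endpoints coincide on the full circle.\<close>
    moreover have "cis s \<in> arc_closed s t" "cis ((s + t) / 2) \<in> arc_closed s t"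
      unfolding arc using assms(1) by (auto intro!: imageI)
    ultimately have "cis s = cis ((s + t) / 2)"
      by (metis singletonD)
    then have "cis ((s + t) / 2 - s) = 1"
      unfolding cis_divide[symmetric] by simp
    moreover have "(s + t) / 2 - s = (t - s) / 2"
      by (simp add: field_simps)
    ultimately have "cos ((t - s) / 2) = 1"
      by (simp only: complex_eq_iff cis.sel one_complex.sel)
    moreover have "cos ((t - s) / 2) < cos 0"
      using assms by (intro cos_monotone_0_pi) auto
    ultimately show False by simp
  qed
  ultimately have lim: "z islimpt arc_closed s t"
    using iso by (intro connected_imp_perfect) (auto simp: isolated_in_def)
  obtain T where "open T" "T \<inter> arc_closed s t = {z}"
    using iso by (auto simp: isolated_in_def)
  with lim show False
    unfolding islimpt_def by (metis IntI IntD1 singletonD singletonI)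
qed

text \<open>The arc may start anywhere in \<open>{0..2 * pi}\<close> and have length up to
  \<open>2 * pi\<close>, so its parameters run through two periods. The second period follows from
  the first by translation invariance.\<close>

lemma AE_mu0_imp_AE_lborel:
  assumes "AE \<zeta> in mu0. P \<zeta>"
  shows "AE t in lborel. t \<in> {0..4 * pi} \<longrightarrow> P (cis t)"
proof -
  have "cis \<in> borel_measurable borel"
    by (intro borel_measurable_continuous_onI continuous_intros)
  then have cis: "cis \<in> measurable (uniform_measure lborel {0..2 * pi}) (restrict_space borel (sphere 0 1))"
    by (auto intro!: measurable_restrict_space2 simp: dist_norm)
  have "AE t in uniform_measure lborel {0..2 * pi}. P (cis t)"
    using AE_distrD[OF cis] assms unfolding mu0_def by blast
  then have 1: "AE t in lborel. t \<in> {0..2 * pi} \<longrightarrow> P (cis t)"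
    by (subst (asm) AE_uniform_measure) auto
  have "AE t in distr lborel borel ((+) (- 2 * pi)). t \<in> {0..2 * pi} \<longrightarrow> P (cis t)"
    using 1 unfolding lborel_distr_plus .
  then have "AE t in lborel. - 2 * pi + t \<in> {0..2 * pi} \<longrightarrow> P (cis (- 2 * pi + t))"
    by (rule AE_distrD[rotated]) simp
  with 1 show ?thesis
  proof eventually_elim
    case (elim t)
    have "cis (- 2 * pi + t) = cis t"
      by (simp add: complex_eq_iff cos_diff sin_diff)
    then show ?case
      using elim by auto
  qed
qed

lemma half_angle_identity: "(cos (\<phi> / 2))\<^sup>2 - (sin (\<phi> / 2))\<^sup>2 = cos (\<phi> :: real)"
  using cos_double[of "\<phi> / 2"] by simp

text \<open>\<open>cis m\<close> is the midpoint of the arc and \<open>\<phi>\<close> its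
  half-length. In these terms the ratio is \<open>- cis m\<close> and the modulus to be proved is
  \<open>cos (\<phi> / 2)\<close>.\<close>

locale reflectionless_arc =
  fixes \<alpha> :: "int \<Rightarrow> complex" and m \<phi> :: real
  assumes verblunsky: "\<And>k. cmod (\<alpha> k) < 1"
    and refl: "reflectionless \<alpha>"
    and spectrum: "op_spectrum UNIV (cmv \<alpha>) = arc_closed (m - \<phi>) (m + \<phi>)"
    and \<phi>: "0 < \<phi>" "\<phi> \<le> pi"
    and range: "0 \<le> m - \<phi>" "m + \<phi> \<le> 4 * pi"
begin

lemma essential_spectrum_eq: "essential_spectrum UNIV (cmv \<alpha>) = arc_closed (m - \<phi>) (m + \<phi>)"
proof -
  have "\<not> z isolated_in arc_closed (m - \<phi>) (m + \<phi>)" for z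
    using \<phi> by (intro arc_not_isolated) auto
  then show ?thesis
    by (simp add: essential_spectrum_def discrete_spectrum_def spectrum)
qed

lemma schur_radial_limits:
  "AE t in lborel. t \<in> {m - \<phi><..<m + \<phi>} \<longrightarrow>
    ((\<lambda>r. schur_plus \<alpha> k (of_real r * cis t) - cnj (schur_minus \<alpha> k (of_real r * cis t))) \<longlongrightarrow> 0) (at_left 1)"
proof -
  have "AE \<zeta> in mu0. \<zeta> \<in> arc_closed (m - \<phi>) (m + \<phi>) \<longrightarrow>
        (\<exists>w\<^sub>p w\<^sub>m. has_radial_limit (\<lambda>z. M_plus \<alpha> z k) \<zeta> w\<^sub>p \<and>
                 has_radial_limit (\<lambda>z. M_minus \<alpha> z k) \<zeta> w\<^sub>m \<and> w\<^sub>p = - cnj w\<^sub>m)"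
    using refl unfolding reflectionless_def essential_spectrum_eq by blast
  from AE_mu0_imp_AE_lborel[OF this] show ?thesis
  proof (rule AE_mp, intro AE_I2 impI)
    fix t assume *: "t \<in> {0..4 * pi} \<longrightarrow> cis t \<in> arc_closed (m - \<phi>) (m + \<phi>) \<longrightarrow>
        (\<exists>w\<^sub>p w\<^sub>m. has_radial_limit (\<lambda>z. M_plus \<alpha> z k) (cis t) w\<^sub>p \<and>
                 has_radial_limit (\<lambda>z. M_minus \<alpha> z k) (cis t) w\<^sub>m \<and> w\<^sub>p = - cnj w\<^sub>m)"
      and t: "t \<in> {m - \<phi><..<m + \<phi>}"
    have "t \<in> {0..4 * pi}"
      using t range by simp
    moreover have "cis t \<in> arc_closed (m - \<phi>) (m + \<phi>)"
      using t by (auto simp: arc_closed_def)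
    ultimately obtain p q where lim: "has_radial_limit (\<lambda>z. M_plus \<alpha> z k) (cis t) p"
      "has_radial_limit (\<lambda>z. M_minus \<alpha> z k) (cis t) q" "p = - cnj q"
      using * by blast
    define c where "c r = of_real r * cis t" for r
    have p: "((\<lambda>r. M_plus \<alpha> (c r) k) \<longlongrightarrow> p) (at_left 1)"
      and q: "((\<lambda>r. M_minus \<alpha> (c r) k) \<longlongrightarrow> q) (at_left 1)"
      using lim(1,2) by (simp_all add: has_radial_limit_def c_def)
    have "\<forall>\<^sub>F r in at_left (1::real). 0 < r \<and> r < 1"
      using eventually_at_left_real[of 0 "1::real"] by simp
    then have disc: "\<forall>\<^sub>F r in at_left 1. cmod (c r) < 1"
      by eventually_elim (simp add: c_def norm_mult)
    \<comment> \<open>Only the weak inequality survives the limit, but it keeps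
      \<open>p + 1\<close>, and with it \<open>q - 1 = - cnj (p + 1)\<close>, away from 0.\<close>
    have "0 \<le> Re p"
    proof (rule tendsto_lowerbound[OF tendsto_Re[OF p]])
      show "\<forall>\<^sub>F r in at_left 1. 0 \<le> Re (M_plus \<alpha> (c r) k)"
        using disc by eventually_elim (simp add: schur_plus_M_plus(2)[where \<alpha> = \<alpha>, OF verblunsky] less_imp_le)
    qed simp
    then have p1: "p + 1 \<noteq> 0"
      by (auto simp: complex_eq_iff)
    have q_eq: "q = - cnj p"
      using lim(3) by simp
    have q1: "q - 1 \<noteq> 0"
    proof -
      have "q - 1 = - cnj (p + 1)"
        by (simp add: q_eq)
      then show ?thesis
        using p1 by (metis complex_cnj_zero_iff neg_equal_0_iff_equal)
    qed
    have "((\<lambda>r. (M_plus \<alpha> (c r) k - 1) / (M_plus \<alpha> (c r) k + 1)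
        - cnj ((M_minus \<alpha> (c r) k + 1) / (M_minus \<alpha> (c r) k - 1)))
        \<longlongrightarrow> (p - 1) / (p + 1) - cnj ((q + 1) / (q - 1))) (at_left 1)"
      by (intro tendsto_intros p q p1 q1)
    also have "(p - 1) / (p + 1) - cnj ((q + 1) / (q - 1)) = 0"
    proof -
      have "cnj ((q + 1) / (q - 1)) = (- (p - 1)) / (- (p + 1))"
        by (simp add: q_eq)
      then show ?thesis
        by (simp only: minus_divide_divide) simp
    qed
    finally have "((\<lambda>r. (M_plus \<alpha> (c r) k - 1) / (M_plus \<alpha> (c r) k + 1)
        - cnj ((M_minus \<alpha> (c r) k + 1) / (M_minus \<alpha> (c r) k - 1))) \<longlongrightarrow> 0) (at_left 1)" .
    then show "((\<lambda>r. schur_plus \<alpha> k (of_real r * cis t) - cnj (schur_minus \<alpha> k (of_real r * cis t))) \<longlongrightarrow> 0) (at_left 1)"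
      unfolding c_def[symmetric]
    proof (rule Lim_transform_eventually)
      show "\<forall>\<^sub>F r in at_left 1. (M_plus \<alpha> (c r) k - 1) / (M_plus \<alpha> (c r) k + 1)
        - cnj ((M_minus \<alpha> (c r) k + 1) / (M_minus \<alpha> (c r) k - 1))
        = schur_plus \<alpha> k (c r) - cnj (schur_minus \<alpha> k (c r))"
        using disc
        by eventually_elim
          (simp only: schur_plus_M_plus(1)[where \<alpha> = \<alpha>, OF verblunsky] schur_minus_M_minus[where \<alpha> = \<alpha>, OF verblunsky])
    qed
  qed
qed

lemma schur_arc_limits:
  assumes "cmod \<zeta> = 1" "cos \<phi> < Re (\<zeta> * cnj (cis m))"
  shows "\<exists>w. (schur_plus \<alpha> k \<longlongrightarrow> w) (at \<zeta> within ball 0 1) \<and>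
    (schur_minus \<alpha> k \<longlongrightarrow> cnj w) (at \<zeta> within ball 0 1)"
proof -
  obtain t where t: "\<zeta> = cis t" "m - \<phi> < t" "t < m + \<phi>"
    using in_arc_open[OF assms] \<phi> by auto
  obtain w where "(schur_plus \<alpha> k \<longlongrightarrow> w) (at (cis t) within ball 0 1)"
    "(schur_minus \<alpha> k \<longlongrightarrow> cnj w) (at (cis t) within ball 0 1)"
    by (rule glue_across_arc[OF schur_holomorphic(1)[where \<alpha> = \<alpha>, OF verblunsky] _ schur_holomorphic(3)[where \<alpha> = \<alpha>, OF verblunsky] _
          schur_radial_limits t(2,3)])
       (simp_all add: schur_lt_1[where \<alpha> = \<alpha>, OF verblunsky] less_imp_le)
  then show ?thesis
    unfolding t(1) by blast
qed

text \<open>\<open>arc_Schwarz_bound\<close> is applied to the concentric subarc of half-length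
  \<open>pi - 2 * \<psi>\<close>, with \<open>\<kappa> = cis \<psi>\<close>. The freedom in
  \<open>\<psi>\<close> matters on the full circle, where the subarc leaves an artificial gap that
  can be shrunk.\<close>

lemma verblunsky_bound:
  assumes "0 < \<psi>" "\<psi> < pi / 2" "pi - 2 * \<psi> \<le> \<phi>"
  shows "cmod (\<alpha> k) \<le> sin \<psi>"
proof -
  have "cmod (schur_minus \<alpha> k 0) \<le> Im (cis \<psi>)"
  proof (rule arc_Schwarz_bound[where f = "schur_plus \<alpha> k" and g = "- cis m"])
    show "0 < Re (cis \<psi>)" "0 < Im (cis \<psi>)"
      using assms by (auto simp: cos_gt_zero sin_gt_zero)
    show "\<exists>w. (schur_plus \<alpha> k \<longlongrightarrow> w) (at \<zeta> within ball 0 1) \<and>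
        (schur_minus \<alpha> k \<longlongrightarrow> cnj w) (at \<zeta> within ball 0 1)"
      if "cmod \<zeta> = 1" "(Im (cis \<psi>))\<^sup>2 - (Re (cis \<psi>))\<^sup>2 < Re (\<zeta> * cnj (- (- cis m)))" for \<zeta>
    proof (rule schur_arc_limits[OF that(1)])
      have "cos \<phi> \<le> cos (pi - 2 * \<psi>)"
        using assms \<phi> by (intro cos_monotone_0_pi_le) auto
      also have "\<dots> = (sin \<psi>)\<^sup>2 - (cos \<psi>)\<^sup>2"
        using cos_double[of \<psi>] by simp
      also have "\<dots> < Re (\<zeta> * cnj (cis m))"
        using that(2) by simp
      finally show "cos \<phi> < Re (\<zeta> * cnj (cis m))" .
    qed
  qed (simp_all add: schur_holomorphic[where \<alpha> = \<alpha>, OF verblunsky] schur_lt_1[where \<alpha> = \<alpha>, OF verblunsky] schur_at_0[where \<alpha> = \<alpha>, OF verblunsky])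
  then show ?thesis
    by (simp add: schur_at_0[where \<alpha> = \<alpha>, OF verblunsky])
qed

section \<open>Limits at the gap, products of neighbouring coefficients and the geometric
  form\<close>

lemma gap_limits:
  assumes k: "even k" and \<zeta>: "cmod \<zeta> = 1" "Re (\<zeta> * cnj (cis m)) < cos \<phi>"
  shows "\<exists>L. Re L = 0 \<and> ((\<lambda>z. (1 + schur_plus \<alpha> k z * schur_minus \<alpha> k z) /
      (1 - schur_plus \<alpha> k z * schur_minus \<alpha> k z)) \<longlongrightarrow> L) (at \<zeta> within ball 0 1)"
    and "\<exists>L. Re L = 0 \<and> ((\<lambda>z. (1 + schur_sigma \<alpha> k z * schur_tau \<alpha> k z) /
      (1 - schur_sigma \<alpha> k z * schur_tau \<alpha> k z)) \<longlongrightarrow> L) (at \<zeta> within ball 0 1)"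
proof -
  have "\<zeta> \<notin> op_spectrum UNIV (cmv \<alpha>)"
    using arc_closed_Re_ge[of \<zeta> m \<phi>] \<phi> \<zeta>(2) unfolding spectrum by auto
  then have res: "\<zeta> \<in> resolvent_set UNIV (cmv \<alpha>)"
    by (simp add: op_spectrum_def)
  have "\<forall>z. \<exists>u v. cmod z < 1 \<longrightarrow> square_summable u \<and> (\<forall>n. cmv \<alpha> u n = z * u n + delta k n) \<and>
      1 + 2 * z * u k = (1 + schur_plus \<alpha> k z * schur_minus \<alpha> k z) / (1 - schur_plus \<alpha> k z * schur_minus \<alpha> k z) \<and>
      square_summable v \<and> (\<forall>n. cmv \<alpha> v n = z * v n + delta (k - 1) n) \<and>
      1 + 2 * z * v (k - 1) = (1 + schur_sigma \<alpha> k z * schur_tau \<alpha> k z) / (1 - schur_sigma \<alpha> k z * schur_tau \<alpha> k z)"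
    using green_function[where \<alpha> = \<alpha>, OF verblunsky k] by (metis (no_types, lifting))
  then obtain u v where uv: "\<And>z. cmod z < 1 \<Longrightarrow> square_summable (u z) \<and> (\<forall>n. cmv \<alpha> (u z) n = z * u z n + delta k n) \<and>
      1 + 2 * z * u z k = (1 + schur_plus \<alpha> k z * schur_minus \<alpha> k z) / (1 - schur_plus \<alpha> k z * schur_minus \<alpha> k z) \<and>
      square_summable (v z) \<and> (\<forall>n. cmv \<alpha> (v z) n = z * v z n + delta (k - 1) n) \<and>
      1 + 2 * z * v z (k - 1) = (1 + schur_sigma \<alpha> k z * schur_tau \<alpha> k z) / (1 - schur_sigma \<alpha> k z * schur_tau \<alpha> k z)"
    by metis
  obtain L where L: "Re L = 0" "((\<lambda>z. 1 + 2 * z * u z k) \<longlongrightarrow> L) (at \<zeta> within ball 0 1)"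
    using green_function_gap_limit[where \<alpha> = \<alpha>, OF verblunsky res \<zeta>(1), of u k] uv by blast
  have "((\<lambda>z. (1 + schur_plus \<alpha> k z * schur_minus \<alpha> k z) /
      (1 - schur_plus \<alpha> k z * schur_minus \<alpha> k z)) \<longlongrightarrow> L) (at \<zeta> within ball 0 1)"
    by (rule Lim_transform_eventually[OF L(2)])
       (use uv in \<open>auto simp: eventually_at_filter intro!: always_eventually\<close>)
  then show "\<exists>L. Re L = 0 \<and> ((\<lambda>z. (1 + schur_plus \<alpha> k z * schur_minus \<alpha> k z) /
      (1 - schur_plus \<alpha> k z * schur_minus \<alpha> k z)) \<longlongrightarrow> L) (at \<zeta> within ball 0 1)"
    using L(1) by blast
  obtain L' where L': "Re L' = 0" "((\<lambda>z. 1 + 2 * z * v z (k - 1)) \<longlongrightarrow> L') (at \<zeta> within ball 0 1)"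
    using green_function_gap_limit[where \<alpha> = \<alpha>, OF verblunsky res \<zeta>(1), of v "k - 1"] uv by blast
  have "((\<lambda>z. (1 + schur_sigma \<alpha> k z * schur_tau \<alpha> k z) /
      (1 - schur_sigma \<alpha> k z * schur_tau \<alpha> k z)) \<longlongrightarrow> L') (at \<zeta> within ball 0 1)"
    by (rule Lim_transform_eventually[OF L'(2)])
       (use uv in \<open>auto simp: eventually_at_filter intro!: always_eventually\<close>)
  then show "\<exists>L. Re L = 0 \<and> ((\<lambda>z. (1 + schur_sigma \<alpha> k z * schur_tau \<alpha> k z) /
      (1 - schur_sigma \<alpha> k z * schur_tau \<alpha> k z)) \<longlongrightarrow> L) (at \<zeta> within ball 0 1)"
    using L'(1) by blast
qed

text \<open>Conjugation intertwines the Moebius maps with parameters \<open>\<alpha> k\<close> and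
  \<open>cnj (\<alpha> k)\<close>, so the relation between boundary values passes to the second
  pair. \<open>schur_tau\<close> is recovered from \<open>schur_minus\<close> because the Moebius
  map is an involution.\<close>

lemma sigma_tau_arc_limits:
  assumes "cmod \<zeta> = 1" "cos \<phi> < Re (\<zeta> * cnj (cis m))"
  shows "\<exists>w. (schur_sigma \<alpha> k \<longlongrightarrow> w) (at \<zeta> within ball 0 1) \<and>
    (schur_tau \<alpha> k \<longlongrightarrow> cnj w) (at \<zeta> within ball 0 1)"
proof -
  obtain w where w: "(schur_plus \<alpha> k \<longlongrightarrow> w) (at \<zeta> within ball 0 1)"
    "(schur_minus \<alpha> k \<longlongrightarrow> cnj w) (at \<zeta> within ball 0 1)"
    using schur_arc_limits[OF assms] by blast
  have w1: "cmod w \<le> 1"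
  proof (rule Lim_norm_ubound[OF at_within_disc_ne_bot[OF assms(1)] w(1)])
    show "\<forall>\<^sub>F z in at \<zeta> within ball 0 1. norm (schur_plus \<alpha> k z) \<le> 1"
      unfolding eventually_at_filter
      by (intro always_eventually) (auto simp: schur_lt_1[where \<alpha> = \<alpha>, OF verblunsky] less_imp_le)
  qed
  have "(schur_sigma \<alpha> k \<longlongrightarrow> disc_moebius (cnj (\<alpha> k)) w) (at \<zeta> within ball 0 1)"
    unfolding schur_sigma_def[abs_def] by (rule disc_moebius_tendsto[OF _ w1 w(1)]) (simp add: verblunsky)
  moreover have "((\<lambda>z. disc_moebius (\<alpha> k) (schur_minus \<alpha> k z)) \<longlongrightarrow> disc_moebius (\<alpha> k) (cnj w)) (at \<zeta> within ball 0 1)"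
    by (rule disc_moebius_tendsto[OF verblunsky _ w(2)]) (simp add: w1)
  then have "(schur_tau \<alpha> k \<longlongrightarrow> disc_moebius (\<alpha> k) (cnj w)) (at \<zeta> within ball 0 1)"
  proof (rule Lim_transform_eventually)
    show "\<forall>\<^sub>F z in at \<zeta> within ball 0 1. disc_moebius (\<alpha> k) (schur_minus \<alpha> k z) = schur_tau \<alpha> k z"
      unfolding eventually_at_filter schur_minus_def
      by (intro always_eventually)
         (auto simp: disc_moebius_involution[OF verblunsky] schur_lt_1[where \<alpha> = \<alpha>, OF verblunsky])
  qed
  ultimately show ?thesis
    by (intro exI[of _ "disc_moebius (cnj (\<alpha> k)) w"]) (simp add: cnj_disc_moebius)
qed

text \<open>One factor of each pair vanishes at 0, so the derivative of the product there is the
  derivative of that factor times the value of the other. For even \<open>k\<close> the first pair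
  yields the product for \<open>k, k + 1\<close> and the second that for \<open>k - 1, k\<close>;
  together they reach every \<open>j\<close>.\<close>

lemma consecutive_product:
  assumes \<phi>_lt: "\<phi> < pi"
  shows "\<alpha> j * cnj (\<alpha> (j + 1)) = (of_real (cos (\<phi> / 2)))\<^sup>2 * cnj (- cis m)"
proof -
  \<comment> \<open>\<open>\<kappa>\<close> has argument \<open>pi / 2 - \<phi> / 2\<close>, which
    makes the threshold of \<open>disc_map_axes\<close> equal to \<open>cos \<phi>\<close>. The gap
    being nonempty, it lies inside the first quadrant.\<close>
  define \<kappa> where "\<kappa> = Complex (sin (\<phi> / 2)) (cos (\<phi> / 2))"
  have \<kappa>: "0 < Re \<kappa>" "0 < Im \<kappa>" "cmod \<kappa> = 1"
    using \<phi> \<phi>_lt by (auto simp: \<kappa>_def cmod_def sin_gt_zero cos_gt_zero)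
  have id: "(Im \<kappa>)\<^sup>2 - (Re \<kappa>)\<^sup>2 = cos \<phi>"
    by (simp add: \<kappa>_def half_angle_identity)
  have g: "cmod (- cis m) = 1"
    by simp
  have even_case: "\<alpha> k * cnj (\<alpha> (k + 1)) = (of_real (Im \<kappa>))\<^sup>2 * cnj (- cis m)"
    "\<alpha> (k - 1) * cnj (\<alpha> k) = (of_real (Im \<kappa>))\<^sup>2 * cnj (- cis m)" if k: "even k" for k
  proof -
    obtain d where d: "(schur_minus \<alpha> k has_field_derivative d) (at 0)"
      using holomorphic_derivI[OF schur_holomorphic(3)[where \<alpha> = \<alpha>, OF verblunsky] open_ball, of 0] by auto
    have "((\<lambda>z. schur_plus \<alpha> k z * schur_minus \<alpha> k z) has_field_derivative
        - cnj (\<alpha> (k + 1)) * \<alpha> k) (at 0)"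
      using DERIV_mult[OF schur_deriv_0(1)[where \<alpha> = \<alpha>, OF verblunsky k] d] by (simp add: schur_at_0[where \<alpha> = \<alpha>, OF verblunsky])
    note D1 = this
    have "- cnj (\<alpha> (k + 1)) * \<alpha> k = - (of_real (Im \<kappa>))\<^sup>2 * cnj (- cis m)"
      by (rule arc_product_derivative[where f = "schur_plus \<alpha> k" and h = "schur_minus \<alpha> k", OF g \<kappa> _ _ _ _ _ _ _ D1])
         (use schur_arc_limits gap_limits(1)[OF k] in \<open>simp_all add: id schur_at_0[where \<alpha> = \<alpha>, OF verblunsky] schur_holomorphic[where \<alpha> = \<alpha>, OF verblunsky] schur_lt_1[where \<alpha> = \<alpha>, OF verblunsky]\<close>)
    then show "\<alpha> k * cnj (\<alpha> (k + 1)) = (of_real (Im \<kappa>))\<^sup>2 * cnj (- cis m)"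
      by (simp only: mult_minus_left neg_equal_iff_equal) (simp only: mult.commute)
    obtain d' where d': "(schur_sigma \<alpha> k has_field_derivative d') (at 0)"
      using holomorphic_derivI[OF schur_holomorphic(4)[where \<alpha> = \<alpha>, OF verblunsky] open_ball, of 0] by auto
    have "((\<lambda>z. schur_sigma \<alpha> k z * schur_tau \<alpha> k z) has_field_derivative
        - \<alpha> (k - 1) * cnj (\<alpha> k)) (at 0)"
      using DERIV_mult[OF d' schur_deriv_0(2)[where \<alpha> = \<alpha>, OF verblunsky k]] by (simp add: schur_at_0[where \<alpha> = \<alpha>, OF verblunsky] mult.commute)
    note D2 = this
    have "- \<alpha> (k - 1) * cnj (\<alpha> k) = - (of_real (Im \<kappa>))\<^sup>2 * cnj (- cis m)"
      by (rule arc_product_derivative[where f = "schur_sigma \<alpha> k" and h = "schur_tau \<alpha> k", OF g \<kappa> _ _ _ _ _ _ _ D2])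
         (use sigma_tau_arc_limits gap_limits(2)[OF k] in \<open>simp_all add: id schur_at_0[where \<alpha> = \<alpha>, OF verblunsky] schur_holomorphic[where \<alpha> = \<alpha>, OF verblunsky] schur_lt_1[where \<alpha> = \<alpha>, OF verblunsky]\<close>)
    then show "\<alpha> (k - 1) * cnj (\<alpha> k) = (of_real (Im \<kappa>))\<^sup>2 * cnj (- cis m)"
      by (simp only: mult_minus_left neg_equal_iff_equal)
  qed
  show ?thesis
    using even_case(1)[of j] even_case(2)[of "j + 1"] by (cases "even j") (simp_all add: \<kappa>_def)
qed

lemma verblunsky_norm: "cmod (\<alpha> k) = cos (\<phi> / 2)"
proof (cases "\<phi> < pi")
  case True
  have le: "cmod (\<alpha> j) \<le> cos (\<phi> / 2)" for j
  proof -
    have "cmod (\<alpha> j) \<le> sin (pi / 2 - \<phi> / 2)"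
      using \<phi> True by (intro verblunsky_bound) auto
    then show ?thesis
      by (simp add: sin_diff)
  qed
  have pos: "0 < cos (\<phi> / 2)"
    using \<phi> True by (intro cos_gt_zero) auto
  have "cmod (\<alpha> k) * cmod (\<alpha> (k + 1)) = (cos (\<phi> / 2))\<^sup>2"
    using arg_cong[OF consecutive_product[OF True, of k], of cmod]
    by (simp add: norm_mult norm_power)
  moreover have "cmod (\<alpha> k) * cmod (\<alpha> (k + 1)) \<le> cmod (\<alpha> k) * cos (\<phi> / 2)"
    by (intro mult_left_mono le) auto
  ultimately have "cos (\<phi> / 2) * cos (\<phi> / 2) \<le> cmod (\<alpha> k) * cos (\<phi> / 2)"
    by (simp add: power2_eq_square)
  then show ?thesis
    using le[of k] pos by simp
next
  case False
  then have \<phi>_eq: "\<phi> = pi" using \<phi> by simp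
  have "cmod (\<alpha> k) \<le> 0 + e" if e: "0 < e" for e
  proof -
    \<comment> \<open>Capping at 1 keeps \<open>\<psi>\<close> below \<open>pi / 2\<close>. On the
      full circle every such \<open>\<psi>\<close> is admissible, so the bound
      \<open>sin \<psi> \<le> e\<close> forces the coefficient to vanish.\<close>
    define \<psi> where "\<psi> = min e 1"
    have "cmod (\<alpha> k) \<le> sin \<psi>"
      using e pi_gt3 by (intro verblunsky_bound) (auto simp: \<psi>_def \<phi>_eq min_def)
    also have "\<dots> \<le> \<psi>"
      using e by (intro sin_x_le_x) (simp add: \<psi>_def)
    finally show ?thesis
      by (simp add: \<psi>_def)
  qed
  then have "cmod (\<alpha> k) \<le> 0"
    by (rule field_le_epsilon)
  then show ?thesis
    by (simp add: \<phi>_eq)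
qed

text \<open>Multiplying the product identity by \<open>\<alpha> (j + 1)\<close> produces its squared
  modulus, which equals the constant \<open>A\<close> on the other side and cancels; the phase
  remains. On the full circle all coefficients are 0.\<close>

lemma verblunsky_step: "\<alpha> (j + 1) = - cis m * \<alpha> j"
proof (cases "\<phi> < pi")
  case True
  define A where "A = complex_of_real ((cos (\<phi> / 2))\<^sup>2)"
  have A: "A \<noteq> 0"
    using \<phi> True cos_gt_zero[of "\<phi> / 2"] by (simp add: A_def)
  have norm_sq: "\<alpha> (j + 1) * cnj (\<alpha> (j + 1)) = A"
    by (simp add: A_def complex_norm_square[symmetric] verblunsky_norm)
  have g: "(- cis m) * cnj (- cis m) = 1"
    by (simp add: cis_cnj cis_mult)
  have prod: "\<alpha> j * cnj (\<alpha> (j + 1)) = A * cnj (- cis m)"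
    using consecutive_product[OF True, of j] by (simp add: A_def)
  have "A * \<alpha> j = (\<alpha> j * cnj (\<alpha> (j + 1))) * \<alpha> (j + 1)"
    unfolding norm_sq[symmetric] by (simp only: mult_ac)
  also have "\<dots> = A * (cnj (- cis m) * \<alpha> (j + 1))"
    unfolding prod by (simp only: mult_ac)
  finally have "\<alpha> j = cnj (- cis m) * \<alpha> (j + 1)"
    using A by (simp only: mult_cancel_left) simp
  then have "- cis m * \<alpha> j = ((- cis m) * cnj (- cis m)) * \<alpha> (j + 1)"
    by (simp only: mult_ac)
  then show ?thesis
    unfolding g by simp
next
  case False
  then have "\<phi> = pi" using \<phi> by simp
  then have "\<alpha> i = 0" for i
    using verblunsky_norm[of i] by simp
  then show ?thesis by simp
qed

lemma verblunsky_geometric: "\<alpha> k = \<alpha> 0 * (- cis m) powi k"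
proof (induction k rule: int_induct[where k = 0])
  case base
  then show ?case by simp
next
  case (step1 i)
  then show ?case
    using verblunsky_step[of i] by (simp add: power_int_add)
next
  case (step2 i)
  have "- cis m * \<alpha> (i - 1) = - cis m * (\<alpha> 0 * (- cis m) powi (i - 1))"
    using verblunsky_step[of "i - 1"] step2.IH power_int_add[of "- cis m" "i - 1" 1] by simp
  then show ?case
    by (simp only: mult_cancel_left) simp
qed

end

theorem theorem5p3:
  fixes \<alpha> :: "int \<Rightarrow> complex" and \<theta>\<^sub>0 \<theta>\<^sub>1 :: real and g :: complex
  defines "g \<equiv> - exp (\<i> * of_real ((\<theta>\<^sub>0 + \<theta>\<^sub>1) / 2))"
  assumes verblunsky: "\<And>k. cmod (\<alpha> k) < 1"
    and reflectionless: "reflectionless \<alpha>"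
    and spectrum: "op_spectrum UNIV (cmv \<alpha>) = arc_closed \<theta>\<^sub>0 \<theta>\<^sub>1"
    and theta0: "\<theta>\<^sub>0 \<in> {0..2 * pi}"
    and theta1: "\<theta>\<^sub>0 < \<theta>\<^sub>1" "\<theta>\<^sub>1 \<le> \<theta>\<^sub>0 + 2 * pi"
  shows "exp (\<i> * of_real ((\<theta>\<^sub>0 + \<theta>\<^sub>1) / 2)) \<in> arc_open \<theta>\<^sub>0 \<theta>\<^sub>1 \<and>
         (\<forall>k. \<alpha> k = \<alpha> 0 * g powi k) \<and>
         cmod (\<alpha> 0) = cos ((\<theta>\<^sub>1 - \<theta>\<^sub>0) / 4)"
proof -
  define m where "m = (\<theta>\<^sub>0 + \<theta>\<^sub>1) / 2"
  define \<phi> where "\<phi> = (\<theta>\<^sub>1 - \<theta>\<^sub>0) / 2"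
  have ends: "m - \<phi> = \<theta>\<^sub>0" "m + \<phi> = \<theta>\<^sub>1"
    by (simp_all add: m_def \<phi>_def field_simps)
  interpret reflectionless_arc \<alpha> m \<phi>
    by standard (use assms ends in \<open>auto simp: \<phi>_def\<close>)
  have exp: "exp (\<i> * of_real ((\<theta>\<^sub>0 + \<theta>\<^sub>1) / 2)) = cis m"
    by (simp add: cis_conv_exp m_def)
  have "cis m \<in> arc_open \<theta>\<^sub>0 \<theta>\<^sub>1"
    using theta1(1) by (auto simp: arc_open_def m_def intro!: exI[of _ "(\<theta>\<^sub>0 + \<theta>\<^sub>1) / 2"])
  then show ?thesis
    unfolding g_def exp
  proof (intro conjI allI)
    show "\<alpha> k = \<alpha> 0 * (- cis m) powi k" for k
      by (rule verblunsky_geometric)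
    show "cmod (\<alpha> 0) = cos ((\<theta>\<^sub>1 - \<theta>\<^sub>0) / 4)"
      using verblunsky_norm[of 0] by (simp add: \<phi>_def)
  qed
qed

end
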